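(* Suppose $C$ is a progressively measurable process with $C^{1-R}\in\mathbb{SO}_+$. Then there exist a unique CRRA-order solution, a unique extremal solution and a unique proper solution associated to $C$, and these three solutions coincide.
   Context: Work on a filtered probability space $(\Omega,\mathcal F,(\mathcal F_t)_{t\ge0},\mathbb P)$ whose filtration is complete and continuous, with $\mathcal F_0$ trivial; processes are identified up to indistinguishability. $\mathscr P_+$ (resp. $\mathscr P_{++}$) denotes nonnegative (resp. strictly positive) progressively measurable processes. Parameters $R,S\in(0,1)\cup(1,\infty)$ satisfy $\theta:=\frac{1-R}{1-S}>1$; $\rho:=\frac{\theta-1}{\theta}$. The Epstein--Zin aggregator is $f_{EZ}(c,v)=\frac{c^{1-S}}{1-S}((1-R)v)^{\rho}$ for $c\ge0$, $v\in(1-R)[0,\infty)$. Given $C\in\mathscr P_+$, a solution associated to $C$ is a càdlàg progressively measurable process $V$ with values in $(1-R)[0,\infty)$ such that $\mathbb E\int_0^\infty|f_{EZ}(C_s,V_s)|\,ds<\infty$ and $V_t=\mathbb E[\int_t^\infty f_{EZ}(C_s,V_s)\,ds\mid\mathcal F_t]$ for all $t\ge0$. For $X\in\mathscr P_+$ let $J^X_t=\mathbb E[\int_t^\infty X_s\,ds\mid\mathcal F_t]$. A solution $V$ is: proper if for every $t\ge0$, up to null sets, $(1-R)V_t>0$ on $\{J^{C^{1-R}}_t>0\}$; extremal if $(1-R)V\ge(1-R)Y$ for every solution $Y$ associated to $C$; a CRRA-order solution if there are constants $0<k\le K<\infty$ with $kJ^{C^{1-R}}\le(1-R)V\le KJ^{C^{1-R}}$.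 $\mathbb{SO}$ is the set of $X\in\mathscr P_{++}$ with $\mathbb E\int_0^\infty X_t\,dt<\infty$ such that $kJ^X\le X\le KJ^X$ for some constants $0<k\le K<\infty$; $\mathbb{SO}_\nu$ ($\nu\ge0$) is the set of $X\in\mathbb{SO}$ with $(e^{\nu t}X_t)_{t\ge0}\in\mathbb{SO}$, and $\mathbb{SO}_+=\bigcup_{\nu>0}\mathbb{SO}_\nu$. *)

theory Defs
  imports "HOL-Probability.Probability"
begin

text \<open>Setting: a probability space M with a filtration F indexed by real time t \<ge> 0.
  Processes are functions real \<Rightarrow> 'a \<Rightarrow> real; only times t \<ge> 0 matter.\<close>

definition usual_filtration :: "'a measure \<Rightarrow> (real \<Rightarrow> 'a measure) \<Rightarrow> bool" where
  "usual_filtration M F \<longleftrightarrow>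
     prob_space M
   \<and> (\<forall>t\<ge>0. subalgebra M (F t))
   \<and> (\<forall>s t. 0 \<le> s \<longrightarrow> s \<le> t \<longrightarrow> sets (F s) \<subseteq> sets (F t))
   \<comment> \<open>complete: F 0 contains all subsets of M-null sets\<close>
   \<and> (\<forall>N A. N \<in> null_sets M \<longrightarrow> A \<subseteq> N \<longrightarrow> A \<in> sets (F 0))
   \<comment> \<open>right-continuous\<close>
   \<and> (\<forall>t\<ge>0. sets (F t) = (\<Inter>s\<in>{t<..}. sets (F s)))
   \<comment> \<open>left-continuous\<close>
   \<and> (\<forall>t>0. sets (F t) = sigma_sets (space M) (\<Union>s\<in>{0..<t}. sets (F s)))
   \<comment> \<open>F 0 trivial\<close>
   \<and> (\<forall>A\<in>sets (F 0). emeasure M A = 0 \<or> emeasure M A = 1)"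

definition progressive :: "'a measure \<Rightarrow> (real \<Rightarrow> 'a measure) \<Rightarrow> (real \<Rightarrow> 'a \<Rightarrow> real) \<Rightarrow> bool" where
  "progressive M F X \<longleftrightarrow>
     (\<forall>t\<ge>0. (\<lambda>(s, \<omega>). X s \<omega>) \<in> borel_measurable (restrict_space borel {0..t} \<Otimes>\<^sub>M F t))"

definition cadlag :: "'a measure \<Rightarrow> (real \<Rightarrow> 'a \<Rightarrow> real) \<Rightarrow> bool" where
  "cadlag M X \<longleftrightarrow> (\<forall>\<omega>\<in>space M.
      (\<forall>t\<ge>0. ((\<lambda>s. X s \<omega>) \<longlongrightarrow> X t \<omega>) (at_right t))
    \<and> (\<forall>t>0. \<exists>l. ((\<lambda>s. X s \<omega>) \<longlongrightarrow> l) (at_left t)))"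

definition Pplus :: "'a measure \<Rightarrow> (real \<Rightarrow> 'a measure) \<Rightarrow> (real \<Rightarrow> 'a \<Rightarrow> real) \<Rightarrow> bool" where
  "Pplus M F X \<longleftrightarrow> progressive M F X \<and> (\<forall>t\<ge>0. \<forall>\<omega>\<in>space M. X t \<omega> \<ge> 0)"

definition Ppp :: "'a measure \<Rightarrow> (real \<Rightarrow> 'a measure) \<Rightarrow> (real \<Rightarrow> 'a \<Rightarrow> real) \<Rightarrow> bool" where
  "Ppp M F X \<longleftrightarrow> progressive M F X \<and> (\<forall>t\<ge>0. \<forall>\<omega>\<in>space M. X t \<omega> > 0)"

definition Jproc :: "'a measure \<Rightarrow> (real \<Rightarrow> 'a measure) \<Rightarrow> (real \<Rightarrow> 'a \<Rightarrow> real) \<Rightarrow> real \<Rightarrow> 'a \<Rightarrow> real" where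
  "Jproc M F X t = real_cond_exp M (F t) (\<lambda>\<omega>. LINT s:{t..}|lborel. X s \<omega>)"

definition finite_expected_integral :: "'a measure \<Rightarrow> (real \<Rightarrow> 'a \<Rightarrow> real) \<Rightarrow> bool" where
  "finite_expected_integral M X \<longleftrightarrow>
     (\<integral>\<^sup>+\<omega>. (\<integral>\<^sup>+s\<in>{0..}. ennreal \<bar>X s \<omega>\<bar> \<partial>lborel) \<partial>M) < \<infinity>"

definition SO :: "'a measure \<Rightarrow> (real \<Rightarrow> 'a measure) \<Rightarrow> (real \<Rightarrow> 'a \<Rightarrow> real) \<Rightarrow> bool" where
  "SO M F X \<longleftrightarrow> Ppp M F X \<and> finite_expected_integral M X
     \<and> (\<exists>k K. 0 < k \<and> k \<le> K \<and>
          (\<forall>t\<ge>0. AE \<omega> in M. k * Jproc M F X t \<omega> \<le> X t \<omega> \<and> X t \<omega> \<le> K * Jproc M F X t \<omega>))"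

definition SO_nu :: "real \<Rightarrow> 'a measure \<Rightarrow> (real \<Rightarrow> 'a measure) \<Rightarrow> (real \<Rightarrow> 'a \<Rightarrow> real) \<Rightarrow> bool" where
  "SO_nu \<nu> M F X \<longleftrightarrow> SO M F X \<and> SO M F (\<lambda>t \<omega>. exp (\<nu> * t) * X t \<omega>)"

definition SO_plus :: "'a measure \<Rightarrow> (real \<Rightarrow> 'a measure) \<Rightarrow> (real \<Rightarrow> 'a \<Rightarrow> real) \<Rightarrow> bool" where
  "SO_plus M F X \<longleftrightarrow> (\<exists>\<nu>>0. SO_nu \<nu> M F X)"

definition EZ_theta :: "real \<Rightarrow> real \<Rightarrow> real" where
  "EZ_theta R S = (1 - R) / (1 - S)"

definition EZ_rho :: "real \<Rightarrow> real \<Rightarrow> real" where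
  "EZ_rho R S = (EZ_theta R S - 1) / EZ_theta R S"

definition f_EZ :: "real \<Rightarrow> real \<Rightarrow> real \<Rightarrow> real \<Rightarrow> real" where
  "f_EZ R S c v = c powr (1 - S) / (1 - S) * ((1 - R) * v) powr (EZ_rho R S)"

definition EZ_solution :: "real \<Rightarrow> real \<Rightarrow> 'a measure \<Rightarrow> (real \<Rightarrow> 'a measure)
     \<Rightarrow> (real \<Rightarrow> 'a \<Rightarrow> real) \<Rightarrow> (real \<Rightarrow> 'a \<Rightarrow> real) \<Rightarrow> bool" where
  "EZ_solution R S M F C V \<longleftrightarrow>
     cadlag M V \<and> progressive M F V
   \<and> (\<forall>t\<ge>0. \<forall>\<omega>\<in>space M. (1 - R) * V t \<omega> \<ge> 0)
   \<and> finite_expected_integral M (\<lambda>s \<omega>. f_EZ R S (C s \<omega>) (V s \<omega>))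
   \<and> (\<forall>t\<ge>0. AE \<omega> in M. V t \<omega> =
        real_cond_exp M (F t) (\<lambda>\<omega>'. LINT s:{t..}|lborel. f_EZ R S (C s \<omega>') (V s \<omega>')) \<omega>)"

definition EZ_proper :: "real \<Rightarrow> 'a measure \<Rightarrow> (real \<Rightarrow> 'a measure)
     \<Rightarrow> (real \<Rightarrow> 'a \<Rightarrow> real) \<Rightarrow> (real \<Rightarrow> 'a \<Rightarrow> real) \<Rightarrow> bool" where
  "EZ_proper R M F C V \<longleftrightarrow>
     (\<forall>t\<ge>0. AE \<omega> in M. Jproc M F (\<lambda>s \<omega>'. C s \<omega>' powr (1 - R)) t \<omega> > 0 \<longrightarrow> (1 - R) * V t \<omega> > 0)"

definition EZ_extremal :: "real \<Rightarrow> real \<Rightarrow> 'a measure \<Rightarrow> (real \<Rightarrow> 'a measure)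
     \<Rightarrow> (real \<Rightarrow> 'a \<Rightarrow> real) \<Rightarrow> (real \<Rightarrow> 'a \<Rightarrow> real) \<Rightarrow> bool" where
  "EZ_extremal R S M F C V \<longleftrightarrow>
     (\<forall>Y. EZ_solution R S M F C Y \<longrightarrow> (AE \<omega> in M. \<forall>t\<ge>0. (1 - R) * V t \<omega> \<ge> (1 - R) * Y t \<omega>))"

definition EZ_CRRA_order :: "real \<Rightarrow> 'a measure \<Rightarrow> (real \<Rightarrow> 'a measure)
     \<Rightarrow> (real \<Rightarrow> 'a \<Rightarrow> real) \<Rightarrow> (real \<Rightarrow> 'a \<Rightarrow> real) \<Rightarrow> bool" where
  "EZ_CRRA_order R M F C V \<longleftrightarrow>
     (\<exists>k K. 0 < k \<and> k \<le> K \<and>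
        (\<forall>t\<ge>0. AE \<omega> in M.
           k * Jproc M F (\<lambda>s \<omega>'. C s \<omega>' powr (1 - R)) t \<omega> \<le> (1 - R) * V t \<omega>
         \<and> (1 - R) * V t \<omega> \<le> K * Jproc M F (\<lambda>s \<omega>'. C s \<omega>' powr (1 - R)) t \<omega>))"

definition indistinguishable :: "'a measure \<Rightarrow> (real \<Rightarrow> 'a \<Rightarrow> real) \<Rightarrow> (real \<Rightarrow> 'a \<Rightarrow> real) \<Rightarrow> bool" where
  "indistinguishable M X Y \<longleftrightarrow> (AE \<omega> in M. \<forall>t\<ge>0. X t \<omega> = Y t \<omega>)"

end

theory Submission
  imports Defs
begin

text \<open>Put \<open>X = C\<^sup>1\<^sup>-\<^sup>R\<close> and \<open>W = (1 - R) V\<close>. The utility equation becomes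
  \<open>W\<^sub>t = E[\<integral>\<^sub>t \<theta> X\<^sup>1\<^sup>-\<^sup>\<rho> W\<^sup>\<rho> ds | F\<^sub>t]\<close> with \<open>0 < \<rho> < 1\<close> and \<open>\<theta> (1 - \<rho>) = 1\<close>.
  The right-hand side is monotone in \<open>W\<close> and homogeneous of degree \<open>\<rho>\<close>, so a bound \<open>Y \<le> c W\<close> between two
  solutions improves to \<open>Y \<le> c\<^sup>\<rho> W\<close> and, by iteration, to \<open>Y \<le> W\<close>; thus it is enough to bound solutions by constant
  multiples of each other. Since \<open>X\<close> is comparable with its tail expectation, monotone iteration started at a small
  multiple of \<open>X\<close> converges to a solution comparable with \<open>X\<close>; a cadlag version exists by Doob's upcrossing
  inequality. Every solution is bounded by a multiple of \<open>X\<close>: by Young's inequality the integrand is at most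
  \<open>a e\<^sup>\<nu>\<^sup>(\<^sup>s\<^sup>-\<^sup>t\<^sup>) X\<^sub>s + (\<gamma>/2) e\<^sup>-\<^sup>\<gamma>\<^sup>(\<^sup>s\<^sup>-\<^sup>t\<^sup>) Y\<^sub>s\<close>, and the second term contributes at most half of \<open>Y\<^sub>t\<close>, as \<open>Y\<close> is a
  supermartingale. Finally, for a positive solution \<open>Y\<close> the drift of the concave function \<open>Y\<^sup>1\<^sup>-\<^sup>\<rho> W\<^sup>\<rho>\<close> is at most
  \<open>- X\<^sup>1\<^sup>-\<^sup>\<rho> W\<^sup>\<rho>\<close>, which integrates to \<open>W \<le> \<theta> Y\<^sup>1\<^sup>-\<^sup>\<rho> W\<^sup>\<rho>\<close>. All conditional expectations are expressed through integrals over
  the events of \<open>F\<^sub>t\<close>.\<close>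

section \<open>Upcrossings\<close>

text \<open>A side condition on solutions is unavoidable: the zero process solves the reduced
  equation as well. It bounds no positive solution, and mere positivity of a proper solution offers
  no comparison constant either; this is what makes the lower bound the delicate step. Solutions are
  known only through integral identities, so the drift of \<open>Y^(1-\<rho>) W^\<rho>\<close> is
  estimated without stochastic calculus: the concave function is compared with its tangent plane at
  the left ends of the cells of a grid, and the mesh is sent to 0. Integrals over events take values
  in [0, \<infinity>], so Fubini, monotone convergence and Fatou apply without integrability;
  finiteness matters mostly where a term is cancelled. Solutions are compared almost surely at each
  fixed time, which is all that a tail integral sees; right continuity turns this into a statement
  about paths at the very end.\<close>

fun upcross :: "real \<Rightarrow> real \<Rightarrow> (nat \<Rightarrow> real) \<Rightarrow> nat \<Rightarrow> bool \<times> nat" where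
  "upcross a b x 0 = (x 0 < a, 0)"
| "upcross a b x (Suc k) =
     (let (h, u) = upcross a b x k in
      if h then (if x (Suc k) > b then (False, Suc u) else (True, u)) else (x (Suc k) < a, u))"

text \<open>True from a value below \<open>a\<close> until the next value above \<open>b\<close>:
  the asset is bought below \<open>a\<close> and sold above \<open>b\<close>. Both inequalities are
  strict, as in \<open>cross\<close> below.\<close>

abbreviation upstate :: "real \<Rightarrow> real \<Rightarrow> (nat \<Rightarrow> real) \<Rightarrow> nat \<Rightarrow> bool" where
  "upstate a b x k \<equiv> fst (upcross a b x k)"

abbreviation upcount :: "real \<Rightarrow> real \<Rightarrow> (nat \<Rightarrow> real) \<Rightarrow> nat \<Rightarrow> nat" where
  "upcount a b x k \<equiv> snd (upcross a b x k)"

lemma upstate_Suc: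
  "upstate a b x (Suc k) \<longleftrightarrow> (if upstate a b x k then \<not> x (Suc k) > b else x (Suc k) < a)"
  by (auto simp: split_beta Let_def)

lemma upcount_Suc:
  "upcount a b x (Suc k) = upcount a b x k + (if upstate a b x k \<and> x (Suc k) > b then 1 else 0)"
  by (auto simp: split_beta Let_def)

declare upcross.simps(2) [simp del]
declare upstate_Suc [simp] upcount_Suc [simp]

lemma upcount_mono: "i \<le> j \<Longrightarrow> upcount a b x i \<le> upcount a b x j"
  by (induction j rule: dec_induct) auto

lemma upstate_low: "a < b \<Longrightarrow> x i < a \<Longrightarrow> upstate a b x i"
  by (cases i) auto

text \<open>A position held at \<open>i\<close> is either sold before \<open>j\<close>, or still
  open at \<open>j - 1\<close> and then sold at \<open>j\<close>.\<close>

lemma upcount_less_of_upstate: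
  assumes "i < j" "upstate a b x i" "x j > b"
  shows "upcount a b x i < upcount a b x j"
proof -
  have step: "upcount a b x i < upcount a b x k \<or> upcount a b x i = upcount a b x k \<and> upstate a b x k"
    if "i \<le> k" for k
    using that assms(2) by (induction k rule: dec_induct) auto
  obtain k where k: "j = Suc k" "i \<le> k"
    using assms(1) by (cases j) auto
  show ?thesis
    using step[OF k(2)] assms(3) k by auto
qed

text \<open>The right-hand side is the gain of the strategy that holds the asset in the holding state.\<close>

lemma upcount_le_gain:
  assumes "a < b" "\<And>i. x i \<ge> 0" "a > 0"
  shows "(b - a) * real (upcount a b x n)
           \<le> a + (\<Sum>i<n. if upstate a b x i then x (Suc i) - x i else 0)"
proof -
  \<comment> \<open>The induction needs the book value \<open>x n - a\<close> of an open position.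
    It is negative at the time of purchase, and at least \<open>- a\<close> always since
    \<open>x\<close> is nonnegative.\<close>
  have "(b - a) * real (upcount a b x n) + (if upstate a b x n then x n - a else 0)
           \<le> (\<Sum>i<n. if upstate a b x i then x (Suc i) - x i else 0)"
  proof (induction n)
    case (Suc n)
    then show ?case
      using assms by (auto simp: algebra_simps split: if_splits)
  qed auto
  with assms(2)[of n] assms(3) show ?thesis
    by (auto split: if_splits)
qed

text \<open>Whether the asset is held from step \<open>i\<close> to \<open>i + 1\<close> is known at
  step \<open>i\<close>, so the gain is a martingale transform with mean 0. What remains is the
  possible loss \<open>a\<close> on an open position, hence a bound that depends neither on
  \<open>n\<close> nor on \<open>x\<close>.\<close>

lemma expected_upcount_le:
  fixes x :: "nat \<Rightarrow> 'a \<Rightarrow> real"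
  assumes M: "prob_space M"
    and sub: "\<And>i. subalgebra M (G i)" and filt: "\<And>i. sets (G i) \<subseteq> sets (G (Suc i))"
    and meas: "\<And>i. x i \<in> borel_measurable (G i)"
    and int: "\<And>i. integrable M (x i)"
    and mart: "\<And>i A. A \<in> sets (G i) \<Longrightarrow> (\<integral>w. indicator A w * x (Suc i) w \<partial>M) = (\<integral>w. indicator A w * x i w \<partial>M)"
    and ab: "a < b" "a > 0" and nonneg: "\<And>i w. x i w \<ge> 0"
  shows "(\<lambda>w. upcount a b (\<lambda>i. x i w) n) \<in> measurable M (count_space UNIV)"
    and "(\<integral>\<^sup>+w. of_nat (upcount a b (\<lambda>i. x i w) n) \<partial>M) \<le> ennreal (a / (b - a))"
proof -
  interpret prob_space M by fact
  have sp: "space (G i) = space M" for i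
    using sub[of i] by (simp add: subalgebra_def)
  have x_M[measurable]: "x i \<in> borel_measurable M" for i
    using int[of i] by simp
  have state: "{w\<in>space M. upstate a b (\<lambda>i. x i w) k} \<in> sets (G k)" for k
  proof (induction k)
    case 0
    note meas[of 0, measurable]
    have "{w\<in>space (G 0). x 0 w < a} \<in> sets (G 0)" by measurable
    then show ?case by (simp add: sp)
  next
    case (Suc k)
    note meas[of "Suc k", measurable]
    have [measurable]: "{w\<in>space M. upstate a b (\<lambda>i. x i w) k} \<in> sets (G (Suc k))" (is "?A \<in> _")
      using Suc filt by blast
    have "{w\<in>space (G (Suc k)). (w \<in> ?A \<and> \<not> x (Suc k) w > b) \<or> (w \<notin> ?A \<and> x (Suc k) w < a)} \<in> sets (G (Suc k))"
      by measurable
    moreover have "{w\<in>space (G (Suc k)). (w \<in> ?A \<and> \<not> x (Suc k) w > b) \<or> (w \<notin> ?A \<and> x (Suc k) w < a)}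
        = {w\<in>space M. upstate a b (\<lambda>i. x i w) (Suc k)}"
      by (auto simp: sp)
    ultimately show ?case by simp
  qed
  have state_M[measurable]: "{w\<in>space M. upstate a b (\<lambda>i. x i w) k} \<in> sets M" for k
    using state[of k] sub[of k] by (auto simp: subalgebra_def)
  show count[measurable]: "(\<lambda>w. upcount a b (\<lambda>i. x i w) n) \<in> measurable M (count_space UNIV)" for n
  proof (induction n)
    case (Suc n)
    note [measurable] = Suc
    have [measurable]: "Measurable.pred M (\<lambda>w. upstate a b (\<lambda>i. x i w) n)"
      using state_M[of n] by (simp add: pred_def)
    show ?case unfolding upcount_Suc by measurable
  qed simp
  define A where "A k = {w\<in>space M. upstate a b (\<lambda>i. x i w) k}" for k
  define gain where "gain w = (\<Sum>i<n. indicator (A i) w * x (Suc i) w - indicator (A i) w * x i w)" for w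
  have A_M[measurable]: "A k \<in> sets M" for k
    unfolding A_def by (rule state_M)
  have int1: "integrable M (\<lambda>w. indicator (A i) w * x j w)" for i j
    using integrable_mult_indicator[OF A_M int] by simp
  have gain_int: "integrable M gain" and gain_0: "integral\<^sup>L M gain = 0"
    using int1 mart[OF state, folded A_def] unfolding gain_def by auto
  have le: "(b - a) * real (upcount a b (\<lambda>i. x i w) n) \<le> a + gain w" if "w \<in> space M" for w
  proof -
    have "gain w = (\<Sum>i<n. if upstate a b (\<lambda>i. x i w) i then x (Suc i) w - x i w else 0)"
      unfolding gain_def A_def using that by (intro sum.cong) (auto simp: indicator_def)
    then show ?thesis
      using upcount_le_gain[of a b "\<lambda>i. x i w" n] ab nonneg by simp
  qed
  have "(\<integral>\<^sup>+w. of_nat (upcount a b (\<lambda>i. x i w) n) \<partial>M) \<le> (\<integral>\<^sup>+w. ennreal ((a + gain w) / (b - a)) \<partial>M)"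
    using le ab by (intro nn_integral_mono) (auto simp: ennreal_of_nat_eq_real_of_nat field_simps intro!: ennreal_leI)
  also have "\<dots> = ennreal (\<integral>w. (a + gain w) / (b - a) \<partial>M)"
  proof (rule nn_integral_eq_integral)
    show "integrable M (\<lambda>w. (a + gain w) / (b - a))"
      using gain_int by auto
    show "AE w in M. 0 \<le> (a + gain w) / (b - a)"
    proof (rule AE_I2)
      fix w assume "w \<in> space M"
      have "0 \<le> (b - a) * real (upcount a b (\<lambda>i. x i w) n)" using ab by simp
      with le[OF \<open>w \<in> space M\<close>] have "0 \<le> a + gain w" by linarith
      with ab show "0 \<le> (a + gain w) / (b - a)" by simp
    qed
  qed
  also have "(\<integral>w. (a + gain w) / (b - a) \<partial>M) = a / (b - a)"
    using gain_int gain_0 by (simp add: prob_space)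
  finally show "(\<integral>\<^sup>+w. of_nat (upcount a b (\<lambda>i. x i w) n) \<partial>M) \<le> ennreal (a / (b - a))" .
qed

section \<open>Regularization of paths along the dyadic numbers\<close>

text \<open>A countable dense set exhausted by nested grids, so that crossings along it can be
  counted along sequences indexed by natural numbers.\<close>

definition dyadics :: "real set" where
  "dyadics = {real i / 2 ^ n | i n. True}"

lemma countable_dyadics: "countable dyadics"
proof -
  have "dyadics = (\<lambda>(i, n). real i / 2 ^ n) ` UNIV"
    unfolding dyadics_def by auto
  then show ?thesis by (metis countableI_type countable_image)
qed

lemma dyadics_nonneg: "s \<in> dyadics \<Longrightarrow> 0 \<le> s"
  by (auto simp: dyadics_def)

lemma dyadics_grid: "real i / 2 ^ n \<in> dyadics"
  by (auto simp: dyadics_def)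

lemma eventually_dyadic_grid:
  assumes "s \<in> dyadics"
  shows "\<forall>\<^sub>F n in sequentially. \<exists>i. s = real i / 2 ^ n"
proof -
  obtain i m where s: "s = real i / 2 ^ m"
    using assms by (auto simp: dyadics_def)
  have "s = real (i * 2 ^ (n - m)) / 2 ^ n" if "n \<ge> m" for n
  proof -
    have "(2::real) ^ n = 2 ^ (n - m) * 2 ^ m" using that by (simp flip: power_add)
    then show ?thesis by (simp add: s)
  qed
  then show ?thesis
    using eventually_sequentially by blast
qed

lemma dyadics_dense:
  assumes "0 \<le> x" "x < y"
  shows "\<exists>s\<in>dyadics. x < s \<and> s < y"
proof -
  obtain n where n: "1 / (y - x) < 2 ^ n"
    using real_arch_pow[of 2 "1 / (y - x)"] by auto
  define i where "i = nat \<lfloor>x * 2 ^ n\<rfloor> + 1"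
  have i: "real i = of_int \<lfloor>x * 2 ^ n\<rfloor> + 1"
    using assms unfolding i_def by (simp add: of_nat_nat)
  have "x * 2 ^ n < real i" "real i \<le> x * 2 ^ n + 1"
    unfolding i by linarith+
  moreover have "1 < (y - x) * 2 ^ n"
    using n assms by (simp add: field_simps)
  ultimately have "x < real i / 2 ^ n" "real i / 2 ^ n < y"
    by (simp_all add: field_simps)
  then show ?thesis using dyadics_grid by blast
qed

text \<open>An upcrossing that takes place within the time interval [x, y]. As a relation between
  times it has relational powers, and \<open>cross f a b ^^ k\<close> expresses \<open>k\<close>
  successive upcrossings without listing their times.\<close>

definition cross :: "(real \<Rightarrow> real) \<Rightarrow> real \<Rightarrow> real \<Rightarrow> (real \<times> real) set" where
  "cross f a b = {(x, y). \<exists>s\<in>dyadics. \<exists>u\<in>dyadics. x \<le> s \<and> s < u \<and> u \<le> y \<and> f s < a \<and> b < f u}"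

lemma crossI:
  "\<lbrakk>s \<in> dyadics; u \<in> dyadics; x \<le> s; s < u; u \<le> y; f s < a; b < f u\<rbrakk> \<Longrightarrow> (x, y) \<in> cross f a b"
  by (auto simp: cross_def)

lemma cross_mono: "(x, y) \<in> cross f a b \<Longrightarrow> x' \<le> x \<Longrightarrow> y \<le> y' \<Longrightarrow> (x', y') \<in> cross f a b"
  
  unfolding cross_def by (auto intro: order_trans)

text \<open>The power 0 is the identity relation, for which enlarging the interval fails; hence
  \<open>Suc k\<close>.\<close>

lemma cross_relpow_mono:
  assumes "(x, y) \<in> cross f a b ^^ Suc k" "x' \<le> x" "y \<le> y'"
  shows "(x', y') \<in> cross f a b ^^ Suc k"
proof -
  have r: "(x', y) \<in> cross f a b ^^ Suc k"
    using assms(1,2) by (meson cross_mono relpow_Suc_D2 relpow_Suc_I2 order_refl)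
  then show ?thesis
    using assms(3) by (auto elim!: relcompE intro: cross_mono)
qed

text \<open>The finitely many dyadic times of \<open>k\<close> crossings all lie on every
  sufficiently fine grid, where each crossing raises the counter. Quantifying over all grid points
  beyond \<open>y\<close> lets the next crossing start anywhere after \<open>y\<close>.\<close>

lemma eventually_upcount_ge:
  assumes "(0, y) \<in> cross f a b ^^ k" "a < b"
  shows "\<forall>\<^sub>F n in sequentially. \<forall>j. y \<le> real j / 2 ^ n \<longrightarrow> k \<le> upcount a b (\<lambda>i. f (real i / 2 ^ n)) j"
  using assms(1)
proof (induction k arbitrary: y)
  case (Suc k)
  then obtain z where z: "(0, z) \<in> cross f a b ^^ k" "(z, y) \<in> cross f a b"
    by auto
  then obtain s u where su: "s \<in> dyadics" "u \<in> dyadics" "z \<le> s" "s < u" "u \<le> y" "f s < a" "b < f u"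
    by (auto simp: cross_def)
  show ?case
    using Suc.IH[OF z(1)] eventually_dyadic_grid[OF su(1)] eventually_dyadic_grid[OF su(2)]
  proof eventually_elim
    case (elim n)
    then obtain i j where ij: "s = real i / 2 ^ n" "u = real j / 2 ^ n" by auto
    let ?x = "\<lambda>i. f (real i / 2 ^ n)"
    have "i < j" using su(4) ij by (simp add: divide_less_cancel)
    have "k \<le> upcount a b ?x i" using elim(1) su(3) ij by auto
    also have "\<dots> < upcount a b ?x j"
      using su ij \<open>i < j\<close> by (intro upcount_less_of_upstate upstate_low assms(2)) auto
    finally have "Suc k \<le> upcount a b ?x j" by simp
    moreover have "j \<le> l" if "y \<le> real l / 2 ^ n" for l
    proof -
      have "real j / 2 ^ n \<le> real l / 2 ^ n" using that su(5) ij by simp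
      then show ?thesis by (simp add: divide_le_cancel)
    qed
    ultimately show ?case
      using upcount_mono order_trans by blast
  qed
qed auto

section \<open>One-sided limits along the dyadic times\<close>

text \<open>Rational levels and natural time horizons leave countably many conditions, so that
  almost every path can satisfy all of them at once.\<close>

definition regular_path :: "(real \<Rightarrow> real) \<Rightarrow> bool" where
  "regular_path f \<longleftrightarrow>
     (\<forall>T::nat. \<forall>a\<in>\<rat>. \<forall>b\<in>\<rat>. a < b \<longrightarrow> (\<exists>k. (0, real T) \<notin> cross f a b ^^ Suc k))
   \<and> (\<forall>T::nat. \<exists>B. \<forall>s\<in>dyadics. s \<le> real T \<longrightarrow> \<bar>f s\<bar> \<le> B)"

text \<open>If the lower limit were below the upper limit, two rationals strictly between them would
  both be passed frequently. The bound \<open>B\<close> keeps both limits finite.\<close>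

lemma ex_tendsto_of_no_oscillation:
  fixes f :: "'b \<Rightarrow> real"
  assumes F: "F \<noteq> bot" and bdd: "\<forall>\<^sub>F x in F. \<bar>f x\<bar> \<le> B"
    and osc: "\<And>a b. a \<in> \<rat> \<Longrightarrow> b \<in> \<rat> \<Longrightarrow> a < b \<Longrightarrow> \<not> ((\<exists>\<^sub>F x in F. f x < a) \<and> (\<exists>\<^sub>F x in F. b < f x))"
  shows "\<exists>l. (f \<longlongrightarrow> l) F"
proof -
  let ?g = "\<lambda>x. ereal (f x)"
  let ?L = "Liminf F ?g" and ?U = "Limsup F ?g"
  have LU: "?L \<le> ?U" by (rule Liminf_le_Limsup[OF F])
  have lo: "ereal (- B) \<le> ?L"
    by (rule Liminf_bounded) (use bdd in \<open>auto elim!: eventually_mono\<close>)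
  have hi: "?U \<le> ereal B"
    by (rule Limsup_bounded) (use bdd in \<open>auto elim!: eventually_mono\<close>)
  have "?L = ?U"
  proof (rule ccontr)
    assume "?L \<noteq> ?U"
    then have lt: "?L < ?U" using LU by simp
    obtain l u where lu: "?L = ereal l" "?U = ereal u"
      using lo hi LU by (cases ?L; cases ?U) auto
    then have "l < u" using lt by simp
    then obtain a where a: "a \<in> \<rat>" "l < a" "a < u" using Rats_dense_in_real by blast
    then obtain b where b: "b \<in> \<rat>" "a < b" "b < u" using Rats_dense_in_real by blast
    have "\<exists>\<^sub>F x in F. f x < a"
    proof (rule ccontr)
      assume "\<not> ?thesis"
      then have "\<forall>\<^sub>F x in F. ereal a \<le> ?g x" by (simp add: frequently_def not_less)
      then have "ereal a \<le> ?L" by (rule Liminf_bounded)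
      then show False using a lu by simp
    qed
    moreover have "\<exists>\<^sub>F x in F. b < f x"
    proof (rule ccontr)
      assume "\<not> ?thesis"
      then have "\<forall>\<^sub>F x in F. ?g x \<le> ereal b" by (simp add: frequently_def not_less)
      then have "?U \<le> ereal b" by (rule Limsup_bounded)
      then show False using b lu by simp
    qed
    ultimately show False using osc a b by blast
  qed
  moreover obtain l where "?L = ereal l"
    using lo hi LU by (cases ?L; cases ?U) auto
  ultimately have "(?g \<longlongrightarrow> ereal l) F"
    using Liminf_eq_Limsup[OF F] by metis
  then show ?thesis by auto
qed

lemma frequently_at_within_right:
  fixes t :: real
  assumes "\<exists>\<^sub>F x in at t within D \<inter> {t<..}. P x" "t < d"
  shows "\<exists>x\<in>D. t < x \<and> x < d \<and> P x"
  using assms by (force simp: frequently_at dist_real_def dest!: spec[of _ "d - t"])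

lemma frequently_at_within_left:
  fixes t :: real
  assumes "\<exists>\<^sub>F x in at t within D \<inter> {..<t}. P x" "d < t"
  shows "\<exists>x\<in>D. d < x \<and> x < t \<and> P x"
  using assms by (force simp: frequently_at dist_real_def dest!: spec[of _ "t - d"])

lemma at_within_dyadics_right_nontrivial:
  assumes "0 \<le> t"
  shows "at t within dyadics \<inter> {t<..} \<noteq> bot"
proof -
  have "\<exists>x\<in>dyadics \<inter> {t<..}. x \<noteq> t \<and> dist x t < e" if "0 < e" for e
  proof -
    obtain s where "s \<in> dyadics" "t < s" "s < t + e"
      using dyadics_dense[of t "t + e"] assms \<open>0 < e\<close> by auto
    then show ?thesis by (intro bexI[of _ s]) (auto simp: dist_real_def)
  qed
  then show ?thesis
    by (auto simp: trivial_limit_within islimpt_approachable)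
qed

lemma at_within_dyadics_left_nontrivial:
  assumes "0 < t"
  shows "at t within dyadics \<inter> {..<t} \<noteq> bot"
proof -
  have "\<exists>x\<in>dyadics \<inter> {..<t}. x \<noteq> t \<and> dist x t < e" if "0 < e" for e
  proof -
    obtain s where "s \<in> dyadics" "max 0 (t - e) < s" "s < t"
      using dyadics_dense[of "max 0 (t - e)" t] assms \<open>0 < e\<close> by auto
    then show ?thesis by (intro bexI[of _ s]) (auto simp: dist_real_def)
  qed
  then show ?thesis
    by (auto simp: trivial_limit_within islimpt_approachable)
qed

lemma regular_path_right_limit:
  assumes f: "regular_path f" and t: "0 \<le> t"
  shows "\<exists>l. (f \<longlongrightarrow> l) (at t within dyadics \<inter> {t<..})"
proof -
  let ?F = "at t within dyadics \<inter> {t<..}"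
  obtain T :: nat where T: "t + 1 < real T" using reals_Archimedean2 by blast
  obtain B where B: "\<And>s. s \<in> dyadics \<Longrightarrow> s \<le> real T \<Longrightarrow> \<bar>f s\<bar> \<le> B"
    using f unfolding regular_path_def by blast
  show ?thesis
  proof (rule ex_tendsto_of_no_oscillation[OF at_within_dyadics_right_nontrivial[OF t]])
    show "\<forall>\<^sub>F x in ?F. \<bar>f x\<bar> \<le> B"
      using T B by (auto simp: eventually_at dist_real_def intro!: exI[of _ 1])
    fix a b :: real assume ab: "a \<in> \<rat>" "b \<in> \<rat>" "a < b"
    show "\<not> ((\<exists>\<^sub>F x in ?F. f x < a) \<and> (\<exists>\<^sub>F x in ?F. b < f x))"
    proof
      assume *: "(\<exists>\<^sub>F x in ?F. f x < a) \<and> (\<exists>\<^sub>F x in ?F. b < f x)"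
      \<comment> \<open>Close to \<open>t\<close> from the right, crossings are built backwards in
        time: the last one is chosen first and the earlier ones are squeezed between
        \<open>t\<close> and its start, which is why \<open>d\<close> varies in the
        induction.\<close>
      have "\<exists>e. t < e \<and> e \<le> d \<and> (e, d) \<in> cross f a b ^^ k" if "t < d" for d k
        using that
      proof (induction k arbitrary: d)
        case (Suc k)
        obtain u where u: "u \<in> dyadics" "t < u" "u < d" "b < f u"
          using frequently_at_within_right[OF conjunct2[OF *] Suc.prems] by auto
        obtain s where s: "s \<in> dyadics" "t < s" "s < u" "f s < a"
          using frequently_at_within_right[OF conjunct1[OF *] u(2)] by auto
        obtain e where e: "t < e" "e \<le> s" "(e, s) \<in> cross f a b ^^ k"
          using Suc.IH[OF s(2)] by blast
        have "(s, d) \<in> cross f a b" using s u by (intro crossI[of s u]) auto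
        then show ?case using e s u by (intro exI[of _ e]) auto
      qed auto
      then have "(0, real T) \<in> cross f a b ^^ Suc k" for k
        using t T cross_relpow_mono[of _ "t + 1" k f a b 0 "real T"] by (metis less_add_one less_imp_le order_trans)
      then show False using f ab unfolding regular_path_def by blast
    qed
  qed
qed

lemma regular_path_left_limit:
  assumes f: "regular_path f" and t: "0 < t"
  shows "\<exists>l. (f \<longlongrightarrow> l) (at t within dyadics \<inter> {..<t})"
proof -
  let ?F = "at t within dyadics \<inter> {..<t}"
  obtain T :: nat where T: "t < real T" using reals_Archimedean2 by blast
  obtain B where B: "\<And>s. s \<in> dyadics \<Longrightarrow> s \<le> real T \<Longrightarrow> \<bar>f s\<bar> \<le> B"
    using f unfolding regular_path_def by blast
  show ?thesis
  proof (rule ex_tendsto_of_no_oscillation[OF at_within_dyadics_left_nontrivial[OF t]])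
    show "\<forall>\<^sub>F x in ?F. \<bar>f x\<bar> \<le> B"
      using T B by (auto simp: eventually_at dist_real_def intro!: exI[of _ 1])
    fix a b :: real assume ab: "a \<in> \<rat>" "b \<in> \<rat>" "a < b"
    show "\<not> ((\<exists>\<^sub>F x in ?F. f x < a) \<and> (\<exists>\<^sub>F x in ?F. b < f x))"
    proof
      assume *: "(\<exists>\<^sub>F x in ?F. f x < a) \<and> (\<exists>\<^sub>F x in ?F. b < f x)"
      \<comment> \<open>On the left of \<open>t\<close> the crossings are built forwards, each new
        one between the end \<open>e\<close> of the previous ones and \<open>t\<close>.\<close>
      have "\<exists>e. 0 \<le> e \<and> e < t \<and> (0, e) \<in> cross f a b ^^ k" for k
      proof (induction k)
        case 0
        then show ?case using t by auto
      next
        case (Suc k)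
        then obtain e where e: "0 \<le> e" "e < t" "(0, e) \<in> cross f a b ^^ k" by blast
        obtain s where s: "s \<in> dyadics" "e < s" "s < t" "f s < a"
          using frequently_at_within_left[OF conjunct1[OF *] e(2)] by auto
        obtain u where u: "u \<in> dyadics" "s < u" "u < t" "b < f u"
          using frequently_at_within_left[OF conjunct2[OF *] s(3)] by auto
        have "(e, u) \<in> cross f a b" using s u by (intro crossI[of s u]) auto
        then show ?case using e s u by (intro exI[of _ u]) auto
      qed
      then have "(0, real T) \<in> cross f a b ^^ Suc k" for k
        using T cross_relpow_mono[of 0 _ k f a b 0 "real T"] by (metis less_imp_le order_trans order_refl)
      then show False using f ab unfolding regular_path_def by blast
    qed
  qed
qed

text \<open>Only strictly later times enter. The value of \<open>f\<close> at \<open>t\<close> has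
  no influence, and this is what makes the result right-continuous.\<close>

definition right_lim :: "(real \<Rightarrow> real) \<Rightarrow> real \<Rightarrow> real" where
  "right_lim f t = Lim (at t within dyadics \<inter> {t<..}) f"

lemma tendsto_right_lim:
  assumes "regular_path f" "0 \<le> t"
  shows "(f \<longlongrightarrow> right_lim f t) (at t within dyadics \<inter> {t<..})"
  using regular_path_right_limit[OF assms] at_within_dyadics_right_nontrivial[OF assms(2)]
  unfolding right_lim_def by (metis tendsto_Lim)

text \<open>A bound for \<open>f\<close> on the dyadic times of an open interval passes to its right
  limits there. Right continuity and existence of left limits both follow from this.\<close>

lemma right_lim_near:
  assumes f: "regular_path f" and t: "0 \<le> s" "s < d"
    and near: "\<And>u. u \<in> dyadics \<Longrightarrow> s < u \<Longrightarrow> u < d \<Longrightarrow> dist (f u) l \<le> e"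
  shows "dist (right_lim f s) l \<le> e"
proof (rule tendsto_upperbound[OF _ _ at_within_dyadics_right_nontrivial[OF t(1)]])
  show "((\<lambda>u. dist (f u) l) \<longlongrightarrow> dist (right_lim f s) l) (at s within dyadics \<inter> {s<..})"
    by (intro tendsto_intros tendsto_right_lim f t)
  show "\<forall>\<^sub>F u in at s within dyadics \<inter> {s<..}. dist (f u) l \<le> e"
    using near t by (auto simp: eventually_at dist_real_def intro!: exI[of _ "d - s"])
qed

lemma right_lim_right_continuous:
  assumes f: "regular_path f" and t: "0 \<le> t"
  shows "(right_lim f \<longlongrightarrow> right_lim f t) (at_right t)"
proof (rule tendstoI)
  fix e :: real assume "0 < e"
  then have "\<forall>\<^sub>F u in at t within dyadics \<inter> {t<..}. dist (f u) (right_lim f t) < e / 2"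
    using tendstoD[OF tendsto_right_lim[OF f t]] by (meson half_gt_zero)
  then obtain d where d: "0 < d" "\<And>u. u \<in> dyadics \<Longrightarrow> t < u \<Longrightarrow> u < t + d \<Longrightarrow> dist (f u) (right_lim f t) < e / 2"
    by (auto simp: eventually_at dist_real_def)
  have "dist (right_lim f s) (right_lim f t) < e" if "t < s" "s < t + d" for s
    using right_lim_near[OF f _ that(2), of "right_lim f t" "e / 2"] d(2) that t \<open>0 < e\<close>
    by (smt (verit) field_sum_of_halves)
  then show "\<forall>\<^sub>F s in at_right t. dist (right_lim f s) (right_lim f t) < e"
    using d(1) by (auto simp: eventually_at_right[of t "t + 1"] intro!: exI[of _ "t + d"])
qed

lemma right_lim_left_limit:
  assumes f: "regular_path f" and t: "0 < t"
  shows "\<exists>l. (right_lim f \<longlongrightarrow> l) (at_left t)"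
proof -
  obtain l where l: "(f \<longlongrightarrow> l) (at t within dyadics \<inter> {..<t})"
    using regular_path_left_limit[OF f t] by blast
  have "(right_lim f \<longlongrightarrow> l) (at_left t)"
  proof (rule tendstoI)
    fix e :: real assume "0 < e"
    then have "\<forall>\<^sub>F u in at t within dyadics \<inter> {..<t}. dist (f u) l < e / 2"
      using tendstoD[OF l] by (meson half_gt_zero)
    then obtain d where d: "0 < d" "\<And>u. u \<in> dyadics \<Longrightarrow> t - d < u \<Longrightarrow> u < t \<Longrightarrow> dist (f u) l < e / 2"
      by (auto simp: eventually_at dist_real_def)
    have "dist (right_lim f s) l < e" if "max 0 (t - d) < s" "s < t" for s
      using right_lim_near[OF f _ that(2), of l "e / 2"] d(2) that \<open>0 < e\<close>
      by (smt (verit) field_sum_of_halves)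
    then show "\<forall>\<^sub>F s in at_left t. dist (right_lim f s) l < e"
      using d(1) t by (auto simp: eventually_at_left[OF t] intro!: exI[of _ "max 0 (t - d)"])
  qed
  then show ?thesis by blast
qed

text \<open>Floor plus one instead of the ceiling: the value lies strictly above \<open>t\<close>
  even if \<open>t\<close> is itself a grid point.\<close>

definition dyadic_above :: "real \<Rightarrow> nat \<Rightarrow> real" where
  "dyadic_above t n = (of_int \<lfloor>t * 2 ^ n\<rfloor> + 1) / 2 ^ n"

lemma dyadic_above_bounds: "t < dyadic_above t n" "dyadic_above t n \<le> t + 1 / 2 ^ n"
proof -
  have "t * 2 ^ n < of_int \<lfloor>t * 2 ^ n\<rfloor> + 1" "of_int \<lfloor>t * 2 ^ n\<rfloor> + 1 \<le> t * 2 ^ n + 1"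
    by linarith+
  then show "t < dyadic_above t n" "dyadic_above t n \<le> t + 1 / 2 ^ n"
    by (simp_all add: dyadic_above_def field_simps)
qed

lemma dyadic_above_in: "0 \<le> t \<Longrightarrow> dyadic_above t n \<in> dyadics"
proof -
  assume "0 \<le> t"
  then have "dyadic_above t n = real (nat \<lfloor>t * 2 ^ n\<rfloor> + 1) / 2 ^ n"
    by (simp add: dyadic_above_def)
  then show ?thesis using dyadics_grid by metis
qed

lemma dyadic_above_tendsto: "dyadic_above t \<longlonglongrightarrow> t"
proof (rule tendsto_sandwich)
  show "\<forall>\<^sub>F n in sequentially. t \<le> dyadic_above t n"
    using dyadic_above_bounds(1)[of t] by (simp add: less_imp_le)
  show "\<forall>\<^sub>F n in sequentially. dyadic_above t n \<le> t + 1 / 2 ^ n"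
    using dyadic_above_bounds(2)[of t] by auto
  show "(\<lambda>n. t + 1 / 2 ^ n) \<longlonglongrightarrow> t"
    by real_asymp
qed auto

section \<open>Right-continuous versions of conditional expectations\<close>

text \<open>The test event is the part of \<open>V < U\<close> on which \<open>V\<close> is at most
  \<open>n\<close>. There the integral of \<open>V\<close> is finite and can be cancelled, so
  neither function has to be integrable.\<close>

lemma (in finite_measure) AE_le_of_nn_integral_le:
  fixes U V :: "'a \<Rightarrow> real"
  assumes sub: "subalgebra M G" and [measurable]: "U \<in> borel_measurable G" "V \<in> borel_measurable G"
    and V: "\<And>w. w \<in> space M \<Longrightarrow> 0 \<le> V w"
    and le: "\<And>A. A \<in> sets G \<Longrightarrow> (\<integral>\<^sup>+w\<in>A. ennreal (U w) \<partial>M) \<le> (\<integral>\<^sup>+w\<in>A. ennreal (V w) \<partial>M)"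
  shows "AE w in M. U w \<le> V w"
proof -
  have [measurable]: "U \<in> borel_measurable M" "V \<in> borel_measurable M"
    by (auto intro: measurable_from_subalg[OF sub])
  have sp: "space G = space M" and sets: "sets G \<subseteq> sets M"
    using sub by (auto simp: subalgebra_def)
  have "AE w in M. V w \<le> real n \<longrightarrow> U w \<le> V w" for n :: nat
  proof -
    define A where "A = {w\<in>space M. V w < U w \<and> V w \<le> real n}"
    have "{w\<in>space G. V w < U w \<and> V w \<le> real n} \<in> sets G" by measurable
    then have A: "A \<in> sets G" by (simp add: A_def sp)
    then have [measurable]: "A \<in> sets M" using sets by blast
    have "(\<integral>\<^sup>+w\<in>A. ennreal (V w) \<partial>M) \<le> (\<integral>\<^sup>+w. ennreal (real n) \<partial>M)"
      by (intro nn_integral_mono) (auto simp: A_def indicator_def ennreal_leI)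
    also have "\<dots> < \<infinity>" by (simp add: emeasure_eq_measure ennreal_mult_less_top)
    finally have fin: "(\<integral>\<^sup>+w\<in>A. ennreal (V w) \<partial>M) \<noteq> \<infinity>" by simp
    have "(\<integral>\<^sup>+w\<in>A. ennreal (V w) \<partial>M) + (\<integral>\<^sup>+w\<in>A. ennreal (U w - V w) \<partial>M)
        = (\<integral>\<^sup>+w. ennreal (V w) * indicator A w + ennreal (U w - V w) * indicator A w \<partial>M)"
      by (rule nn_integral_add[symmetric]) measurable
    also have "\<dots> = (\<integral>\<^sup>+w\<in>A. ennreal (U w) \<partial>M)"
      using V by (intro nn_integral_cong) (auto simp: A_def indicator_def simp flip: ennreal_plus)
    also have "\<dots> \<le> (\<integral>\<^sup>+w\<in>A. ennreal (V w) \<partial>M) + 0"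
      using le[OF A] by simp
    finally have "(\<integral>\<^sup>+w\<in>A. ennreal (U w - V w) \<partial>M) = 0"
      using fin by (metis ennreal_add_left_cancel_le infinity_ennreal_def le_zero_eq)
    then have "AE w in M. ennreal (U w - V w) * indicator A w = 0"
      by (subst (asm) nn_integral_0_iff_AE) auto
    then show ?thesis
      using AE_space by eventually_elim (auto simp: A_def indicator_def ennreal_eq_0_iff split: if_splits)
  qed
  then have "AE w in M. \<forall>n::nat. V w \<le> real n \<longrightarrow> U w \<le> V w"
    by (simp only: AE_all_countable) blast
  then show ?thesis
    by eventually_elim (meson real_arch_simple)
qed

locale usual_filtered =
  fixes M :: "'a measure" and F :: "real \<Rightarrow> 'a measure"
  assumes usual: "usual_filtration M F"

sublocale usual_filtered \<subseteq> prob_space M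
  using usual by (simp add: usual_filtration_def)

context usual_filtered
begin

lemma F_sub: "0 \<le> t \<Longrightarrow> subalgebra M (F t)"
  using usual by (simp add: usual_filtration_def)

lemma space_F: "0 \<le> t \<Longrightarrow> space (F t) = space M"
  using F_sub by (simp add: subalgebra_def)

lemma sets_F: "0 \<le> t \<Longrightarrow> A \<in> sets (F t) \<Longrightarrow> A \<in> sets M"
  using F_sub[of t] by (auto simp: subalgebra_def)

lemma F_mono: "0 \<le> s \<Longrightarrow> s \<le> t \<Longrightarrow> A \<in> sets (F s) \<Longrightarrow> A \<in> sets (F t)"
  using usual unfolding usual_filtration_def by (elim conjE) (blast dest: subsetD)

lemma F_null:
  assumes "0 \<le> t" "N \<in> null_sets M"
  shows "N \<in> sets (F t)"
proof -
  have "\<forall>N A. N \<in> null_sets M \<longrightarrow> A \<subseteq> N \<longrightarrow> A \<in> sets (F 0)"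
    using usual unfolding usual_filtration_def by (elim conjE)
  then show ?thesis using assms F_mono[of 0 t N] by blast
qed

lemma F_right:
  assumes "0 \<le> t" "\<And>s. t < s \<Longrightarrow> A \<in> sets (F s)"
  shows "A \<in> sets (F t)"
proof -
  have "\<forall>t\<ge>0. sets (F t) = (\<Inter>s\<in>{t<..}. sets (F s))"
    using usual unfolding usual_filtration_def by (elim conjE)
  then have "sets (F t) = (\<Inter>s\<in>{t<..}. sets (F s))"
    using assms(1) by blast
  then show ?thesis using assms(2) by blast
qed

lemma F_space_in: "0 \<le> t \<Longrightarrow> space M \<in> sets (F t)"
  using sets.top[of "F t"] by (simp add: space_F)

lemma measurable_F_M: "0 \<le> t \<Longrightarrow> f \<in> measurable (F t) N \<Longrightarrow> f \<in> measurable M N"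
  using measurable_from_subalg[OF F_sub] by blast

lemma subalgebra_F_F: "0 \<le> s \<Longrightarrow> s \<le> t \<Longrightarrow> subalgebra (F t) (F s)"
  using F_mono by (auto simp: subalgebra_def space_F)

lemma measurable_F_mono: "0 \<le> s \<Longrightarrow> s \<le> t \<Longrightarrow> f \<in> measurable (F s) N \<Longrightarrow> f \<in> measurable (F t) N"
  using measurable_from_subalg[OF subalgebra_F_F] by blast

lemma sigma_finite_F: "0 \<le> t \<Longrightarrow> sigma_finite_subalgebra M (F t)"
  by (intro finite_measure_subalgebra_is_sigma_finite)
     (simp add: finite_measure_subalgebra_def finite_measure_subalgebra_axioms_def F_sub finite_measure_axioms)

lemmas AE_le_F = AE_le_of_nn_integral_le[OF F_sub]

lemma nn_integral_le_of_AE_le: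
  "AE w in M. U w \<le> V w \<Longrightarrow> (\<integral>\<^sup>+w\<in>A. ennreal (U w) \<partial>M) \<le> (\<integral>\<^sup>+w\<in>A. ennreal (V w) \<partial>M)"
  by (intro nn_integral_mono_AE) (auto elim!: eventually_mono simp: indicator_def intro: ennreal_leI)

text \<open>The bridge between almost sure inequalities at time \<open>t\<close> and integrals over
  the events of \<open>F t\<close>.\<close>

lemma AE_le_F_iff:
  assumes "0 \<le> t" "U \<in> borel_measurable (F t)" "V \<in> borel_measurable (F t)" "\<And>w. w \<in> space M \<Longrightarrow> 0 \<le> V w"
  shows "(AE w in M. U w \<le> V w)
    \<longleftrightarrow> (\<forall>A\<in>sets (F t). (\<integral>\<^sup>+w\<in>A. ennreal (U w) \<partial>M) \<le> (\<integral>\<^sup>+w\<in>A. ennreal (V w) \<partial>M))"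
  using AE_le_F[OF assms] nn_integral_le_of_AE_le by blast

lemma AE_eq_F:
  fixes U V :: "'a \<Rightarrow> real"
  assumes "0 \<le> t" "U \<in> borel_measurable (F t)" "V \<in> borel_measurable (F t)"
    "\<And>w. w \<in> space M \<Longrightarrow> 0 \<le> U w" "\<And>w. w \<in> space M \<Longrightarrow> 0 \<le> V w"
    "\<And>A. A \<in> sets (F t) \<Longrightarrow> (\<integral>\<^sup>+w\<in>A. ennreal (U w) \<partial>M) = (\<integral>\<^sup>+w\<in>A. ennreal (V w) \<partial>M)"
  shows "AE w in M. U w = V w"
  using AE_le_F[of t U V] AE_le_F[of t V U] assms by (auto intro!: antisym)

text \<open>A version of the conditional expectation that is real and nonnegative at every point, as
  the pathwise upcrossing argument requires. \<open>enn2real\<close> turns the value \<infinity>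
  into 0; for \<open>Z\<close> of finite mean this happens on a null set only.\<close>

definition cexp :: "('a \<Rightarrow> real) \<Rightarrow> real \<Rightarrow> 'a \<Rightarrow> real" where
  "cexp Z t w = enn2real (nn_cond_exp M (F t) (\<lambda>w. ennreal (Z w)) w)"

lemma cexp_nonneg [simp]: "0 \<le> cexp Z t w"
  by (simp add: cexp_def)

lemma cexp_measurable [measurable]: "cexp Z t \<in> borel_measurable (F t)"
  unfolding cexp_def by measurable

lemma nn_integral_cexp:
  assumes t: "0 \<le> t" and [measurable]: "Z \<in> borel_measurable M"
    and fin: "(\<integral>\<^sup>+w. ennreal (Z w) \<partial>M) < \<infinity>" and A: "A \<in> sets (F t)"
  shows "(\<integral>\<^sup>+w\<in>A. ennreal (cexp Z t w) \<partial>M) = (\<integral>\<^sup>+w\<in>A. ennreal (Z w) \<partial>M)"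
proof -
  interpret S: sigma_finite_subalgebra M "F t" by (rule sigma_finite_F[OF t])
  let ?N = "nn_cond_exp M (F t) (\<lambda>w. ennreal (Z w))"
  have *: "(\<integral>\<^sup>+w\<in>B. ?N w \<partial>M) = (\<integral>\<^sup>+w\<in>B. ennreal (Z w) \<partial>M)" if [measurable]: "B \<in> sets (F t)" for B
    using S.nn_cond_exp_intg[of "indicator B" "\<lambda>w. ennreal (Z w)"] by (simp add: mult.commute)
  have "(\<integral>\<^sup>+w. ?N w \<partial>M) = (\<integral>\<^sup>+w\<in>space M. ?N w \<partial>M)"
    by (auto intro: nn_integral_cong)
  also have "\<dots> = (\<integral>\<^sup>+w\<in>space M. ennreal (Z w) \<partial>M)"
    by (rule *[OF F_space_in[OF t]])
  also have "\<dots> < \<infinity>"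
    using fin by (simp cong: nn_integral_cong)
  finally have "AE w in M. ?N w \<noteq> \<infinity>"
    by (intro nn_integral_noteq_infinite) auto
  then have "(\<integral>\<^sup>+w\<in>A. ennreal (cexp Z t w) \<partial>M) = (\<integral>\<^sup>+w\<in>A. ?N w \<partial>M)"
    by (intro nn_integral_cong_AE) (auto elim!: eventually_mono simp: cexp_def less_top)
  then show ?thesis using *[OF A] by simp
qed

section \<open>A cadlag version of the martingale of conditional expectations of
  \<open>Z\<close>\<close>

context
  fixes Z :: "'a \<Rightarrow> real"
  assumes Z[measurable]: "Z \<in> borel_measurable M" and Z_nonneg: "\<And>w. 0 \<le> Z w"
    and Z_fin: "(\<integral>\<^sup>+w. ennreal (Z w) \<partial>M) < \<infinity>"
begin

lemma cexp_measurable_M [measurable]: "0 \<le> t \<Longrightarrow> cexp Z t \<in> borel_measurable M"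
  by (rule measurable_F_M[OF _ cexp_measurable])

lemma cexp_integrable: "0 \<le> t \<Longrightarrow> integrable M (cexp Z t)"
proof (rule integrableI_nonneg)
  assume t: "0 \<le> t"
  have "(\<integral>\<^sup>+w. ennreal (cexp Z t w) \<partial>M) = (\<integral>\<^sup>+w\<in>space M. ennreal (cexp Z t w) \<partial>M)"
    by (auto intro: nn_integral_cong)
  also have "\<dots> = (\<integral>\<^sup>+w\<in>space M. ennreal (Z w) \<partial>M)"
    by (rule nn_integral_cexp[OF t Z Z_fin F_space_in[OF t]])
  also have "\<dots> < \<infinity>"
    using Z_fin by (simp cong: nn_integral_cong)
  finally show "(\<integral>\<^sup>+w. ennreal (cexp Z t w) \<partial>M) < \<infinity>" .
qed (auto simp: cexp_measurable_M)

lemma integral_cexp_indicator: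
  assumes t: "0 \<le> t" and A: "A \<in> sets (F t)"
  shows "(\<integral>w. indicator A w * cexp Z t w \<partial>M) = (\<integral>w. indicator A w * Z w \<partial>M)"
proof -
  have [measurable]: "A \<in> sets M" by (rule sets_F[OF t A])
  have [measurable]: "cexp Z t \<in> borel_measurable M" by (rule cexp_measurable_M[OF t])
  have "(\<integral>\<^sup>+w. ennreal (indicator A w * cexp Z t w) \<partial>M) = (\<integral>\<^sup>+w\<in>A. ennreal (cexp Z t w) \<partial>M)"
    by (intro nn_integral_cong) (auto simp: indicator_def)
  moreover have "(\<integral>\<^sup>+w. ennreal (indicator A w * Z w) \<partial>M) = (\<integral>\<^sup>+w\<in>A. ennreal (Z w) \<partial>M)"
    by (intro nn_integral_cong) (auto simp: indicator_def)
  ultimately show ?thesis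
    using nn_integral_cexp[OF t Z Z_fin A] Z_nonneg
    by (simp add: integral_eq_nn_integral)
qed

definition grid_upcount :: "real \<Rightarrow> real \<Rightarrow> nat \<Rightarrow> nat \<Rightarrow> 'a \<Rightarrow> ennreal" where
  "grid_upcount a b T n w = of_nat (upcount a b (\<lambda>i. cexp Z (real i / 2 ^ n) w) (T * 2 ^ n))"

lemma grid_upcount_bound:
  assumes "a < b" "0 < a"
  shows grid_upcount_measurable: "grid_upcount a b T n \<in> borel_measurable M"
    and "(\<integral>\<^sup>+w. grid_upcount a b T n w \<partial>M) \<le> ennreal (a / (b - a))"
proof -
  let ?t = "\<lambda>i. real i / 2 ^ n"
  have t: "0 \<le> ?t i" "?t i \<le> ?t (Suc i)" for i
    by (auto simp: divide_right_mono)
  note * = expected_upcount_le[of M "\<lambda>i. F (?t i)" "\<lambda>i. cexp Z (?t i)" a b "T * 2 ^ n"]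
  have **: "(\<integral>w. indicator A w * cexp Z (?t (Suc i)) w \<partial>M) = (\<integral>w. indicator A w * cexp Z (?t i) w \<partial>M)"
    if "A \<in> sets (F (?t i))" for i A
    using integral_cexp_indicator[OF t(1) that] integral_cexp_indicator[OF t(1) F_mono[OF t that]] by simp
  have "(\<lambda>w. upcount a b (\<lambda>i. cexp Z (?t i) w) (T * 2 ^ n)) \<in> measurable M (count_space UNIV)"
    using assms prob_space_axioms F_sub[OF t(1)] F_mono[OF t] cexp_integrable[OF t(1)] **
    by (intro *(1)) auto
  then show "grid_upcount a b T n \<in> borel_measurable M"
    unfolding grid_upcount_def by measurable
  show "(\<integral>\<^sup>+w. grid_upcount a b T n w \<partial>M) \<le> ennreal (a / (b - a))"
    unfolding grid_upcount_def
    using assms prob_space_axioms F_sub[OF t(1)] F_mono[OF t] cexp_integrable[OF t(1)] **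
    by (intro *(2)) auto
qed

text \<open>The upcrossing bound does not depend on the grid, so it survives refinement by
  Fatou.\<close>

lemma nn_integral_liminf_upcount:
  assumes "a < b" "0 < a"
  shows "(\<integral>\<^sup>+w. liminf (\<lambda>n. grid_upcount a b T n w) \<partial>M) \<le> ennreal (a / (b - a))"
proof -
  have "(\<integral>\<^sup>+w. liminf (\<lambda>n. grid_upcount a b T n w) \<partial>M) \<le> liminf (\<lambda>n. \<integral>\<^sup>+w. grid_upcount a b T n w \<partial>M)"
    by (rule nn_integral_liminf) (rule grid_upcount_measurable[OF assms])
  also have "\<dots> \<le> liminf (\<lambda>n. ennreal (a / (b - a)))"
    by (intro Liminf_mono always_eventually allI grid_upcount_bound assms)
  finally show ?thesis by (simp add: Liminf_const)
qed

lemma liminf_upcount_ge: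
  assumes "(0, real T) \<in> cross (\<lambda>s. cexp Z s w) a b ^^ k" "a < b"
  shows "of_nat k \<le> liminf (\<lambda>n. grid_upcount a b T n w)"
proof (rule Liminf_bounded)
  show "\<forall>\<^sub>F n in sequentially. of_nat k \<le> grid_upcount a b T n w"
    using eventually_upcount_ge[OF assms] unfolding grid_upcount_def
    by eventually_elim (auto simp: of_nat_le_iff)
qed

lemma AE_finite_crossings:
  assumes "a < b"
  shows "AE w in M. \<exists>k. (0, real T) \<notin> cross (\<lambda>s. cexp Z s w) a b ^^ Suc k"
proof (cases "0 < a")
  case True
  note [measurable] = grid_upcount_measurable[OF assms True]
  have "AE w in M. liminf (\<lambda>n. grid_upcount a b T n w) \<noteq> \<infinity>"
  proof (rule nn_integral_noteq_infinite)
    show "(\<integral>\<^sup>+w. liminf (\<lambda>n. grid_upcount a b T n w) \<partial>M) \<noteq> \<infinity>"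
      using nn_integral_liminf_upcount[OF assms True, of T] by (metis ennreal_neq_top infinity_ennreal_def neq_top_trans)
  qed measurable
  then show ?thesis
  proof eventually_elim
    case (elim w)
    show ?case
    proof (rule ccontr)
      assume "\<not> ?thesis"
      then have "of_nat (Suc k) \<le> liminf (\<lambda>n. grid_upcount a b T n w)" for k
        using liminf_upcount_ge[where T = T and a = a and b = b and k = "Suc k"] assms by blast
      then show False
        using elim by (metis ennreal_Ex_less_of_nat infinity_ennreal_def leD less_top lessI less_trans of_nat_less_iff)
    qed
  qed
next
  case False
  \<comment> \<open>A nonnegative path never gets below a level \<open>a \<le> 0\<close>.\<close>
  then have "cross (\<lambda>s. cexp Z s w) a b = {}" for w
    using order_le_less_trans[OF cexp_nonneg] by (fastforce simp: cross_def)
  then show ?thesis by (auto intro!: AE_I2 exI[of _ 0])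
qed

text \<open>The upcrossing bound also serves as a maximal inequality: \<open>a / (b - a)\<close>
  tends to 0 as \<open>b\<close> grows, so almost surely some interval above \<open>a\<close> is not
  crossed even once. A path starting below \<open>a\<close> then stays below the upper end of that
  interval.\<close>

lemma AE_bounded_on_dyadics:
  "AE w in M. \<exists>B. \<forall>s\<in>dyadics. s \<le> real T \<longrightarrow> \<bar>cexp Z s w\<bar> \<le> B"
proof -
  have "AE w in M. \<exists>b. (0, real T) \<notin> cross (\<lambda>s. cexp Z s w) (real (Suc a)) (real (Suc a) + 1 + real b)" for a
  proof -
    let ?a = "real (Suc a)" and ?b = "\<lambda>b. real (Suc a) + 1 + real b"
    let ?g = "\<lambda>b w. liminf (\<lambda>n. grid_upcount ?a (?b b) T n w)"
    have ab: "?a < ?b b" "0 < ?a" for b by auto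
    have [measurable]: "?g b \<in> borel_measurable M" for b
      using grid_upcount_measurable[OF ab] by measurable
    have "(\<integral>\<^sup>+w. (INF b. ?g b w) \<partial>M) \<le> ennreal (?a / (1 + real b))" for b
    proof -
      have "(\<integral>\<^sup>+w. (INF b. ?g b w) \<partial>M) \<le> (\<integral>\<^sup>+w. ?g b w \<partial>M)"
        by (intro nn_integral_mono INF_lower) auto
      also have "\<dots> \<le> ennreal (?a / (?b b - ?a))" by (rule nn_integral_liminf_upcount[OF ab])
      finally show ?thesis by (simp add: add.commute add.left_commute)
    qed
    moreover have "(\<lambda>b. ennreal (?a / (1 + real b))) \<longlonglongrightarrow> ennreal 0"
      by (intro tendsto_ennrealI) real_asymp
    ultimately have "(\<integral>\<^sup>+w. (INF b. ?g b w) \<partial>M) \<le> ennreal 0"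
      by (intro LIMSEQ_le_const) auto
    then have "(\<integral>\<^sup>+w. (INF b. ?g b w) \<partial>M) = 0" by simp
    then have "AE w in M. (INF b. ?g b w) = 0"
      by (subst (asm) nn_integral_0_iff_AE) (auto simp del: of_nat_Suc)
    then show ?thesis
    proof eventually_elim
      case (elim w)
      show ?case
      proof (rule ccontr)
        assume neg: "\<not> ?thesis"
        have "1 \<le> ?g b w" for b
          using liminf_upcount_ge[where T = T and a = ?a and b = "?b b" and k = 1] neg ab(1)[of b] by auto
        then have "1 \<le> (INF b. ?g b w)" by (intro INF_greatest)
        then show False using elim by simp
      qed
    qed
  qed
  then have "AE w in M. \<forall>a. \<exists>b. (0, real T) \<notin> cross (\<lambda>s. cexp Z s w) (real (Suc a)) (real (Suc a) + 1 + real b)"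
    by (simp only: AE_all_countable) blast
  then show ?thesis
  proof eventually_elim
    case (elim w)
    \<comment> \<open>With \<open>a\<close> above the value at time 0, any dyadic
      \<open>s > 0\<close> at which the path exceeds the upper level would complete a crossing that
      starts at time 0.\<close>
    obtain a :: nat where a: "cexp Z 0 w < real a" using reals_Archimedean2 by blast
    obtain b where b: "(0, real T) \<notin> cross (\<lambda>s. cexp Z s w) (real (Suc a)) (real (Suc a) + 1 + real b)"
      using elim by blast
    have "cexp Z s w \<le> real (Suc a) + 1 + real b" if s: "s \<in> dyadics" "s \<le> real T" for s
    proof (cases "s = 0")
      case False
      then have "0 < s" using dyadics_nonneg[OF s(1)] by simp
      moreover have "0 \<in> dyadics" using dyadics_grid[of 0 0] by simp
      ultimately show ?thesis
        using b s a crossI[of 0 s 0 "real T" "\<lambda>s. cexp Z s w" "real (Suc a)" "real (Suc a) + 1 + real b"]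
        by force
    qed (use a in auto)
    then show ?case by (intro exI[of _ "real (Suc a) + 1 + real b"]) auto
  qed
qed

lemma AE_regular_path: "AE w in M. regular_path (\<lambda>s. cexp Z s w)"
proof -
  have "AE w in M. a < b \<longrightarrow> (\<exists>k. (0, real T) \<notin> cross (\<lambda>s. cexp Z s w) a b ^^ Suc k)" for T a b
    by (cases "a < b") (simp_all del: relpow.simps add: AE_finite_crossings)
  then have "AE w in M. \<forall>T. \<forall>a\<in>\<rat>. \<forall>b\<in>\<rat>. a < b \<longrightarrow> (\<exists>k. (0, real T) \<notin> cross (\<lambda>s. cexp Z s w) a b ^^ Suc k)"
    by (simp only: AE_all_countable AE_ball_countable[OF countable_rat]) blast
  moreover have "AE w in M. \<forall>T. \<exists>B. \<forall>s\<in>dyadics. s \<le> real T \<longrightarrow> \<bar>cexp Z s w\<bar> \<le> B"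
    using AE_bounded_on_dyadics by (simp add: AE_all_countable)
  ultimately show ?thesis
    by eventually_elim (unfold regular_path_def, blast)
qed

text \<open>Conditional Jensen inequality for the concave truncation at \<open>m\<close>. It
  excludes a loss of mass when \<open>t\<close> is approached from the right, in place of uniform
  integrability.\<close>

lemma nn_integral_min_cexp_ge:
  assumes t: "0 \<le> t" and A: "A \<in> sets (F t)" and m: "0 \<le> m"
  shows "(\<integral>\<^sup>+w\<in>A. ennreal (min (Z w) m) \<partial>M) \<le> (\<integral>\<^sup>+w\<in>A. ennreal (min (cexp Z t w) m) \<partial>M)"
proof -
  let ?Z = "\<lambda>w. min (Z w) m"
  have fin: "(\<integral>\<^sup>+w. ennreal (?Z w) \<partial>M) < \<infinity>"
    by (rule le_less_trans[OF nn_integral_mono Z_fin]) (auto intro: ennreal_leI)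
  have [measurable]: "A \<in> sets M" by (rule sets_F[OF t A])
  have "AE w in M. cexp ?Z t w \<le> cexp Z t w"
  proof (rule AE_le_F[OF t])
    fix B assume B: "B \<in> sets (F t)"
    show "(\<integral>\<^sup>+w\<in>B. ennreal (cexp ?Z t w) \<partial>M) \<le> (\<integral>\<^sup>+w\<in>B. ennreal (cexp Z t w) \<partial>M)"
      using Z_fin fin by (subst (1 2) nn_integral_cexp[OF t _ _ B])
         (auto simp: indicator_def intro!: nn_integral_mono ennreal_leI)
  qed auto
  moreover have "AE w in M. cexp ?Z t w \<le> m"
  proof (rule AE_le_F[OF t])
    fix B assume B: "B \<in> sets (F t)"
    show "(\<integral>\<^sup>+w\<in>B. ennreal (cexp ?Z t w) \<partial>M) \<le> (\<integral>\<^sup>+w\<in>B. ennreal m \<partial>M)"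
      using fin by (subst nn_integral_cexp[OF t _ _ B])
         (auto simp: indicator_def intro!: nn_integral_mono ennreal_leI)
  qed (auto simp: m)
  ultimately have "AE w in M. cexp ?Z t w \<le> min (cexp Z t w) m"
    by eventually_elim simp
  then have "(\<integral>\<^sup>+w\<in>A. ennreal (cexp ?Z t w) \<partial>M) \<le> (\<integral>\<^sup>+w\<in>A. ennreal (min (cexp Z t w) m) \<partial>M)"
    by (rule nn_integral_le_of_AE_le)
  then show ?thesis
    by (subst (asm) nn_integral_cexp[OF t _ fin A]) auto
qed

lemma cexp_dyadic_above_tendsto:
  assumes "regular_path (\<lambda>s. cexp Z s w)" "0 \<le> t"
  shows "(\<lambda>n. cexp Z (dyadic_above t n) w) \<longlonglongrightarrow> right_lim (\<lambda>s. cexp Z s w) t"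
proof -
  have "filterlim (dyadic_above t) (at t within dyadics \<inter> {t<..}) sequentially"
    unfolding filterlim_at
    using dyadic_above_tendsto dyadic_above_in[OF assms(2)] dyadic_above_bounds(1)[of t]
    by (auto simp: order_less_imp_not_eq2)
  then show ?thesis
    by (rule filterlim_compose[OF tendsto_right_lim[OF assms]])
qed

text \<open>For each \<open>r > t\<close> all but finitely many terms are measurable at time
  \<open>r\<close>, hence so is the limit; right continuity of the filtration brings this down to
  \<open>t\<close>.\<close>

lemma measurable_F_of_limit:
  fixes f :: "nat \<Rightarrow> 'a \<Rightarrow> real"
  assumes t: "0 \<le> t"
    and s: "\<And>n. t < s n" "s \<longlonglongrightarrow> t"
    and f: "\<And>n. f n \<in> borel_measurable (F (s n))"
    and lim: "\<And>w. w \<in> space M \<Longrightarrow> (\<lambda>n. f n w) \<longlonglongrightarrow> g w"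
  shows "g \<in> borel_measurable (F t)"
proof (rule measurableI)
  fix B :: "real set" assume B: "B \<in> sets borel"
  show "g -` B \<inter> space (F t) \<in> sets (F t)"
  proof (rule F_right[OF t])
    fix r assume "t < r"
    then obtain n0 where n0: "\<And>n. n \<ge> n0 \<Longrightarrow> s n < r"
      using order_tendstoD(2)[OF s(2)] by (auto simp: eventually_sequentially)
    have "g \<in> borel_measurable (F r)"
    proof (rule borel_measurable_LIMSEQ_real)
      show "(\<lambda>n. f (n + n0) w) \<longlonglongrightarrow> g w" if "w \<in> space (F r)" for w
        using that lim[of w] t \<open>t < r\<close> by (intro LIMSEQ_ignore_initial_segment) (simp add: space_F)
      show "f (n + n0) \<in> borel_measurable (F r)" for n
        by (rule measurable_F_mono[OF _ _ f[of "n + n0"]])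
           (use t s(1)[of "n + n0"] n0[of "n + n0"] in auto)
    qed
    then have "g -` B \<inter> space (F r) \<in> sets (F r)" using B by (rule measurable_sets)
    then show "g -` B \<inter> space (F t) \<in> sets (F r)"
      using t \<open>t < r\<close> by (simp add: space_F)
  qed
qed auto

text \<open>The version is the right limit along dyadic times, set to 0 on a null set containing the
  irregular paths; by completeness that set belongs to every \<open>F t\<close>. Its integrals over
  events are those of \<open>Z\<close>: Fatou gives one inequality and truncation the other.\<close>

lemma ex_cadlag_version:
  "\<exists>N. cadlag M N \<and> (\<forall>t\<ge>0. N t \<in> borel_measurable (F t)) \<and> (\<forall>t\<ge>0. \<forall>w. 0 \<le> N t w)
     \<and> (\<forall>t\<ge>0. \<forall>A\<in>sets (F t). (\<integral>\<^sup>+w\<in>A. ennreal (N t w) \<partial>M) = (\<integral>\<^sup>+w\<in>A. ennreal (Z w) \<partial>M))"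
proof -
  obtain E where E: "{w\<in>space M. \<not> regular_path (\<lambda>s. cexp Z s w)} \<subseteq> E" "E \<in> null_sets M"
    using AE_regular_path by (auto elim!: AE_E simp: null_sets_def)
  define G where "G = space M - E"
  define N where "N t w = (if w \<in> G then right_lim (\<lambda>s. cexp Z s w) t else 0)" for t w
  have G_F[measurable]: "G \<in> sets (F t)" if "0 \<le> t" for t
    unfolding G_def using F_null[OF that E(2)] F_space_in[OF that] by blast
  have reg: "regular_path (\<lambda>s. cexp Z s w)" if "w \<in> G" for w
    using that E(1) by (auto simp: G_def)
  have lim: "(\<lambda>n. indicator G w * cexp Z (dyadic_above t n) w) \<longlonglongrightarrow> N t w" if "0 \<le> t" for t w
    using cexp_dyadic_above_tendsto[OF reg that, of w] by (auto simp: N_def)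
  have meas: "N t \<in> borel_measurable (F t)" if t: "0 \<le> t" for t
  proof (rule measurable_F_of_limit[OF t dyadic_above_bounds(1) dyadic_above_tendsto])
    show "(\<lambda>w. indicator G w * cexp Z (dyadic_above t n) w) \<in> borel_measurable (F (dyadic_above t n))" for n
      using G_F[of "dyadic_above t n"] dyadic_above_bounds(1)[of t n] t
      by (intro borel_measurable_times borel_measurable_indicator cexp_measurable) auto
  qed (rule lim[OF t])
  have nonneg: "0 \<le> N t w" if "0 \<le> t" for t w
    by (rule LIMSEQ_le_const[OF lim[OF that]]) (auto simp: indicator_def)
  have AE_G: "AE w in M. w \<in> G"
    using AE_not_in[OF E(2)] AE_space by eventually_elim (simp add: G_def)
  have integral: "(\<integral>\<^sup>+w\<in>A. ennreal (N t w) \<partial>M) = (\<integral>\<^sup>+w\<in>A. ennreal (Z w) \<partial>M)"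
    if t: "0 \<le> t" and A: "A \<in> sets (F t)" for t A
  proof -
    let ?s = "dyadic_above t"
    have s: "0 \<le> ?s n" "t \<le> ?s n" for n
      using dyadic_above_bounds(1)[of t n] t by auto
    have A': "A \<in> sets (F (?s n))" for n
      using F_mono[OF t s(2) A] .
    have [measurable]: "A \<in> sets M" "G \<in> sets M" "cexp Z (?s n) \<in> borel_measurable M" "N t \<in> borel_measurable M" for n
      using sets_F[OF t] A G_F[OF t] cexp_measurable_M[OF s(1)] measurable_F_M[OF t meas[OF t]] by auto
    have lim_AE: "AE w in M. (\<lambda>n. cexp Z (?s n) w) \<longlonglongrightarrow> N t w"
      using AE_G
    proof eventually_elim
      case (elim w)
      then show ?case using lim[OF t, of w] by simp
    qed
    \<comment> \<open>The event \<open>A\<close> also belongs to \<open>F\<close> at the later times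
      \<open>?s n\<close>, where the integral of the conditional expectation over it is that of
      \<open>Z\<close>; only Fatou is needed for this half.\<close>
    have "(\<integral>\<^sup>+w\<in>A. ennreal (N t w) \<partial>M) \<le> (\<integral>\<^sup>+w. liminf (\<lambda>n. ennreal (cexp Z (?s n) w) * indicator A w) \<partial>M)"
    proof (intro nn_integral_mono_AE)
      show "AE w in M. ennreal (N t w) * indicator A w \<le> liminf (\<lambda>n. ennreal (cexp Z (?s n) w) * indicator A w)"
        using lim_AE
      proof eventually_elim
        case (elim w)
        have "(\<lambda>n. ennreal (cexp Z (?s n) w) * indicator A w) \<longlonglongrightarrow> ennreal (N t w) * indicator A w"
          using elim by (cases "w \<in> A") (auto intro: tendsto_ennrealI)
        then show ?case by (simp add: lim_imp_Liminf)
      qed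
    qed
    also have "\<dots> \<le> liminf (\<lambda>n. \<integral>\<^sup>+w. ennreal (cexp Z (?s n) w) * indicator A w \<partial>M)"
      by (rule nn_integral_liminf) measurable
    also have "\<dots> = (\<integral>\<^sup>+w\<in>A. ennreal (Z w) \<partial>M)"
      using nn_integral_cexp[OF s(1) Z Z_fin A'] by (simp add: Liminf_const)
    finally have le: "(\<integral>\<^sup>+w\<in>A. ennreal (N t w) \<partial>M) \<le> (\<integral>\<^sup>+w\<in>A. ennreal (Z w) \<partial>M)" .
    \<comment> \<open>After truncation at \<open>m\<close>, dominated convergence keeps all the mass
      along \<open>?s n\<close>; then \<open>m\<close> is sent to infinity.\<close>
    have trunc: "(\<integral>\<^sup>+w\<in>A. ennreal (min (Z w) (real m)) \<partial>M) \<le> (\<integral>\<^sup>+w\<in>A. ennreal (N t w) \<partial>M)" for m :: nat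
    proof -
      have "(\<lambda>n. \<integral>\<^sup>+w\<in>A. ennreal (min (cexp Z (?s n) w) (real m)) \<partial>M)
          \<longlonglongrightarrow> (\<integral>\<^sup>+w\<in>A. ennreal (min (N t w) (real m)) \<partial>M)"
      proof (rule nn_integral_dominated_convergence[where w = "\<lambda>_. ennreal (real m)"])
        show "AE w in M. (\<lambda>n. ennreal (min (cexp Z (?s n) w) (real m)) * indicator A w)
            \<longlonglongrightarrow> ennreal (min (N t w) (real m)) * indicator A w"
          using lim_AE
        proof eventually_elim
          case (elim w)
          then show ?case
            by (cases "w \<in> A") (auto intro!: tendsto_ennrealI tendsto_min)
        qed
      qed (auto simp: indicator_def emeasure_eq_measure ennreal_mult_less_top intro: ennreal_leI)
      moreover have "(\<integral>\<^sup>+w\<in>A. ennreal (min (Z w) (real m)) \<partial>M) \<le> (\<integral>\<^sup>+w\<in>A. ennreal (min (cexp Z (?s n) w) (real m)) \<partial>M)" for n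
        by (rule nn_integral_min_cexp_ge[OF s(1) A']) simp
      ultimately have "(\<integral>\<^sup>+w\<in>A. ennreal (min (Z w) (real m)) \<partial>M) \<le> (\<integral>\<^sup>+w\<in>A. ennreal (min (N t w) (real m)) \<partial>M)"
        by (intro LIMSEQ_le_const) auto
      also have "\<dots> \<le> (\<integral>\<^sup>+w\<in>A. ennreal (N t w) \<partial>M)"
        by (intro nn_integral_mono) (auto simp: indicator_def intro: ennreal_leI)
      finally show ?thesis .
    qed
    have "(\<integral>\<^sup>+w\<in>A. ennreal (Z w) \<partial>M) \<le> (\<integral>\<^sup>+w. liminf (\<lambda>m. ennreal (min (Z w) (real m)) * indicator A w) \<partial>M)"
    proof (intro nn_integral_mono)
      fix w
      have "\<forall>\<^sub>F m in sequentially. Z w \<le> real m"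
        using filterlim_real_sequentially by (simp add: filterlim_at_top)
      then have "\<forall>\<^sub>F m in sequentially. ennreal (Z w) * indicator A w \<le> ennreal (min (Z w) (real m)) * indicator A w"
        by eventually_elim (simp add: min_def)
      then show "ennreal (Z w) * indicator A w \<le> liminf (\<lambda>m. ennreal (min (Z w) (real m)) * indicator A w)"
        by (rule Liminf_bounded)
    qed
    also have "\<dots> \<le> liminf (\<lambda>m. \<integral>\<^sup>+w. ennreal (min (Z w) (real m)) * indicator A w \<partial>M)"
      by (rule nn_integral_liminf) measurable
    also have "\<dots> \<le> liminf (\<lambda>m::nat. \<integral>\<^sup>+w\<in>A. ennreal (N t w) \<partial>M)"
      by (intro Liminf_mono always_eventually allI trunc)
    finally show ?thesis
      using le by (simp add: Liminf_const)
  qed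
  have "cadlag M N"
    unfolding cadlag_def
  proof (intro ballI conjI allI impI)
    fix w t :: real assume "0 \<le> t"
    then show "((\<lambda>s. N s w) \<longlongrightarrow> N t w) (at_right t)" for w
      using right_lim_right_continuous[OF reg] by (cases "w \<in> G") (auto simp: N_def)
  next
    fix w t :: real assume "0 < t"
    then show "\<exists>l. ((\<lambda>s. N s w) \<longlongrightarrow> l) (at_left t)" for w
      using right_lim_left_limit[OF reg] by (cases "w \<in> G") (auto simp: N_def)
  qed
  then show ?thesis
    using meas nonneg integral by blast
qed

end

end

section \<open>Progressive processes\<close>

text \<open>Trades the restricted time interval in the definition of progressive measurability for
  an indicator factor on the whole real line, where Fubini can be applied.\<close>

lemma measurable_restrict_pair:
  fixes f :: "real \<times> 'b \<Rightarrow> real"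
  assumes "f \<in> borel_measurable (restrict_space borel {0..T::real} \<Otimes>\<^sub>M N)"
  shows "(\<lambda>p. indicator {0..T} (fst p) * f p) \<in> borel_measurable (borel \<Otimes>\<^sub>M N)"
proof -
  let ?\<Omega> = "{0..T} \<times> space N"
  have \<Omega>: "?\<Omega> \<in> sets (borel \<Otimes>\<^sub>M N)" by auto
  have "(\<lambda>p. p) \<in> measurable (restrict_space (borel \<Otimes>\<^sub>M N) ?\<Omega>) (restrict_space borel {0..T} \<Otimes>\<^sub>M N)"
  proof (rule measurable_pair)
    show "fst \<circ> (\<lambda>p. p) \<in> measurable (restrict_space (borel \<Otimes>\<^sub>M N) ?\<Omega>) (restrict_space borel {0..T})"
      by (intro measurable_restrict_space2) (auto simp: space_restrict_space comp_def intro!: measurable_restrict_space1)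
    show "snd \<circ> (\<lambda>p. p) \<in> measurable (restrict_space (borel \<Otimes>\<^sub>M N) ?\<Omega>) N"
      by (auto simp: comp_def intro!: measurable_restrict_space1)
  qed
  then have "f \<in> borel_measurable (restrict_space (borel \<Otimes>\<^sub>M N) ?\<Omega>)"
    by (rule measurable_compose[OF _ assms])
  then have "(\<lambda>p. indicator ?\<Omega> p *\<^sub>R f p) \<in> borel_measurable (borel \<Otimes>\<^sub>M N)"
    using \<Omega> by (subst (asm) borel_measurable_restrict_space_iff) auto
  then show ?thesis
    by (rule measurable_cong[THEN iffD1, rotated]) (auto simp: indicator_def space_pair_measure)
qed

context usual_filtered
begin

lemma progressiveD:
  "progressive M F X \<Longrightarrow> 0 \<le> t \<Longrightarrow> (\<lambda>p. X (fst p) (snd p)) \<in> borel_measurable (restrict_space borel {0..t} \<Otimes>\<^sub>M F t)"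
  by (simp add: progressive_def split_beta')

lemma progressiveI:
  "(\<And>t. 0 \<le> t \<Longrightarrow> (\<lambda>p. X (fst p) (snd p)) \<in> borel_measurable (restrict_space borel {0..t} \<Otimes>\<^sub>M F t)) \<Longrightarrow> progressive M F X"
  by (simp add: progressive_def split_beta')

lemma progressive_adapted:
  assumes "progressive M F X" "0 \<le> t"
  shows "X t \<in> borel_measurable (F t)"
proof -
  have "Pair t \<in> measurable (F t) (restrict_space borel {0..t} \<Otimes>\<^sub>M F t)"
    using assms(2) by (intro measurable_Pair1') (simp add: space_restrict_space)
  from measurable_compose[OF this progressiveD[OF assms]] show ?thesis by simp
qed

lemma progressive_adapted_M: "progressive M F X \<Longrightarrow> 0 \<le> t \<Longrightarrow> X t \<in> borel_measurable M"
  by (rule measurable_F_M[OF _ progressive_adapted])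

lemma progressive_joint_F:
  assumes "progressive M F X" "0 \<le> T"
  shows "(\<lambda>p. indicator {0..T} (fst p) * X (fst p) (snd p)) \<in> borel_measurable (borel \<Otimes>\<^sub>M F T)"
  by (rule measurable_restrict_pair[OF progressiveD[OF assms]])

text \<open>Nothing is known about a process at negative times; the indicator of
  \<open>{0..}\<close> removes them.\<close>

lemma progressive_joint:
  assumes X: "progressive M F X"
  shows "(\<lambda>p. indicator {0..} (fst p) * X (fst p) (snd p)) \<in> borel_measurable (borel \<Otimes>\<^sub>M M)"
proof (rule borel_measurable_LIMSEQ_real)
  show "(\<lambda>p. indicator {0..real n} (fst p) * X (fst p) (snd p)) \<in> borel_measurable (borel \<Otimes>\<^sub>M M)" for n
  proof -
    have "(\<lambda>p. p) \<in> measurable (borel \<Otimes>\<^sub>M M) (borel \<Otimes>\<^sub>M F (real n))"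
    proof (rule measurable_pair)
      have "(\<lambda>w. w) \<in> measurable M (F (real n))"
        by (rule measurable_F_M[of "real n"]) auto
      from measurable_compose[OF measurable_snd this]
      show "snd \<circ> (\<lambda>p. p) \<in> measurable (borel \<Otimes>\<^sub>M M) (F (real n))"
        by (simp add: comp_def)
    qed (simp add: comp_def)
    from measurable_compose[OF this progressive_joint_F[OF X, of "real n"]] show ?thesis by simp
  qed
  show "(\<lambda>n. indicator {0..real n} (fst p) * X (fst p) (snd p)) \<longlonglongrightarrow> indicator {0..} (fst p) * X (fst p) (snd p)" for p
  proof (rule tendsto_eventually)
    show "\<forall>\<^sub>F n in sequentially. indicator {0..real n} (fst p) * X (fst p) (snd p) = indicator {0..} (fst p) * X (fst p) (snd p)"
      using filterlim_real_sequentially unfolding filterlim_at_top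
      by (rule allE[of _ "fst p"]) (auto elim!: eventually_mono simp: indicator_def)
  qed
qed

lemma progressive_path:
  assumes "progressive M F X" "w \<in> space M"
  shows "(\<lambda>s. indicator {0..} s * X s w) \<in> borel_measurable borel"
  using measurable_compose[OF measurable_Pair2'[OF assms(2)] progressive_joint[OF assms(1)]] by simp

lemma progressive_path_measurable:
  assumes "progressive M F X" "w \<in> space M" "B \<in> sets borel" "B \<subseteq> {0..}"
  shows "(\<lambda>s. ennreal (X s w) * indicator B s) \<in> borel_measurable borel"
proof -
  note [measurable] = assms(3) progressive_path[OF assms(1,2)]
  have "(\<lambda>s. ennreal (indicator {0..} s * X s w) * indicator B s) \<in> borel_measurable borel"
    by measurable
  also have "(\<lambda>s. ennreal (indicator {0..} s * X s w) * indicator B s) = (\<lambda>s. ennreal (X s w) * indicator B s)"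
    using assms(4) by (auto simp: fun_eq_iff indicator_def)
  finally show ?thesis .
qed

lemma progressive_comp2:
  assumes X: "progressive M F X" and Y: "progressive M F Y"
    and h[measurable]: "(\<lambda>p. h (fst p) (snd p)) \<in> borel_measurable (borel \<Otimes>\<^sub>M borel)"
  shows "progressive M F (\<lambda>s w. h (X s w) (Y s w) :: real)"
proof (rule progressiveI)
  fix t :: real assume t: "0 \<le> t"
  note [measurable] = progressiveD[OF X t] progressiveD[OF Y t]
  have "(\<lambda>p. (X (fst p) (snd p), Y (fst p) (snd p))) \<in> measurable (restrict_space borel {0..t} \<Otimes>\<^sub>M F t) (borel \<Otimes>\<^sub>M borel)"
    by measurable
  from measurable_compose[OF this h] show "(\<lambda>p. h (X (fst p) (snd p)) (Y (fst p) (snd p))) \<in> borel_measurable (restrict_space borel {0..t} \<Otimes>\<^sub>M F t)"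
    by simp
qed

lemma progressive_time:
  assumes "f \<in> borel_measurable borel"
  shows "progressive M F (\<lambda>s w. f s)"
proof (rule progressiveI)
  fix t :: real
  have "fst \<in> measurable (restrict_space borel {0..t} \<Otimes>\<^sub>M F t) borel"
    by (rule measurable_compose[OF measurable_fst measurable_restrict_space1[OF measurable_ident_sets[OF refl]]])
  from measurable_compose[OF this assms]
  show "(\<lambda>p. f (fst p)) \<in> borel_measurable (restrict_space borel {0..t} \<Otimes>\<^sub>M F t)" .
qed

lemma progressive_lim:
  assumes "\<And>n. progressive M F (X n)"
  shows "progressive M F (\<lambda>s w. lim (\<lambda>n. X n s w) :: real)"
proof (rule progressiveI)
  fix t :: real assume "0 \<le> t"
  then show "(\<lambda>p. lim (\<lambda>n. X n (fst p) (snd p))) \<in> borel_measurable (restrict_space borel {0..t} \<Otimes>\<^sub>M F t)"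
    by (rule borel_measurable_lim_metric[OF progressiveD[OF assms]])
qed

text \<open>On [0, t] the process is approximated by its values at the next grid time, capped at
  \<open>t\<close>. The cap keeps every approximation measurable at time \<open>t\<close>.\<close>

lemma right_continuous_adapted_progressive:
  assumes meas: "\<And>t. 0 \<le> t \<Longrightarrow> X t \<in> borel_measurable (F t)"
    and cont: "\<And>t w. 0 \<le> t \<Longrightarrow> w \<in> space M \<Longrightarrow> ((\<lambda>s. X s w) \<longlongrightarrow> X t w) (at_right t)"
  shows "progressive M F X"
proof (rule progressiveI)
  fix t :: real assume t: "0 \<le> t"
  let ?N = "restrict_space borel {0..t} \<Otimes>\<^sub>M F t"
  have fst_meas: "fst \<in> borel_measurable ?N"
    by (rule measurable_compose[OF measurable_fst measurable_restrict_space1[OF measurable_ident_sets[OF refl]]])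
  show "(\<lambda>p. X (fst p) (snd p)) \<in> borel_measurable ?N"
  proof (rule borel_measurable_LIMSEQ_real)
    show "(\<lambda>p. X (min t (dyadic_above (fst p) n)) (snd p)) \<in> borel_measurable ?N" for n
    proof -
      \<comment> \<open>The process is first frozen at a time given by a fixed integer
        \<open>i\<close>, and the random integer is substituted afterwards. \<open>max 0\<close>
        covers negative \<open>i\<close>; it changes nothing for the integers that occur.\<close>
      have "(\<lambda>p. X (max 0 (min t ((of_int i + 1) / 2 ^ n))) (snd p)) \<in> borel_measurable ?N" for i :: int
        using t by (intro measurable_compose[OF measurable_snd] measurable_F_mono[OF _ _ meas]) auto
      moreover have "(\<lambda>p. \<lfloor>fst p * 2 ^ n\<rfloor>) \<in> measurable ?N (count_space UNIV)"
        using fst_meas by measurable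
      ultimately have "(\<lambda>p. X (max 0 (min t ((of_int \<lfloor>fst p * 2 ^ n\<rfloor> + 1) / 2 ^ n))) (snd p)) \<in> borel_measurable ?N"
        by (rule measurable_compose_countable)
      moreover have "max 0 (min t ((of_int \<lfloor>fst p * 2 ^ n\<rfloor> + 1) / 2 ^ n)) = min t (dyadic_above (fst p) n)"
        if "p \<in> space ?N" for p
        using that t dyadic_above_bounds(1)[of "fst p" n]
        by (auto simp: space_pair_measure space_restrict_space dyadic_above_def[symmetric] intro!: max_absorb2)
      ultimately show ?thesis
        by (simp cong: measurable_cong)
    qed
    show "(\<lambda>n. X (min t (dyadic_above (fst p) n)) (snd p)) \<longlonglongrightarrow> X (fst p) (snd p)" if "p \<in> space ?N" for p
    proof -
      obtain s w where p: "p = (s, w)" "0 \<le> s" "s \<le> t" "w \<in> space M"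
        using \<open>p \<in> space ?N\<close> t by (auto simp: space_pair_measure space_restrict_space space_F)
      show ?thesis
      proof (cases "s = t")
        case True
        then have "min t (dyadic_above s n) = s" for n
          using dyadic_above_bounds(1)[of s n] by simp
        then show ?thesis by (simp add: p)
      next
        case False
        have "(\<lambda>n. min t (dyadic_above s n)) \<longlonglongrightarrow> min t s"
          by (intro tendsto_intros dyadic_above_tendsto)
        then have "filterlim (\<lambda>n. min t (dyadic_above s n)) (at_right s) sequentially"
          unfolding filterlim_at using False p dyadic_above_bounds(1)[of s]
          by (auto simp: min_def order_less_imp_not_eq2)
        from filterlim_compose[OF cont[OF p(2,4)] this] show ?thesis by (simp add: p)
      qed
    qed
  qed
qed

section \<open>Tail integrals\<close>

text \<open>In these terms the utility equation is \<open>mass A W t = tail A (gen W) t\<close> for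
  all \<open>A\<close> in \<open>F t\<close>. The time integral of \<open>tail\<close> stands
  outside the expectation, so that comparing tails reduces to comparing masses at fixed
  times.\<close>

definition mass :: "'a set \<Rightarrow> (real \<Rightarrow> 'a \<Rightarrow> real) \<Rightarrow> real \<Rightarrow> ennreal" where
  "mass A X s = (\<integral>\<^sup>+w\<in>A. ennreal (X s w) \<partial>M)"

definition tail :: "'a set \<Rightarrow> (real \<Rightarrow> 'a \<Rightarrow> real) \<Rightarrow> real \<Rightarrow> ennreal" where
  "tail A X t = (\<integral>\<^sup>+s\<in>{t..}. mass A X s \<partial>lborel)"

lemma measurable_lborel_pair:
  "measurable (lborel \<Otimes>\<^sub>M N) L = measurable (borel \<Otimes>\<^sub>M N) L"
  "measurable (N \<Otimes>\<^sub>M lborel) L = measurable (N \<Otimes>\<^sub>M borel) L"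
  by (rule measurable_cong_sets[OF sets_pair_measure_cong refl]; simp)+

lemma pair_lborel_M: "pair_sigma_finite lborel M"
  by (simp add: pair_sigma_finite_def sigma_finite_lborel sigma_finite_measure_axioms)

lemma progressive_ennreal_joint:
  assumes "progressive M F X" "A \<in> sets M" "0 \<le> t"
  shows "(\<lambda>p. ennreal (X (fst p) (snd p)) * indicator A (snd p) * indicator {t..} (fst p)) \<in> borel_measurable (lborel \<Otimes>\<^sub>M M)"
proof -
  note [measurable] = progressive_joint[OF assms(1)] assms(2)
  have "(\<lambda>p. ennreal (indicator {0..} (fst p) * X (fst p) (snd p)) * indicator A (snd p) * indicator {t..} (fst p)) \<in> borel_measurable (borel \<Otimes>\<^sub>M M)"
    by measurable
  also have "(\<lambda>p. ennreal (indicator {0..} (fst p) * X (fst p) (snd p)) * indicator A (snd p) * indicator {t..} (fst p))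
      = (\<lambda>p. ennreal (X (fst p) (snd p)) * indicator A (snd p) * indicator {t..} (fst p))"
    using assms(3) by (auto simp: fun_eq_iff indicator_def)
  finally show ?thesis
    by (simp only: measurable_lborel_pair)
qed

lemma mass_measurable:
  assumes "progressive M F X" "A \<in> sets M" "0 \<le> t"
  shows "(\<lambda>s. mass A X s * indicator {t..} s) \<in> borel_measurable lborel"
proof -
  have "(\<lambda>s. \<integral>\<^sup>+w. ennreal (X s w) * indicator A w * indicator {t..} s \<partial>M) \<in> borel_measurable lborel"
    using borel_measurable_nn_integral_fst[OF progressive_ennreal_joint[OF assms]] by simp
  moreover have "(\<integral>\<^sup>+w. ennreal (X s w) * indicator A w * indicator {t..} s \<partial>M) = mass A X s * indicator {t..} s" for s
    by (auto simp: mass_def indicator_def)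
  ultimately show ?thesis by simp
qed

lemma tail_Fubini:
  assumes X: "progressive M F X" and A: "A \<in> sets M" and t: "0 \<le> t"
  shows "(\<lambda>w. \<integral>\<^sup>+s\<in>{t..}. ennreal (X s w) \<partial>lborel) \<in> borel_measurable M"
    and "tail A X t = (\<integral>\<^sup>+w\<in>A. (\<integral>\<^sup>+s\<in>{t..}. ennreal (X s w) \<partial>lborel) \<partial>M)"
proof -
  interpret P: pair_sigma_finite lborel M by (rule pair_lborel_M)
  note j = progressive_ennreal_joint[OF X _ t]
  have "(\<lambda>p. ennreal (X (snd p) (fst p)) * indicator (space M) (fst p) * indicator {t..} (snd p)) \<in> borel_measurable (M \<Otimes>\<^sub>M lborel)"
    by (rule measurable_compose[OF measurable_pair_swap' j[OF sets.top], simplified split_beta' fst_conv snd_conv])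
  from lborel.borel_measurable_nn_integral_fst[OF this]
  have "(\<lambda>w. \<integral>\<^sup>+s. ennreal (X s w) * indicator (space M) w * indicator {t..} s \<partial>lborel) \<in> borel_measurable M"
    by simp
  then show "(\<lambda>w. \<integral>\<^sup>+s\<in>{t..}. ennreal (X s w) \<partial>lborel) \<in> borel_measurable M"
    by (rule measurable_cong[THEN iffD1, rotated]) simp
  have "tail A X t = (\<integral>\<^sup>+s. (\<integral>\<^sup>+w. ennreal (X s w) * indicator A w * indicator {t..} s \<partial>M) \<partial>lborel)"
    unfolding tail_def mass_def by (intro nn_integral_cong) (auto simp: indicator_def)
  also have "\<dots> = (\<integral>\<^sup>+w. (\<integral>\<^sup>+s. ennreal (X s w) * indicator A w * indicator {t..} s \<partial>lborel) \<partial>M)"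
    using P.Fubini[OF j[OF A]] by (simp add: split_beta')
  also have "\<dots> = (\<integral>\<^sup>+w\<in>A. (\<integral>\<^sup>+s\<in>{t..}. ennreal (X s w) \<partial>lborel) \<partial>M)"
    by (intro nn_integral_cong) (auto simp: indicator_def)
  finally show "tail A X t = (\<integral>\<^sup>+w\<in>A. (\<integral>\<^sup>+s\<in>{t..}. ennreal (X s w) \<partial>lborel) \<partial>M)" .
qed

lemma PplusD:
  "Pplus M F X \<Longrightarrow> progressive M F X"
  "Pplus M F X \<Longrightarrow> 0 \<le> t \<Longrightarrow> w \<in> space M \<Longrightarrow> 0 \<le> X t w"
  by (auto simp: Pplus_def)

lemma running_integral_measurable:
  assumes X: "progressive M F X" and t: "0 \<le> t"
  shows "(\<lambda>w. \<integral>\<^sup>+s\<in>{0..t}. ennreal (X s w) \<partial>lborel) \<in> borel_measurable (F t)"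
proof -
  note [measurable] = progressive_joint_F[OF X t]
  have "(\<lambda>p. ennreal (indicator {0..t} (fst p) * X (fst p) (snd p))) \<in> borel_measurable (borel \<Otimes>\<^sub>M F t)"
    by measurable
  then have "(\<lambda>p. ennreal (indicator {0..t} (snd p) * X (snd p) (fst p))) \<in> borel_measurable (F t \<Otimes>\<^sub>M borel)"
    by (rule measurable_compose[OF measurable_pair_swap', where g = "\<lambda>p. ennreal (indicator {0..t} (fst p) * X (fst p) (snd p))", simplified split_beta' fst_conv snd_conv])
  then have "(\<lambda>p. ennreal (indicator {0..t} (snd p) * X (snd p) (fst p))) \<in> borel_measurable (F t \<Otimes>\<^sub>M lborel)"
    by (simp only: measurable_lborel_pair)
  from lborel.borel_measurable_nn_integral_fst[OF this]
  have "(\<lambda>w. \<integral>\<^sup>+s. ennreal (indicator {0..t} s * X s w) \<partial>lborel) \<in> borel_measurable (F t)"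
    by simp
  moreover have "(\<integral>\<^sup>+s. ennreal (indicator {0..t} s * X s w) \<partial>lborel) = (\<integral>\<^sup>+s\<in>{0..t}. ennreal (X s w) \<partial>lborel)" for w
    by (intro nn_integral_cong) (auto simp: indicator_def)
  ultimately show ?thesis by simp
qed

end

section \<open>Running integrals and the cadlag version of a tail integral\<close>

lemma running_integral_continuous:
  fixes h :: "real \<Rightarrow> real"
  assumes [measurable]: "(\<lambda>s. indicator {0..} s * h s) \<in> borel_measurable borel"
    and nonneg: "\<And>s. 0 \<le> s \<Longrightarrow> 0 \<le> h s"
    and fin: "(\<integral>\<^sup>+s\<in>{0..}. ennreal (h s) \<partial>lborel) < \<infinity>"
  shows "continuous_on {0..T} (\<lambda>t. enn2real (\<integral>\<^sup>+s\<in>{0..t}. ennreal (h s) \<partial>lborel))"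
proof -
  let ?h = "\<lambda>s. indicator {0..} s * h s"
  have eq: "ennreal (?h s) = ennreal (h s) * indicator {0..} s" for s
    by (auto simp: indicator_def)
  have int: "integrable lborel ?h"
  proof (rule integrableI_nonneg)
    show "AE s in lborel. 0 \<le> ?h s"
      using nonneg by (intro AE_I2) (simp add: indicator_def)
    show "(\<integral>\<^sup>+s. ennreal (?h s) \<partial>lborel) < \<infinity>"
      unfolding eq using fin .
  qed simp
  have set_int: "set_integrable lborel {0..t} ?h" for t
    using int unfolding set_integrable_def by (intro integrable_mult_indicator) auto
  have "enn2real (\<integral>\<^sup>+s\<in>{0..t}. ennreal (h s) \<partial>lborel) = integral {0..t} ?h" for t
  proof -
    have "integral {0..t} ?h = (\<integral>s. indicator {0..t} s * h s \<partial>lborel)"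
      unfolding set_borel_integral_eq_integral(2)[OF set_int[of t], symmetric] set_lebesgue_integral_def
      by (intro Bochner_Integration.integral_cong) (auto simp: indicator_def)
    also have "\<dots> = enn2real (\<integral>\<^sup>+s. ennreal (indicator {0..t} s * h s) \<partial>lborel)"
    proof (rule integral_eq_nn_integral)
      have "(\<lambda>s. indicator {0..t} s * h s) = (\<lambda>s. indicator {0..t} s * ?h s)"
        by (auto simp: fun_eq_iff indicator_def)
      then show "(\<lambda>s. indicator {0..t} s * h s) \<in> borel_measurable lborel" by simp
    qed (auto simp: nonneg indicator_def)
    also have "(\<integral>\<^sup>+s. ennreal (indicator {0..t} s * h s) \<partial>lborel) = (\<integral>\<^sup>+s\<in>{0..t}. ennreal (h s) \<partial>lborel)"
      by (intro nn_integral_cong) (auto simp: indicator_def)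
    finally show ?thesis by simp
  qed
  moreover have "continuous_on {0..T} (\<lambda>t. integral {0..t} ?h)"
    by (intro indefinite_integral_continuous_1 set_borel_integral_eq_integral(1) set_int)
  ultimately show ?thesis by simp
qed

context usual_filtered
begin

text \<open>The conditional tail is the martingale \<open>N\<close> of the total integral
  \<open>Z\<close> minus the running integral \<open>B\<close>. The first has a cadlag version and
  the second is continuous, hence the difference is cadlag.\<close>

lemma ex_cadlag_tail_version:
  assumes g: "Pplus M F g" and fin: "tail (space M) g 0 < \<infinity>"
  shows "\<exists>W. cadlag M W \<and> Pplus M F W \<and> (\<forall>t\<ge>0. \<forall>A\<in>sets (F t). mass A W t = tail A g t)"
proof -
  note prog = PplusD(1)[OF g]
  let ?I = "\<lambda>w. \<integral>\<^sup>+s\<in>{0..}. ennreal (g s w) \<partial>lborel"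
  have I_M[measurable]: "?I \<in> borel_measurable M"
    by (rule tail_Fubini(1)[OF prog sets.top order_refl])
  have "(\<integral>\<^sup>+w. ?I w \<partial>M) = tail (space M) g 0"
    by (subst tail_Fubini(2)[OF prog sets.top order_refl]) (auto intro: nn_integral_cong)
  then have I_fin: "(\<integral>\<^sup>+w. ?I w \<partial>M) < \<infinity>" using fin by simp
  define E where "E = {w\<in>space M. ?I w < \<infinity>}"
  have AE_E: "AE w in M. w \<in> E"
    using nn_integral_noteq_infinite[OF I_M less_imp_neq[OF I_fin]] AE_space
    by eventually_elim (simp add: E_def less_top)
  have E_M[measurable]: "E \<in> sets M" unfolding E_def by measurable
  have null: "space M - E \<in> null_sets M"
    using AE_E by (subst (asm) AE_iff_null) (auto simp: set_diff_eq)
  have E_F: "E \<in> sets (F t)" if "0 \<le> t" for t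
  proof -
    have "space M - (space M - E) \<in> sets (F t)"
      using F_null[OF that null] F_space_in[OF that] by blast
    moreover have "space M - (space M - E) = E" by (auto simp: E_def)
    ultimately show ?thesis by simp
  qed
  define Z where "Z w = (if w \<in> E then enn2real (?I w) else 0)" for w
  define B where "B t w = (if w \<in> E then enn2real (\<integral>\<^sup>+s\<in>{0..t}. ennreal (g s w) \<partial>lborel) else 0)" for t w
  have Z_M[measurable]: "Z \<in> borel_measurable M" unfolding Z_def by measurable
  have Z_eq: "ennreal (Z w) = ?I w" if "w \<in> E" for w
    using that by (auto simp: Z_def E_def less_top)
  have B_F: "B t \<in> borel_measurable (F t)" if "0 \<le> t" for t
    using running_integral_measurable[OF prog that] E_F[OF that] unfolding B_def by measurable
  have B_eq: "ennreal (B t w) = (\<integral>\<^sup>+s\<in>{0..t}. ennreal (g s w) \<partial>lborel)" if "w \<in> E" "0 \<le> t" for t w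
  proof -
    have "(\<integral>\<^sup>+s\<in>{0..t}. ennreal (g s w) \<partial>lborel) \<le> ?I w"
      by (intro nn_integral_mono) (auto simp: indicator_def)
    also have "\<dots> < \<top>" using that by (simp add: E_def)
    finally show ?thesis using that by (simp add: B_def)
  qed
  have "(\<integral>\<^sup>+w. ennreal (Z w) \<partial>M) = (\<integral>\<^sup>+w. ?I w \<partial>M)"
    using AE_E by (intro nn_integral_cong_AE) (auto elim!: eventually_mono simp: Z_eq)
  then have Z_fin: "(\<integral>\<^sup>+w. ennreal (Z w) \<partial>M) < \<infinity>" using I_fin by simp
  have Z_nonneg: "0 \<le> Z w" for w by (simp add: Z_def)
  obtain N where N': "cadlag M N" "\<forall>t\<ge>0. N t \<in> borel_measurable (F t)" "\<forall>t\<ge>0. \<forall>w. 0 \<le> N t w"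
    "\<forall>t\<ge>0. \<forall>A\<in>sets (F t). (\<integral>\<^sup>+w\<in>A. ennreal (N t w) \<partial>M) = (\<integral>\<^sup>+w\<in>A. ennreal (Z w) \<partial>M)"
    using ex_cadlag_version[OF Z_M Z_nonneg Z_fin] by (elim exE conjE)
  have N: "cadlag M N" "\<And>t. 0 \<le> t \<Longrightarrow> N t \<in> borel_measurable (F t)" "\<And>t w. 0 \<le> t \<Longrightarrow> 0 \<le> N t w"
    "\<And>t A. 0 \<le> t \<Longrightarrow> A \<in> sets (F t) \<Longrightarrow> (\<integral>\<^sup>+w\<in>A. ennreal (N t w) \<partial>M) = (\<integral>\<^sup>+w\<in>A. ennreal (Z w) \<partial>M)"
    using N' by simp_all
  \<comment> \<open>\<open>B t \<le> N t\<close> holds only almost surely; \<open>max 0\<close>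
    makes \<open>W\<close> nonnegative at every point without spoiling the path property.\<close>
  define W where "W t w = max 0 (N t w - B t w)" for t w
  have B_cont: "continuous_on {0..T} (\<lambda>t. B t w)" if "w \<in> space M" for T w
  proof (cases "w \<in> E")
    case True
    have "(\<lambda>s. indicator {0..} s * g s w) \<in> borel_measurable borel"
      by (rule progressive_path[OF prog that])
    then have "continuous_on {0..T} (\<lambda>t. enn2real (\<integral>\<^sup>+s\<in>{0..t}. ennreal (g s w) \<partial>lborel))"
      using True PplusD(2)[OF g _ that] by (intro running_integral_continuous) (auto simp: E_def)
    then show ?thesis using True by (simp add: B_def)
  qed (simp add: B_def)
  have W_cadlag: "cadlag M W"
    unfolding cadlag_def
  proof (intro ballI conjI allI impI)
    fix w :: 'a and t :: real assume w: "w \<in> space M" and t: "0 \<le> t"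
    have "((\<lambda>s. B s w) \<longlongrightarrow> B t w) (at_right t)"
      by (rule continuous_on_Icc_at_rightD[of t "t + 1" "\<lambda>t. B t w"])
         (use t in \<open>auto intro: continuous_on_subset[OF B_cont[OF w, of "t + 1"]]\<close>)
    moreover have "((\<lambda>s. N s w) \<longlongrightarrow> N t w) (at_right t)"
      using N(1) w t by (auto simp: cadlag_def)
    ultimately show "((\<lambda>s. W s w) \<longlongrightarrow> W t w) (at_right t)"
      unfolding W_def by (intro tendsto_max tendsto_diff tendsto_const)
  next
    fix w :: 'a and t :: real assume w: "w \<in> space M" and t: "0 < t"
    have "((\<lambda>s. B s w) \<longlongrightarrow> B t w) (at_left t)"
      using continuous_on_Icc_at_leftD[OF B_cont[OF w, of t] t] .
    moreover obtain l where "((\<lambda>s. N s w) \<longlongrightarrow> l) (at_left t)"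
      using N(1) w t unfolding cadlag_def by blast
    ultimately show "\<exists>l. ((\<lambda>s. W s w) \<longlongrightarrow> l) (at_left t)"
      unfolding W_def by (intro exI[of _ "max 0 (l - B t w)"] tendsto_max tendsto_diff tendsto_const)
  qed
  have W_F: "W t \<in> borel_measurable (F t)" if "0 \<le> t" for t
    using N(2)[OF that] B_F[OF that] unfolding W_def by measurable
  have "progressive M F W"
    using W_F W_cadlag by (intro right_continuous_adapted_progressive) (auto simp: cadlag_def)
  then have W_Pplus: "Pplus M F W" by (simp add: Pplus_def W_def)
  have "mass A W t = tail A g t" if t: "0 \<le> t" and A: "A \<in> sets (F t)" for t A
  proof -
    let ?R = "\<lambda>w. \<integral>\<^sup>+s\<in>{t..}. ennreal (g s w) \<partial>lborel"
    have [measurable]: "A \<in> sets M" "B t \<in> borel_measurable M" "N t \<in> borel_measurable M" "W t \<in> borel_measurable M" "?R \<in> borel_measurable M"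
      using sets_F[OF t A] measurable_F_M[OF t] B_F[OF t] N(2)[OF t] W_F[OF t] tail_Fubini(1)[OF prog sets.top t] by auto
    have split: "ennreal (Z w) = ennreal (B t w) + ?R w" if "w \<in> E" for w
    proof -
      have w: "w \<in> space M" using that by (simp add: E_def)
      have "?I w = (\<integral>\<^sup>+s. ennreal (g s w) * indicator {0..t} s + ennreal (g s w) * indicator {t..} s \<partial>lborel)"
        using AE_lborel_singleton[of t] t
        by (intro nn_integral_cong_AE) (auto elim!: eventually_mono simp: indicator_def)
      also have "\<dots> = (\<integral>\<^sup>+s\<in>{0..t}. ennreal (g s w) \<partial>lborel) + ?R w"
        using progressive_path_measurable[OF prog w, of "{0..t}"] progressive_path_measurable[OF prog w, of "{t..}"] t
        by (intro nn_integral_add) (auto simp: subset_eq)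
      finally show ?thesis using Z_eq B_eq that t by simp
    qed
    have "AE w in M. B t w \<le> N t w"
    proof (rule AE_le_F[OF t B_F[OF t] N(2)[OF t] N(3)[OF t]])
      fix A assume A: "A \<in> sets (F t)"
      have "(\<integral>\<^sup>+w\<in>A. ennreal (B t w) \<partial>M) \<le> (\<integral>\<^sup>+w\<in>A. ennreal (Z w) \<partial>M)"
        using AE_E by (intro nn_integral_mono_AE) (auto elim!: eventually_mono simp: split indicator_def)
      then show "(\<integral>\<^sup>+w\<in>A. ennreal (B t w) \<partial>M) \<le> (\<integral>\<^sup>+w\<in>A. ennreal (N t w) \<partial>M)"
        using N(4)[OF t A] by simp
    qed
    then have "AE w in M. ennreal (N t w) * indicator A w = ennreal (B t w) * indicator A w + ennreal (W t w) * indicator A w"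
      by eventually_elim (auto simp: W_def B_def indicator_def simp flip: ennreal_plus)
    then have "(\<integral>\<^sup>+w\<in>A. ennreal (N t w) \<partial>M) = (\<integral>\<^sup>+w. ennreal (B t w) * indicator A w + ennreal (W t w) * indicator A w \<partial>M)"
      by (rule nn_integral_cong_AE)
    also have "\<dots> = (\<integral>\<^sup>+w\<in>A. ennreal (B t w) \<partial>M) + mass A W t"
      unfolding mass_def by (intro nn_integral_add) measurable
    finally have 1: "(\<integral>\<^sup>+w\<in>A. ennreal (Z w) \<partial>M) = (\<integral>\<^sup>+w\<in>A. ennreal (B t w) \<partial>M) + mass A W t"
      using N(4)[OF t A] by simp
    have "(\<integral>\<^sup>+w\<in>A. ennreal (Z w) \<partial>M) = (\<integral>\<^sup>+w. ennreal (B t w) * indicator A w + ?R w * indicator A w \<partial>M)"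
      using AE_E by (intro nn_integral_cong_AE) (auto elim!: eventually_mono simp: split indicator_def)
    also have "\<dots> = (\<integral>\<^sup>+w\<in>A. ennreal (B t w) \<partial>M) + tail A g t"
      unfolding tail_Fubini(2)[OF prog \<open>A \<in> sets M\<close> t] by (intro nn_integral_add) measurable
    finally have 2: "(\<integral>\<^sup>+w\<in>A. ennreal (Z w) \<partial>M) = (\<integral>\<^sup>+w\<in>A. ennreal (B t w) \<partial>M) + tail A g t" .
    \<comment> \<open>Facts \<open>1\<close> and \<open>2\<close> share the summand with
      \<open>B\<close>, which has to be finite before it can be cancelled.\<close>
    have "(\<integral>\<^sup>+w\<in>A. ennreal (B t w) \<partial>M) \<le> (\<integral>\<^sup>+w\<in>A. ennreal (Z w) \<partial>M)"
      using 1 by simp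
    also have "\<dots> \<le> (\<integral>\<^sup>+w. ennreal (Z w) \<partial>M)"
      by (intro nn_integral_mono) (auto simp: indicator_def)
    finally have "(\<integral>\<^sup>+w\<in>A. ennreal (B t w) \<partial>M) \<noteq> \<infinity>"
      using Z_fin by auto
    then show ?thesis using 1 2 by (simp add: ennreal_add_left_cancel)
  qed
  then show ?thesis using W_cadlag W_Pplus by blast
qed

end

section \<open>Left continuity at almost every time, random weights, elementary integrals\<close>

text \<open>By right continuity the forward increments over \<open>h n\<close> tend to 0 in mean,
  and by translation invariance so do the backward increments. Fatou makes the lower limit of the
  latter vanish for almost every \<open>r\<close>, and since the left limit exists it must be
  \<open>f r\<close>.\<close>

lemma AE_left_continuous:
  fixes f :: "real \<Rightarrow> real"
  assumes meas: "(\<lambda>s. indicator {0..} s * f s) \<in> borel_measurable borel"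
    and right: "\<And>t. 0 \<le> t \<Longrightarrow> (f \<longlongrightarrow> f t) (at_right t)"
    and left: "\<And>t. 0 < t \<Longrightarrow> \<exists>l. (f \<longlongrightarrow> l) (at_left t)"
  shows "AE r in lborel. 0 < r \<longrightarrow> (f \<longlongrightarrow> f r) (at_left r)"
proof -
  \<comment> \<open>\<open>arctan\<close> supplies the dominating constant and, being continuous and
    injective, still determines the limit of \<open>f\<close>.\<close>
  define \<phi> where "\<phi> s = arctan (indicator {0..} s * f s)" for s
  have \<phi>[measurable]: "\<phi> \<in> borel_measurable borel"
    unfolding \<phi>_def using meas by measurable
  have \<phi>_eq: "\<phi> s = arctan (f s)" if "0 \<le> s" for s
    using that by (simp add: \<phi>_def)
  define h where "h n = 1 / real (Suc n)" for n
  have h: "0 < h n" for n by (simp add: h_def)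
  have h_lim: "h \<longlonglongrightarrow> 0"
    unfolding h_def by (rule LIMSEQ_Suc[OF lim_1_over_n])
  have "AE r in lborel. 0 < r \<and> r < real N \<longrightarrow> (f \<longlongrightarrow> f r) (at_left r)" for N :: nat
  proof -
    define u where "u n s = ennreal \<bar>\<phi> (s + h n) - \<phi> s\<bar> * indicator {0..real N} s" for n s
    define v where "v n r = ennreal \<bar>\<phi> r - \<phi> (r - h n)\<bar> * indicator {0..real N} (r - h n)" for n r
    have [measurable]: "u n \<in> borel_measurable borel" "v n \<in> borel_measurable borel" for n
      unfolding u_def v_def by measurable
    \<comment> \<open>Substitution \<open>r = s + h n\<close>.\<close>
    have "(\<integral>\<^sup>+r. v n r \<partial>lborel) = (\<integral>\<^sup>+s. u n s \<partial>lborel)" for n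
      by (subst nn_integral_real_affine[where c = 1 and t = "h n"]) (simp_all add: u_def[abs_def] v_def[abs_def] add.commute)
    moreover have "(\<lambda>n. \<integral>\<^sup>+s. u n s \<partial>lborel) \<longlonglongrightarrow> (\<integral>\<^sup>+(s::real). 0 \<partial>lborel)"
    proof (rule nn_integral_dominated_convergence[where w = "\<lambda>s. ennreal (2 * pi) * indicator {0..real N} s"])
      show "AE s in lborel. u n s \<le> ennreal (2 * pi) * indicator {0..real N} s" for n
      proof (rule AE_I2)
        fix s
        have "\<bar>\<phi> (s + h n) - \<phi> s\<bar> \<le> 2 * pi"
          unfolding \<phi>_def using arctan_bounded by (smt (verit) field_sum_of_halves)
        then show "u n s \<le> ennreal (2 * pi) * indicator {0..real N} s"
          by (auto simp: u_def indicator_def intro: ennreal_leI)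
      qed
      have "(\<integral>\<^sup>+s. ennreal (2 * pi) * indicator {0..real N} s \<partial>lborel) = ennreal (2 * pi) * ennreal (real N)"
        by (subst nn_integral_cmult_indicator) auto
      then show "(\<integral>\<^sup>+s. ennreal (2 * pi) * indicator {0..real N} s \<partial>lborel) < \<infinity>"
        by (simp add: ennreal_mult_less_top)
      show "AE s in lborel. (\<lambda>n. u n s) \<longlonglongrightarrow> 0"
      proof (rule AE_I2)
        fix s
        show "(\<lambda>n. u n s) \<longlonglongrightarrow> 0"
        proof (cases "0 \<le> s")
          case True
          have "filterlim (\<lambda>n. s + h n) (at_right s) sequentially"
            unfolding filterlim_at using tendsto_add[OF tendsto_const[of s] h_lim] h
            by (auto simp: order_less_imp_not_eq2)
          from filterlim_compose[OF right[OF True] this]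
          have "(\<lambda>n. arctan (f (s + h n))) \<longlonglongrightarrow> arctan (f s)"
            by (rule tendsto_arctan)
          then have "(\<lambda>n. \<phi> (s + h n)) \<longlonglongrightarrow> \<phi> s"
            using True h by (simp add: \<phi>_eq less_imp_le)
          then have "(\<lambda>n. \<bar>\<phi> (s + h n) - \<phi> s\<bar>) \<longlonglongrightarrow> 0"
            by (intro tendsto_rabs_zero) (simp add: LIM_zero)
          then have "(\<lambda>n. ennreal \<bar>\<phi> (s + h n) - \<phi> s\<bar>) \<longlonglongrightarrow> ennreal 0"
            by (rule tendsto_ennrealI)
          then show ?thesis
            by (auto simp: u_def indicator_def)
        qed (simp add: u_def)
      qed
    qed auto
    ultimately have "(\<lambda>n. \<integral>\<^sup>+r. v n r \<partial>lborel) \<longlonglongrightarrow> 0" by simp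
    then have "liminf (\<lambda>n. \<integral>\<^sup>+r. v n r \<partial>lborel) = 0"
      by (intro lim_imp_Liminf) auto
    moreover have "(\<integral>\<^sup>+r. liminf (\<lambda>n. v n r) \<partial>lborel) \<le> liminf (\<lambda>n. \<integral>\<^sup>+r. v n r \<partial>lborel)"
      by (rule nn_integral_liminf) measurable
    ultimately have "(\<integral>\<^sup>+r. liminf (\<lambda>n. v n r) \<partial>lborel) = 0" by simp
    then have "AE r in lborel. liminf (\<lambda>n. v n r) = 0"
      by (subst (asm) nn_integral_0_iff_AE) auto
    then show ?thesis
    proof eventually_elim
      case (elim r)
      show ?case
      proof
        assume r: "0 < r \<and> r < real N"
        then obtain l where l: "(f \<longlongrightarrow> l) (at_left r)" using left by blast
        have "filterlim (\<lambda>n. r - h n) (at_left r) sequentially"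
          unfolding filterlim_at using tendsto_diff[OF tendsto_const[of r] h_lim] h
          by (auto simp: order_less_imp_not_eq2)
        from filterlim_compose[OF l this]
        have "(\<lambda>n. arctan (f (r - h n))) \<longlonglongrightarrow> arctan l"
          by (rule tendsto_arctan)
        moreover have ev: "\<forall>\<^sub>F n in sequentially. h n < r"
          using order_tendstoD(2)[OF h_lim] r by simp
        moreover have "\<forall>\<^sub>F n in sequentially. arctan (f (r - h n)) = \<phi> (r - h n)"
          using ev by eventually_elim (simp add: \<phi>_eq)
        ultimately have "(\<lambda>n. \<phi> (r - h n)) \<longlonglongrightarrow> arctan l"
          by (blast intro: Lim_transform_eventually)
        then have "(\<lambda>n. ennreal \<bar>\<phi> r - \<phi> (r - h n)\<bar>) \<longlonglongrightarrow> ennreal \<bar>\<phi> r - arctan l\<bar>"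
          by (intro tendsto_ennrealI tendsto_rabs tendsto_diff tendsto_const)
        moreover have "\<forall>\<^sub>F n in sequentially. ennreal \<bar>\<phi> r - \<phi> (r - h n)\<bar> = v n r"
          using ev
        proof eventually_elim
          case (elim n)
          then show ?case using r h[of n] by (simp add: v_def)
        qed
        ultimately have "(\<lambda>n. v n r) \<longlonglongrightarrow> ennreal \<bar>\<phi> r - arctan l\<bar>"
          by (rule Lim_transform_eventually)
        then have "ennreal \<bar>\<phi> r - arctan l\<bar> = 0"
          using elim lim_imp_Liminf by force
        then have "arctan (f r) = arctan l"
          using r by (simp add: ennreal_eq_0_iff \<phi>_eq)
        then show "(f \<longlongrightarrow> f r) (at_left r)" using l by (simp add: arctan_eq_iff)
      qed
    qed
  qed
  then have "AE r in lborel. \<forall>N::nat. 0 < r \<and> r < real N \<longrightarrow> (f \<longlongrightarrow> f r) (at_left r)"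
    by (simp only: AE_all_countable) blast
  then show ?thesis
    by eventually_elim (use reals_Archimedean2 in blast)
qed

text \<open>Equality on the events of \<open>G\<close> says that the densities \<open>f\<close> and
  \<open>g\<close> define the same measure on \<open>G\<close>; integrating the weight
  \<open>H\<close> against it gives the claim.\<close>

lemma nn_integral_weighted_subalgebra:
  assumes sub: "subalgebra M G" and [measurable]: "f \<in> borel_measurable M" "g \<in> borel_measurable M"
    and H: "H \<in> borel_measurable G"
    and eq: "\<And>A. A \<in> sets G \<Longrightarrow> (\<integral>\<^sup>+w\<in>A. f w \<partial>M) = (\<integral>\<^sup>+w\<in>A. g w \<partial>M)"
  shows "(\<integral>\<^sup>+w. f w * H w \<partial>M) = (\<integral>\<^sup>+w. g w * H w \<partial>M)"
proof -
  have sub': "subalgebra (density M k) G" for k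
    using sub by (simp add: subalgebra_def)
  have H_M[measurable]: "H \<in> borel_measurable M"
    by (rule measurable_from_subalg[OF sub H])
  have A_M: "A \<in> sets M" if "A \<in> sets G" for A
    using sub that by (auto simp: subalgebra_def)
  have "restr_to_subalg (density M f) G = restr_to_subalg (density M g) G"
  proof (rule measure_eqI)
    fix A assume "A \<in> sets (restr_to_subalg (density M f) G)"
    then have "A \<in> sets G" by (simp add: sets_restr_to_subalg[OF sub'])
    then show "emeasure (restr_to_subalg (density M f) G) A = emeasure (restr_to_subalg (density M g) G) A"
      using eq A_M by (simp add: emeasure_restr_to_subalg[OF sub'] emeasure_density)
  qed (simp add: sets_restr_to_subalg[OF sub'])
  moreover have "(\<integral>\<^sup>+w. k w * H w \<partial>M) = (\<integral>\<^sup>+w. H w \<partial>restr_to_subalg (density M k) G)"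
    if "k \<in> borel_measurable M" for k
    using that by (simp add: nn_integral_subalgebra2[OF sub' H] nn_integral_density)
  ultimately show ?thesis by simp
qed

lemma nn_integral_exp_tail:
  assumes "0 < \<gamma>"
  shows "(\<integral>\<^sup>+s\<in>{t..}. ennreal (exp (- \<gamma> * (s - t))) \<partial>lborel) = ennreal (1 / \<gamma>)"
proof -
  have "((\<lambda>x. exp (\<gamma> * t) * exp (- \<gamma> * x)) has_integral exp (\<gamma> * t) * (exp (- \<gamma> * t) / \<gamma>)) {t..}"
    by (intro has_integral_mult_right has_integral_exp_minus_to_infinity assms)
  moreover have "exp (\<gamma> * t) * (exp (- \<gamma> * t) / \<gamma>) = 1 / \<gamma>"
    by (simp add: exp_minus field_simps)
  moreover have "exp (\<gamma> * t) * exp (- \<gamma> * x) = exp (- \<gamma> * (x - t))" for x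
    by (simp add: algebra_simps flip: exp_add)
  ultimately have "((\<lambda>x. exp (- \<gamma> * (x - t))) has_integral 1 / \<gamma>) {t..}"
    by simp
  then have *: "((\<lambda>x. if x \<in> {t..} then exp (- \<gamma> * (x - t)) else 0) has_integral 1 / \<gamma>) UNIV"
    by (simp only: has_integral_restrict_UNIV)
  have "(\<integral>\<^sup>+s\<in>{t..}. ennreal (exp (- \<gamma> * (s - t))) \<partial>lborel)
      = (\<integral>\<^sup>+x. ennreal (if x \<in> {t..} then exp (- \<gamma> * (x - t)) else 0) \<partial>lborel)"
    by (intro nn_integral_cong) (auto simp: indicator_def)
  also have "\<dots> = ennreal (1 / \<gamma>)"
    by (rule nn_integral_has_integral_lborel[OF _ _ *]) auto
  finally show ?thesis .
qed

lemma weighted_amgm: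
  fixes p q :: real
  assumes "0 < \<rho>" "\<rho> < 1" "0 \<le> p" "0 \<le> q"
  shows "p powr (1 - \<rho>) * q powr \<rho> \<le> (1 - \<rho>) * p + \<rho> * q"
proof (cases "p = 0 \<or> q = 0")
  case True
  then show ?thesis using assms by auto
next
  case False
  then show ?thesis using Youngs_inequality_0[of "1 - \<rho>" \<rho> p q] assms by auto
qed

context usual_filtered
begin

section \<open>Monotonicity and scaling of masses and tails\<close>

abbreviation scaled :: "real \<Rightarrow> (real \<Rightarrow> 'a \<Rightarrow> real) \<Rightarrow> real \<Rightarrow> 'a \<Rightarrow> real" where
  "scaled c U \<equiv> \<lambda>s w. c * U s w"

lemma mass_mono_AE: "AE w in M. U s w \<le> V s w \<Longrightarrow> mass A U s \<le> mass A V s"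
  unfolding mass_def by (rule nn_integral_le_of_AE_le)

lemma mass_cong_AE: "AE w in M. U s w = V s w \<Longrightarrow> mass A U s = mass A V s"
  unfolding mass_def by (rule nn_integral_cong_AE) (auto elim!: eventually_mono)

lemma mass_mono_set: "A \<subseteq> B \<Longrightarrow> mass A U s \<le> mass B U s"
  unfolding mass_def by (rule nn_integral_mono) (auto simp: indicator_def)

lemma mass_cmult:
  assumes "U s \<in> borel_measurable M" "A \<in> sets M" "0 \<le> c"
  shows "mass A (scaled c U) s = ennreal c * mass A U s"
  using assms unfolding mass_def by (simp add: ennreal_mult' nn_integral_cmult mult.assoc)

lemma mass_SUP:
  assumes A: "A \<in> sets M" and f: "\<And>n. f n s \<in> borel_measurable M"
    and lim: "AE w in M. incseq (\<lambda>n. f n s w) \<and> (\<lambda>n. f n s w) \<longlonglongrightarrow> U s w"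
  shows "(SUP n. mass A (f n) s) = mass A U s"
proof -
  have "mass A U s = (\<integral>\<^sup>+w. (SUP n. ennreal (f n s w) * indicator A w) \<partial>M)"
    unfolding mass_def
  proof (rule nn_integral_cong_AE)
    show "AE w in M. ennreal (U s w) * indicator A w = (SUP n. ennreal (f n s w) * indicator A w)"
      using lim
    proof eventually_elim
      case (elim w)
      have "(SUP n. ennreal (f n s w)) = ennreal (U s w)"
      proof (rule LIMSEQ_unique[OF LIMSEQ_SUP])
        show "incseq (\<lambda>n. ennreal (f n s w))" using elim by (auto simp: incseq_def intro: ennreal_leI)
      qed (use elim in \<open>auto intro: tendsto_ennrealI\<close>)
      then show ?case by (cases "w \<in> A") auto
    qed
  qed
  also have "\<dots> = (SUP n. \<integral>\<^sup>+w. ennreal (f n s w) * indicator A w \<partial>M)"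
  proof (rule nn_integral_monotone_convergence_SUP_AE)
    show "AE w in M. ennreal (f n s w) * indicator A w \<le> ennreal (f (Suc n) s w) * indicator A w" for n
      using lim by eventually_elim (auto simp: indicator_def incseq_Suc_iff intro: ennreal_leI)
  qed (use A f in measurable)
  finally show ?thesis by (simp add: mass_def)
qed

lemma tail_mono: "(\<And>s. t \<le> s \<Longrightarrow> mass A U s \<le> mass B V s) \<Longrightarrow> tail A U t \<le> tail B V t"
  unfolding tail_def by (rule nn_integral_mono) (auto simp: indicator_def)

lemma tail_cong: "(\<And>s. t \<le> s \<Longrightarrow> mass A U s = mass B V s) \<Longrightarrow> tail A U t = tail B V t"
  unfolding tail_def by (rule nn_integral_cong) (auto simp: indicator_def)

lemma tail_antimono: "t \<le> s \<Longrightarrow> tail A U s \<le> tail A U t"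
  unfolding tail_def by (rule nn_integral_mono) (auto simp: indicator_def)

lemma tail_cmult:
  assumes "progressive M F U" "A \<in> sets M" "0 \<le> c" "0 \<le> t"
  shows "tail A (scaled c U) t = ennreal c * tail A U t"
proof -
  have "tail A (scaled c U) t = (\<integral>\<^sup>+s. ennreal c * (mass A U s * indicator {t..} s) \<partial>lborel)"
    unfolding tail_def
    by (rule nn_integral_cong)
       (use assms in \<open>auto simp: indicator_def mass_cmult progressive_adapted_M\<close>)
  then show ?thesis
    unfolding tail_def using mass_measurable[OF assms(1,2,4)] by (simp add: nn_integral_cmult)
qed

lemma tail_finite:
  assumes "tail (space M) U 0 < \<infinity>" "A \<in> sets M" "0 \<le> t"
  shows "tail A U t < \<infinity>"
proof -
  have "tail A U t \<le> tail (space M) U t"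
    using sets.sets_into_space[OF assms(2)] by (intro tail_mono mass_mono_set) auto
  also have "\<dots> \<le> tail (space M) U 0" by (rule tail_antimono[OF assms(3)])
  finally show ?thesis using assms(1) by (rule le_less_trans)
qed

end

section \<open>The reduced equation\<close>

text \<open>\<open>X\<close> stands for \<open>C^(1-R)\<close>. The bounds \<open>X_lower\<close>,
  \<open>X_upper\<close> and \<open>X\<nu>_lower\<close> are inequalities between a process and its
  conditional tail, integrated over the events of \<open>F t\<close>; the last one concerns the
  process weighted by \<open>exp (\<nu> * s)\<close>.\<close>

locale ez_equation = usual_filtered M F
  for M :: "'a measure" and F :: "real \<Rightarrow> 'a measure" +
  fixes X :: "real \<Rightarrow> 'a \<Rightarrow> real" and \<theta> \<rho> k K \<nu> k\<^sub>\<nu> :: real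
  assumes X: "Pplus M F X" and X_pos: "\<And>t w. 0 \<le> t \<Longrightarrow> w \<in> space M \<Longrightarrow> 0 < X t w"
    and \<rho>: "0 < \<rho>" "\<rho> < 1" and \<theta>: "\<theta> * (1 - \<rho>) = 1"
    and k: "0 < k" "k \<le> K"
    and X_finite: "tail (space M) X 0 < \<infinity>"
    and X_lower: "\<And>t A. 0 \<le> t \<Longrightarrow> A \<in> sets (F t) \<Longrightarrow> ennreal k * tail A X t \<le> mass A X t"
    and X_upper: "\<And>t A. 0 \<le> t \<Longrightarrow> A \<in> sets (F t) \<Longrightarrow> mass A X t \<le> ennreal K * tail A X t"
    and \<nu>: "0 < \<nu>" "0 < k\<^sub>\<nu>"
    and X\<nu>_lower: "\<And>t A. 0 \<le> t \<Longrightarrow> A \<in> sets (F t) \<Longrightarrow>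
      ennreal k\<^sub>\<nu> * tail A (\<lambda>s w. exp (\<nu> * s) * X s w) t \<le> mass A (\<lambda>s w. exp (\<nu> * s) * X s w) t"
begin

definition gen :: "(real \<Rightarrow> 'a \<Rightarrow> real) \<Rightarrow> real \<Rightarrow> 'a \<Rightarrow> real" where
  "gen W s w = \<theta> * (X s w powr (1 - \<rho>) * W s w powr \<rho>)"

definition sol :: "(real \<Rightarrow> 'a \<Rightarrow> real) \<Rightarrow> bool" where
  "sol W \<longleftrightarrow> cadlag M W \<and> Pplus M F W \<and> tail (space M) (gen W) 0 < \<infinity>
     \<and> (\<forall>t\<ge>0. \<forall>A\<in>sets (F t). mass A W t = tail A (gen W) t)"

text \<open>The exceptional null set may depend on the time, because \<open>tail\<close> only
  integrates masses at fixed times.\<close>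

definition dominated :: "(real \<Rightarrow> 'a \<Rightarrow> real) \<Rightarrow> (real \<Rightarrow> 'a \<Rightarrow> real) \<Rightarrow> bool" where
  "dominated U V \<longleftrightarrow> (\<forall>t\<ge>0. AE w in M. U t w \<le> V t w)"

lemma \<theta>_pos: "0 < \<theta>"
  using \<theta> \<rho> by (metis diff_gt_0_iff_gt zero_less_mult_pos2 zero_less_one)

lemma \<theta>_eq: "\<theta> = 1 / (1 - \<rho>)"
  using \<theta> \<rho> by (simp add: field_simps)

lemma solD:
  assumes "sol W"
  shows "cadlag M W" "Pplus M F W" "progressive M F W" "tail (space M) (gen W) 0 < \<infinity>"
    "0 \<le> t \<Longrightarrow> A \<in> sets (F t) \<Longrightarrow> mass A W t = tail A (gen W) t"
    "0 \<le> t \<Longrightarrow> w \<in> space M \<Longrightarrow> 0 \<le> W t w"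
  using assms by (auto simp: sol_def Pplus_def)

lemma sol_F: "sol W \<Longrightarrow> 0 \<le> t \<Longrightarrow> W t \<in> borel_measurable (F t)"
  by (rule progressive_adapted[OF solD(3)])

lemma sol_M: "sol W \<Longrightarrow> 0 \<le> t \<Longrightarrow> W t \<in> borel_measurable M"
  by (rule measurable_F_M[OF _ sol_F])

lemma X_M: "0 \<le> t \<Longrightarrow> X t \<in> borel_measurable M"
  by (rule progressive_adapted_M[OF PplusD(1)[OF X]])

lemma gen_Pplus:
  assumes "Pplus M F W"
  shows "Pplus M F (gen W)"
proof -
  have "progressive M F (\<lambda>s w. \<theta> * (X s w powr (1 - \<rho>) * W s w powr \<rho>))"
    by (rule progressive_comp2[OF PplusD(1)[OF X] PplusD(1)[OF assms], of "\<lambda>x w. \<theta> * (x powr (1 - \<rho>) * w powr \<rho>)"])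
       measurable
  then show ?thesis
    using \<theta>_pos by (simp add: Pplus_def gen_def[abs_def])
qed

lemma gen_progressive: "Pplus M F W \<Longrightarrow> progressive M F (gen W)"
  by (rule PplusD(1)[OF gen_Pplus])

lemma sol_gen: "sol W \<Longrightarrow> progressive M F (gen W)"
  by (rule gen_progressive[OF solD(2)])

lemma gen_mono: "0 \<le> V s w \<Longrightarrow> V s w \<le> W s w \<Longrightarrow> gen V s w \<le> gen W s w"
  unfolding gen_def using \<theta>_pos \<rho> by (intro mult_left_mono powr_mono2) auto

lemma gen_scale: "0 \<le> c \<Longrightarrow> 0 \<le> W s w \<Longrightarrow> gen (scaled c W) s w = c powr \<rho> * gen W s w"
  by (simp add: gen_def powr_mult)

lemma gen_X: "0 \<le> s \<Longrightarrow> w \<in> space M \<Longrightarrow> gen X s w = \<theta> * X s w"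
  using X_pos[of s w] by (simp add: gen_def flip: powr_add)

lemma cmult_Pplus: "Pplus M F W \<Longrightarrow> 0 \<le> c \<Longrightarrow> Pplus M F (scaled c W)"
  using progressive_comp2[of W W "\<lambda>x y. c * x"] by (auto simp: Pplus_def)

lemma tail_gen_mono:
  assumes "Pplus M F U" "dominated U V" "0 \<le> t"
  shows "tail A (gen U) t \<le> tail A (gen V) t"
proof (rule tail_mono, rule mass_mono_AE)
  fix s assume "t \<le> s"
  then have s: "0 \<le> s" using assms(3) by simp
  then have "AE w in M. U s w \<le> V s w" using assms(2) by (simp add: dominated_def)
  then show "AE w in M. gen U s w \<le> gen V s w"
    using AE_space by eventually_elim (use gen_mono[of U s _ V] PplusD(2)[OF assms(1) s] in blast)
qed

lemma tail_gen_scale: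
  assumes "Pplus M F U" "0 \<le> c" "0 \<le> t" "A \<in> sets M"
  shows "tail A (gen (scaled c U)) t = ennreal (c powr \<rho>) * tail A (gen U) t"
proof -
  have "tail A (gen (scaled c U)) t = tail A (\<lambda>s w. c powr \<rho> * gen U s w) t"
  proof (rule tail_cong, rule mass_cong_AE)
    fix s assume "t \<le> s"
    then show "AE w in M. gen (scaled c U) s w = c powr \<rho> * gen U s w"
      using assms PplusD(2)[OF assms(1), of s] by (intro AE_I2) (simp add: gen_scale)
  qed
  also have "\<dots> = ennreal (c powr \<rho>) * tail A (gen U) t"
    by (rule tail_cmult[OF gen_progressive]) (use assms in auto)
  finally show ?thesis .
qed

lemma sol_dominated_step:
  assumes Y: "sol Y" and W: "sol W" and c: "0 \<le> c" and dom: "dominated Y (scaled c W)"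
  shows "dominated Y (scaled (c powr \<rho>) W)"
  unfolding dominated_def
proof (intro allI impI)
  fix t :: real assume t: "0 \<le> t"
  have cW: "progressive M F (scaled (c powr \<rho>) W)"
    by (rule PplusD(1)[OF cmult_Pplus[OF solD(2)[OF W]]]) simp
  show "AE w in M. Y t w \<le> c powr \<rho> * W t w"
  proof (rule AE_le_F[OF t sol_F[OF Y t] progressive_adapted[OF cW t]])
    fix A assume A: "A \<in> sets (F t)"
    have "mass A Y t = tail A (gen Y) t" by (rule solD(5)[OF Y t A])
    also have "\<dots> \<le> tail A (gen (scaled c W)) t"
      by (rule tail_gen_mono[OF solD(2)[OF Y] dom t])
    also have "\<dots> = ennreal (c powr \<rho>) * tail A (gen W) t"
      by (rule tail_gen_scale[OF solD(2)[OF W] c t sets_F[OF t A]])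
    also have "\<dots> = ennreal (c powr \<rho>) * mass A W t"
      by (simp add: solD(5)[OF W t A])
    also have "\<dots> = mass A (scaled (c powr \<rho>) W) t"
      using mass_cmult[of W t A "c powr \<rho>"] sol_M[OF W t] sets_F[OF t A] by simp
    finally show "(\<integral>\<^sup>+w\<in>A. ennreal (Y t w) \<partial>M) \<le> (\<integral>\<^sup>+w\<in>A. ennreal (c powr \<rho> * W t w) \<partial>M)"
      by (simp add: mass_def)
  qed (use solD(6)[OF W t] in auto)
qed

lemma sol_dominated:
  assumes Y: "sol Y" and W: "sol W" and c: "0 < c" and dom: "dominated Y (scaled c W)"
  shows "dominated Y W"
proof -
  have iter: "dominated Y (scaled (c powr (\<rho> ^ n)) W)" for n
  proof (induction n)
    case (Suc n)
    from sol_dominated_step[OF Y W _ Suc] show ?case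
      by (simp add: powr_powr mult.commute)
  qed (use dom c in simp)
  show ?thesis
    unfolding dominated_def
  proof (intro allI impI)
    fix t :: real assume t: "0 \<le> t"
    have "AE w in M. \<forall>n. Y t w \<le> c powr (\<rho> ^ n) * W t w"
      using iter t by (simp add: AE_all_countable dominated_def)
    then show "AE w in M. Y t w \<le> W t w"
    proof eventually_elim
      case (elim w)
      have "(\<lambda>n. \<rho> ^ n) \<longlonglongrightarrow> 0"
        using \<rho> by (intro LIMSEQ_realpow_zero) auto
      then have "(\<lambda>n. c powr (\<rho> ^ n) * W t w) \<longlonglongrightarrow> c powr 0 * W t w"
        using c by (intro tendsto_mult tendsto_powr tendsto_const) auto
      then show ?case
        using elim c by (intro LIMSEQ_le_const) auto
    qed
  qed
qed

section \<open>A bound for all solutions\<close>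

lemma sol_upper:
  assumes Y: "sol Y"
  obtains c where "0 < c" "dominated Y (scaled c X)"
proof -
  \<comment> \<open>Chosen with \<open>\<gamma> * \<rho> = \<nu> * (1 - \<rho>)\<close>, so that
    growth and decay cancel in the weighted geometric mean of the two terms; see
    \<open>exps\<close>.\<close>
  define \<gamma> where "\<gamma> = \<nu> * (1 - \<rho>) / \<rho>"
  have \<gamma>: "0 < \<gamma>" using \<nu> \<rho> by (simp add: \<gamma>_def)
  \<comment> \<open>Solves \<open>a_eq\<close>, by \<open>\<theta> * (1 - \<rho>) = 1\<close>. The
    factor \<open>\<gamma> / 2\<close> is half the reciprocal of the integral
    \<open>1 / \<gamma>\<close> of the decaying kernel, so half of \<open>Y\<close> is left after
    absorption.\<close>
  define a where "a = (\<theta> * (\<gamma> / 2) powr (- \<rho>)) powr \<theta>"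
  have a: "0 < a" using \<theta>_pos \<gamma> by (simp add: a_def)
  have a_eq: "a powr (1 - \<rho>) * (\<gamma> / 2) powr \<rho> = \<theta>"
    using \<theta> \<theta>_pos \<gamma> by (simp add: a_def powr_powr powr_minus)
  have young: "gen Y s w \<le> a * exp (\<nu> * (s - t)) * X s w + \<gamma> / 2 * exp (- \<gamma> * (s - t)) * Y s w"
    if "0 \<le> s" "w \<in> space M" for s t w
  proof -
    let ?p = "a * exp (\<nu> * (s - t)) * X s w" and ?q = "\<gamma> / 2 * exp (- \<gamma> * (s - t)) * Y s w"
    have pos: "0 < X s w" "0 \<le> Y s w" using X_pos solD(6)[OF Y] that by auto
    have pq: "0 \<le> ?p" "0 \<le> ?q" using pos a \<gamma> by auto
    have exps: "exp (\<nu> * (s - t)) powr (1 - \<rho>) * exp (- \<gamma> * (s - t)) powr \<rho> = 1"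
    proof -
      have "\<nu> * (s - t) * (1 - \<rho>) + - \<gamma> * (s - t) * \<rho> = 0"
        using \<rho> by (simp add: \<gamma>_def field_simps)
      then show ?thesis
        by (simp add: powr_def flip: exp_add) (simp add: algebra_simps)
    qed
    have "gen Y s w = (a powr (1 - \<rho>) * (\<gamma> / 2) powr \<rho>) * (exp (\<nu> * (s - t)) powr (1 - \<rho>) * exp (- \<gamma> * (s - t)) powr \<rho>)
        * (X s w powr (1 - \<rho>) * Y s w powr \<rho>)"
      unfolding a_eq exps by (simp add: gen_def)
    also have "\<dots> = ?p powr (1 - \<rho>) * ?q powr \<rho>"
      using pos a \<gamma> by (simp only: powr_mult mult_ac) 
    also have "\<dots> \<le> (1 - \<rho>) * ?p + \<rho> * ?q"
      by (rule weighted_amgm[OF \<rho> pq])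
    also have "\<dots> \<le> 1 * ?p + 1 * ?q"
      using pq \<rho> by (intro add_mono mult_right_mono) auto
    finally show ?thesis by simp
  qed
  have "dominated Y (scaled (2 * a / k\<^sub>\<nu>) X)"
    unfolding dominated_def
  proof (intro allI impI)
    fix t :: real assume t: "0 \<le> t"
    have cX: "progressive M F (scaled (2 * a / k\<^sub>\<nu>) X)"
      using a \<nu> by (intro PplusD(1)[OF cmult_Pplus[OF X]]) simp
    show "AE w in M. Y t w \<le> (2 * a / k\<^sub>\<nu>) * X t w"
    proof (rule AE_le_F[OF t sol_F[OF Y t] progressive_adapted[OF cX t]])
      fix A assume A: "A \<in> sets (F t)"
      have A_M[measurable]: "A \<in> sets M" by (rule sets_F[OF t A])
      let ?E = "\<lambda>s w. exp (\<nu> * s) * X s w"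
      have E_prog: "progressive M F ?E"
        by (rule progressive_comp2[OF progressive_time[of "\<lambda>s. exp (\<nu> * s)"] PplusD(1)[OF X], of "(*)"]) measurable
      \<comment> \<open>The supermartingale property in integrated form: \<open>A\<close> remains an
        event at the later time \<open>s\<close>, and tails decrease.\<close>
      have Y_le: "mass A Y s \<le> mass A Y t" if "t \<le> s" for s
        using that t A F_mono[OF t that A] tail_antimono[OF that, of A "gen Y"] solD(5)[OF Y] by simp
      have split_sum: "ennreal (p * x + q * y) = ennreal p * ennreal x + ennreal q * ennreal y"
        if "0 \<le> p" "0 \<le> q" "0 \<le> x" "0 \<le> y" for p q x y
        using that by (simp add: ennreal_mult)
      have step: "mass A (gen Y) s \<le> ennreal (a * exp (- \<nu> * t)) * mass A ?E s
          + ennreal (\<gamma> / 2) * mass A Y t * ennreal (exp (- \<gamma> * (s - t)))" if "t \<le> s" for s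
      proof -
        have s: "0 \<le> s" using t that by simp
        have [measurable]: "X s \<in> borel_measurable M" "Y s \<in> borel_measurable M"
          by (rule X_M[OF s] sol_M[OF Y s])+
        have "mass A (gen Y) s \<le> (\<integral>\<^sup>+w. ennreal (a * exp (- \<nu> * t)) * (ennreal (?E s w) * indicator A w)
            + ennreal (\<gamma> / 2 * exp (- \<gamma> * (s - t))) * (ennreal (Y s w) * indicator A w) \<partial>M)"
          unfolding mass_def
        proof (rule nn_integral_mono)
          fix w assume w: "w \<in> space M"
          have "a * exp (\<nu> * (s - t)) * X s w = a * exp (- \<nu> * t) * ?E s w"
            by (simp add: algebra_simps flip: exp_add)
          with young[OF s w, of t]
          have "ennreal (gen Y s w) \<le> ennreal (a * exp (- \<nu> * t) * ?E s w + \<gamma> / 2 * exp (- \<gamma> * (s - t)) * Y s w)"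
            by (intro ennreal_leI) simp
          also have "\<dots> = ennreal (a * exp (- \<nu> * t)) * ennreal (?E s w) + ennreal (\<gamma> / 2 * exp (- \<gamma> * (s - t))) * ennreal (Y s w)"
            using a \<gamma> X_pos[OF s w] solD(6)[OF Y s w] by (intro split_sum) auto
          finally show "ennreal (gen Y s w) * indicator A w \<le> ennreal (a * exp (- \<nu> * t)) * (ennreal (?E s w) * indicator A w)
            + ennreal (\<gamma> / 2 * exp (- \<gamma> * (s - t))) * (ennreal (Y s w) * indicator A w)"
            by (auto simp: indicator_def)
        qed
        also have "\<dots> = ennreal (a * exp (- \<nu> * t)) * mass A ?E s + ennreal (\<gamma> / 2 * exp (- \<gamma> * (s - t))) * mass A Y s"
          unfolding mass_def by (simp add: nn_integral_add nn_integral_cmult)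
        also have "\<dots> \<le> ennreal (a * exp (- \<nu> * t)) * mass A ?E s + ennreal (\<gamma> / 2 * exp (- \<gamma> * (s - t))) * mass A Y t"
          by (intro add_left_mono mult_left_mono Y_le that) auto
        also have "\<dots> = ennreal (a * exp (- \<nu> * t)) * mass A ?E s
          + ennreal (\<gamma> / 2) * mass A Y t * ennreal (exp (- \<gamma> * (s - t)))"
        proof -
          have "ennreal (\<gamma> / 2 * exp (- \<gamma> * (s - t))) = ennreal (\<gamma> / 2) * ennreal (exp (- \<gamma> * (s - t)))"
            using \<gamma> by (intro ennreal_mult) auto
          then show ?thesis by (simp add: mult_ac)
        qed
        finally show ?thesis .
      qed
      have "mass A Y t = tail A (gen Y) t" by (rule solD(5)[OF Y t A])
      also have "\<dots> \<le> (\<integral>\<^sup>+s. ennreal (a * exp (- \<nu> * t)) * (mass A ?E s * indicator {t..} s)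
          + ennreal (\<gamma> / 2) * mass A Y t * (ennreal (exp (- \<gamma> * (s - t))) * indicator {t..} s) \<partial>lborel)"
        unfolding tail_def by (rule nn_integral_mono) (use step in \<open>auto simp: indicator_def\<close>)
      also have "\<dots> = ennreal (a * exp (- \<nu> * t)) * tail A ?E t + ennreal (\<gamma> / 2) * mass A Y t * ennreal (1 / \<gamma>)"
        unfolding tail_def nn_integral_exp_tail[OF \<gamma>, of t, symmetric]
        using mass_measurable[OF E_prog A_M t] by (simp add: nn_integral_add nn_integral_cmult)
      also have "ennreal (\<gamma> / 2) * mass A Y t * ennreal (1 / \<gamma>) = ennreal (1 / 2) * mass A Y t"
      proof -
        have "ennreal (\<gamma> / 2) * ennreal (1 / \<gamma>) = ennreal (1 / 2)"
          using \<gamma> by (simp flip: ennreal_mult)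
        then show ?thesis by (metis mult.assoc mult.commute)
      qed
      \<comment> \<open>Here the exponential integrability of \<open>X\<close> enters: the weighted
        tail is bounded by the weighted mass at time \<open>t\<close>, where the factors
        \<open>exp (- \<nu> * t)\<close> and \<open>exp (\<nu> * t)\<close> cancel.\<close>
      also have "ennreal (a * exp (- \<nu> * t)) * tail A ?E t \<le> ennreal (a / k\<^sub>\<nu>) * mass A X t"
      proof -
        have "ennreal (a * exp (- \<nu> * t)) * tail A ?E t = ennreal (a * exp (- \<nu> * t) / k\<^sub>\<nu>) * (ennreal k\<^sub>\<nu> * tail A ?E t)"
          using \<nu> a by (simp flip: mult.assoc ennreal_mult)
        also have "\<dots> \<le> ennreal (a * exp (- \<nu> * t) / k\<^sub>\<nu>) * mass A ?E t"
          by (intro mult_left_mono X\<nu>_lower t A) auto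
        also have "mass A ?E t = ennreal (exp (\<nu> * t)) * mass A X t"
          unfolding mass_def using X_M[OF t]
          by (simp add: ennreal_mult' nn_integral_cmult mult.assoc)
        also have "ennreal (a * exp (- \<nu> * t) / k\<^sub>\<nu>) * (ennreal (exp (\<nu> * t)) * mass A X t) = ennreal (a / k\<^sub>\<nu>) * mass A X t"
        proof -
          have "a * exp (- \<nu> * t) / k\<^sub>\<nu> * exp (\<nu> * t) = a / k\<^sub>\<nu>"
            by (simp add: exp_minus)
          then have "ennreal (a * exp (- \<nu> * t) / k\<^sub>\<nu>) * ennreal (exp (\<nu> * t)) = ennreal (a / k\<^sub>\<nu>)"
            using \<nu> a by (simp flip: ennreal_mult)
          then show ?thesis by (metis mult.assoc)
        qed
        finally show ?thesis .
      qed
      finally have le: "mass A Y t \<le> ennreal (a / k\<^sub>\<nu>) * mass A X t + ennreal (1 / 2) * mass A Y t"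
        by (simp add: add_right_mono)
      \<comment> \<open>Without finiteness the term with factor \<open>1 / 2\<close> could not be
        moved to the left side.\<close>
      have fin: "mass A Y t < \<infinity>"
        using tail_finite[OF solD(4)[OF Y] A_M t] solD(5)[OF Y t A] by simp
      have "mass A Y t \<le> ennreal (2 * a / k\<^sub>\<nu>) * mass A X t"
      proof (cases "mass A X t")
        case (real x)
        obtain y where y: "mass A Y t = ennreal y" "0 \<le> y" using fin by (cases "mass A Y t") auto
        have "ennreal y \<le> ennreal (a / k\<^sub>\<nu> * x + 1 / 2 * y)"
          using le[unfolded y(1) real(2)] split_sum[of "a / k\<^sub>\<nu>" "1 / 2" x y] y real a \<nu> by simp
        then have "y \<le> a / k\<^sub>\<nu> * x + y / 2"
          using y real a \<nu> by (subst (asm) ennreal_le_iff) auto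
        then show ?thesis using y real a \<nu> by (simp add: ennreal_mult[symmetric] ennreal_leI)
      qed (use a \<nu> in \<open>simp add: ennreal_mult_top\<close>)
      then show "(\<integral>\<^sup>+w\<in>A. ennreal (Y t w) \<partial>M) \<le> (\<integral>\<^sup>+w\<in>A. ennreal ((2 * a / k\<^sub>\<nu>) * X t w) \<partial>M)"
        using mass_cmult[of X t A "2 * a / k\<^sub>\<nu>"] X_M[OF t] a \<nu>
        by (simp add: mass_def)
    qed (use X_pos[OF t] a \<nu> in \<open>auto simp: less_imp_le\<close>)
  qed
  then show thesis using that[of "2 * a / k\<^sub>\<nu>"] a \<nu> by simp
qed

end

text \<open>The sequence may hit \<open>r\<close> itself, a point that the filter
  \<open>at_left r\<close> ignores; therefore the limit has to be the value
  \<open>f r\<close>.\<close>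

lemma tendsto_left_compose:
  fixes f :: "real \<Rightarrow> real"
  assumes f: "(f \<longlongrightarrow> f r) (at_left r)" and \<tau>: "\<tau> \<longlonglongrightarrow> r" "\<And>n. \<tau> n \<le> r"
  shows "(\<lambda>n. f (\<tau> n)) \<longlonglongrightarrow> f r"
proof (rule tendstoI)
  fix e :: real assume e: "0 < e"
  have "\<forall>\<^sub>F x in at_left r. dist (f x) (f r) < e" by (rule tendstoD[OF f e])
  then obtain b where b: "b < r" "\<And>x. b < x \<Longrightarrow> x < r \<Longrightarrow> dist (f x) (f r) < e"
    by (auto simp: eventually_at_left[of "r - 1" r])
  show "\<forall>\<^sub>F n in sequentially. dist (f (\<tau> n)) (f r) < e"
    using order_tendstoD(1)[OF \<tau>(1) b(1)]
  proof eventually_elim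
    case (elim n)
    show ?case
      using b(2)[OF elim] \<tau>(2)[of n] e by (cases "\<tau> n = r") auto
  qed
qed

context usual_filtered
begin

text \<open>Fubini exchanges the quantifiers: a statement almost sure at every fixed time holds, on
  almost every path, at almost every time.\<close>

lemma AE_AE_positive:
  assumes Y: "progressive M F Y" and pos: "\<And>t. 0 \<le> t \<Longrightarrow> AE w in M. 0 < Y t w"
  shows "AE w in M. AE r in lborel. 0 \<le> r \<longrightarrow> 0 < Y r w"
proof -
  interpret P: pair_sigma_finite lborel M by (rule pair_lborel_M)
  let ?f = "\<lambda>p. indicator {0..} (fst p) * Y (fst p) (snd p)"
  have [measurable]: "?f \<in> borel_measurable (lborel \<Otimes>\<^sub>M M)"
    using progressive_joint[OF Y] by (simp only: measurable_lborel_pair)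
  have "{x \<in> space (lborel \<Otimes>\<^sub>M M). 0 \<le> fst x \<longrightarrow> 0 < ?f x} \<in> sets (lborel \<Otimes>\<^sub>M M)"
    by measurable
  also have "{x \<in> space (lborel \<Otimes>\<^sub>M M). 0 \<le> fst x \<longrightarrow> 0 < ?f x}
      = {x \<in> space (lborel \<Otimes>\<^sub>M M). 0 \<le> fst x \<longrightarrow> 0 < Y (fst x) (snd x)}"
    by (auto simp: indicator_def)
  finally show ?thesis
    using P.AE_commute[of "\<lambda>r w. 0 \<le> r \<longrightarrow> 0 < Y r w"] pos by auto
qed

text \<open>The half-open interval makes the pieces disjoint, so that the cells of a grid can be
  added up.\<close>

lemma tail_split:
  assumes X: "progressive M F X" and A: "A \<in> sets M" and s: "0 \<le> s" "s \<le> t"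
  shows "(\<lambda>w. \<integral>\<^sup>+r\<in>{s..<t}. ennreal (X r w) \<partial>lborel) \<in> borel_measurable M"
    and "tail A X s = tail A X t + (\<integral>\<^sup>+w\<in>A. (\<integral>\<^sup>+r\<in>{s..<t}. ennreal (X r w) \<partial>lborel) \<partial>M)"
proof -
  have "progressive M F (\<lambda>r w. indicator {..<t} r * X r w)"
    by (rule progressive_comp2[OF progressive_time[of "indicator {..<t}"] X, of "(*)"]) measurable
  from tail_Fubini(1)[OF this A s(1)]
  have "(\<lambda>w. \<integral>\<^sup>+r\<in>{s..}. ennreal (indicator {..<t} r * X r w) \<partial>lborel) \<in> borel_measurable M" .
  then show R: "(\<lambda>w. \<integral>\<^sup>+r\<in>{s..<t}. ennreal (X r w) \<partial>lborel) \<in> borel_measurable M"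
    by (rule measurable_cong[THEN iffD1, rotated]) (auto intro!: nn_integral_cong simp: indicator_def)
  have t: "0 \<le> t" using s by simp
  note [measurable] = R tail_Fubini(1)[OF X A t] A
  have "tail A X s = (\<integral>\<^sup>+w\<in>A. (\<integral>\<^sup>+r\<in>{s..}. ennreal (X r w) \<partial>lborel) \<partial>M)"
    by (rule tail_Fubini(2)[OF X A s(1)])
  also have "\<dots> = (\<integral>\<^sup>+w. (\<integral>\<^sup>+r\<in>{t..}. ennreal (X r w) \<partial>lborel) * indicator A w
      + (\<integral>\<^sup>+r\<in>{s..<t}. ennreal (X r w) \<partial>lborel) * indicator A w \<partial>M)"
  proof (rule nn_integral_cong)
    fix w assume w: "w \<in> space M"
    have "(\<integral>\<^sup>+r\<in>{s..}. ennreal (X r w) \<partial>lborel)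
        = (\<integral>\<^sup>+r. ennreal (X r w) * indicator {t..} r + ennreal (X r w) * indicator {s..<t} r \<partial>lborel)"
      using s by (intro nn_integral_cong) (auto simp: indicator_def)
    also have "\<dots> = (\<integral>\<^sup>+r\<in>{t..}. ennreal (X r w) \<partial>lborel) + (\<integral>\<^sup>+r\<in>{s..<t}. ennreal (X r w) \<partial>lborel)"
      using progressive_path_measurable[OF X w, of "{t..}"] progressive_path_measurable[OF X w, of "{s..<t}"] s t
      by (intro nn_integral_add) (auto simp: subset_eq)
    finally show "(\<integral>\<^sup>+r\<in>{s..}. ennreal (X r w) \<partial>lborel) * indicator A w = (\<integral>\<^sup>+r\<in>{t..}. ennreal (X r w) \<partial>lborel) * indicator A w
      + (\<integral>\<^sup>+r\<in>{s..<t}. ennreal (X r w) \<partial>lborel) * indicator A w"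
      by (simp add: distrib_right)
  qed
  also have "\<dots> = tail A X t + (\<integral>\<^sup>+w\<in>A. (\<integral>\<^sup>+r\<in>{s..<t}. ennreal (X r w) \<partial>lborel) \<partial>M)"
    unfolding tail_Fubini(2)[OF X A t] by (intro nn_integral_add) measurable
  finally show "tail A X s = tail A X t + (\<integral>\<^sup>+w\<in>A. (\<integral>\<^sup>+r\<in>{s..<t}. ennreal (X r w) \<partial>lborel) \<partial>M)" .
qed

end

context ez_equation
begin

section \<open>Existence by monotone iteration between multiples of \<open>X\<close>\<close>

lemma dominatedI:
  assumes "Pplus M F U" "Pplus M F V"
    and "\<And>t A. 0 \<le> t \<Longrightarrow> A \<in> sets (F t) \<Longrightarrow> mass A U t \<le> mass A V t"
  shows "dominated U V"
  unfolding dominated_def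
proof (intro allI impI)
  fix t :: real assume t: "0 \<le> t"
  show "AE w in M. U t w \<le> V t w"
    by (rule AE_le_F[OF t])
       (use t assms progressive_adapted PplusD in \<open>auto simp flip: mass_def\<close>)
qed

lemma dominatedD: "dominated U V \<Longrightarrow> 0 \<le> t \<Longrightarrow> mass A U t \<le> mass A V t"
  by (rule mass_mono_AE) (simp add: dominated_def)

lemma tail_gen_X:
  assumes "0 \<le> c" "0 \<le> t" "A \<in> sets M"
  shows "tail A (gen (scaled c X)) t = ennreal (c powr \<rho> * \<theta>) * tail A X t"
proof -
  have "tail A (gen (scaled c X)) t = tail A (scaled (c powr \<rho> * \<theta>) X) t"
  proof (rule tail_cong, rule mass_cong_AE)
    fix s assume s: "t \<le> s"
    show "AE w in M. gen (scaled c X) s w = c powr \<rho> * \<theta> * X s w"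
    proof (rule AE_I2)
      fix w assume w: "w \<in> space M"
      have "0 \<le> s" using s assms(2) by simp
      then show "gen (scaled c X) s w = c powr \<rho> * \<theta> * X s w"
        using gen_scale[OF assms(1), of X s w] gen_X[of s w] X_pos[of s w] w by simp
    qed
  qed
  also have "\<dots> = ennreal (c powr \<rho> * \<theta>) * tail A X t"
    by (rule tail_cmult[OF PplusD(1)[OF X]]) (use assms \<theta>_pos in auto)
  finally show ?thesis .
qed

text \<open>\<open>(\<theta> / x) powr \<theta>\<close> is the positive root \<open>c\<close> of
  \<open>c powr \<rho> * \<theta> = c * x\<close>. Taking for \<open>x\<close> the order constants
  \<open>K\<close> and \<open>k\<close> of \<open>X\<close> makes \<open>lo * X\<close> a
  subsolution and \<open>hi * X\<close> a supersolution.\<close>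

definition lo :: real where "lo = (\<theta> / K) powr \<theta>"
definition hi :: real where "hi = (\<theta> / k) powr \<theta>"

lemma lo_hi: "0 < lo" "lo \<le> hi"
proof -
  have "0 < \<theta> / K" using \<theta>_pos k by simp
  moreover have "\<theta> / K \<le> \<theta> / k" using \<theta>_pos k by (intro divide_left_mono) auto
  ultimately show "0 < lo" "lo \<le> hi"
    using \<theta>_pos by (auto simp: lo_def hi_def intro: powr_mono2)
qed

lemma hi_pos: "0 < hi" using lo_hi by simp

lemma powr_bracket:
  assumes "0 < x"
  shows "((\<theta> / x) powr \<theta>) powr \<rho> * \<theta> = (\<theta> / x) powr \<theta> * x"
proof -
  have "\<theta> * \<rho> = \<theta> + - 1" using \<theta> by (simp add: algebra_simps)
  then have "((\<theta> / x) powr \<theta>) powr \<rho> = (\<theta> / x) powr \<theta> * (\<theta> / x) powr (- 1)"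
    by (simp only: powr_powr powr_add)
  also have "(\<theta> / x) powr (- 1) = x / \<theta>"
    using assms \<theta>_pos by (simp add: powr_minus_divide)
  finally show ?thesis using \<theta>_pos by simp
qed

lemma mass_cX: "0 \<le> c \<Longrightarrow> 0 \<le> t \<Longrightarrow> A \<in> sets (F t) \<Longrightarrow> mass A (scaled c X) t = ennreal c * mass A X t"
  by (rule mass_cmult) (auto intro: progressive_adapted_M PplusD(1)[OF X] sets_F)

lemma tail_gen_lo:
  assumes "0 \<le> t" "A \<in> sets (F t)"
  shows "mass A (scaled lo X) t \<le> tail A (gen (scaled lo X)) t"
proof -
  have "mass A (scaled lo X) t = ennreal lo * mass A X t"
    using mass_cX assms lo_hi by simp
  also have "\<dots> \<le> ennreal lo * (ennreal K * tail A X t)"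
    by (intro mult_left_mono X_upper assms) simp
  also have "\<dots> = ennreal (lo powr \<rho> * \<theta>) * tail A X t"
    using powr_bracket[of K] k lo_hi by (simp add: lo_def ennreal_mult mult.assoc)
  also have "\<dots> = tail A (gen (scaled lo X)) t"
    using tail_gen_X[of lo t A] lo_hi assms sets_F by simp
  finally show ?thesis .
qed

lemma tail_gen_hi:
  assumes "0 \<le> t" "A \<in> sets (F t)"
  shows "tail A (gen (scaled hi X)) t \<le> mass A (scaled hi X) t"
proof -
  have "tail A (gen (scaled hi X)) t = ennreal (hi powr \<rho> * \<theta>) * tail A X t"
    using tail_gen_X[of hi t A] hi_pos assms sets_F by simp
  also have "\<dots> = ennreal hi * (ennreal k * tail A X t)"
    using powr_bracket[of k] k hi_pos by (simp add: hi_def ennreal_mult mult.assoc)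
  also have "\<dots> \<le> ennreal hi * mass A X t"
    by (intro mult_left_mono X_lower assms) simp
  also have "\<dots> = mass A (scaled hi X) t"
    using mass_cX assms hi_pos by simp
  finally show ?thesis .
qed

lemma tail_gen_hi_finite: "tail (space M) (gen (scaled hi X)) 0 < \<infinity>"
  using tail_gen_X[of hi 0 "space M"] hi_pos X_finite by (simp add: ennreal_mult_less_top)

definition bracketed :: "(real \<Rightarrow> 'a \<Rightarrow> real) \<Rightarrow> bool" where
  "bracketed V \<longleftrightarrow> Pplus M F V \<and> dominated (scaled lo X) V \<and> dominated V (scaled hi X)"

text \<open>The right side of the equation is monotone, so it maps the order interval between the
  subsolution and the supersolution into itself.\<close>

lemma ex_next:
  assumes V: "bracketed V"
  shows "\<exists>W. bracketed W \<and> cadlag M W \<and> (\<forall>t\<ge>0. \<forall>A\<in>sets (F t). mass A W t = tail A (gen V) t)"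
proof -
  have V': "Pplus M F V" "dominated (scaled lo X) V" "dominated V (scaled hi X)"
    using V by (auto simp: bracketed_def)
  have "tail (space M) (gen V) 0 \<le> tail (space M) (gen (scaled hi X)) 0"
    by (rule tail_gen_mono[OF V'(1,3) order_refl])
  then have "tail (space M) (gen V) 0 < \<infinity>"
    using tail_gen_hi_finite by (rule le_less_trans)
  then obtain W where W: "cadlag M W" "Pplus M F W" "\<forall>t\<ge>0. \<forall>A\<in>sets (F t). mass A W t = tail A (gen V) t"
    using ex_cadlag_tail_version[OF gen_Pplus[OF V'(1)]] by blast
  have lo_P: "Pplus M F (scaled lo X)" and hi_P: "Pplus M F (scaled hi X)"
    using cmult_Pplus[OF X] lo_hi hi_pos by auto
  have "dominated (scaled lo X) W"
  proof (rule dominatedI[OF lo_P W(2)])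
    fix t A assume tA: "0 \<le> (t::real)" "A \<in> sets (F t)"
    show "mass A (scaled lo X) t \<le> mass A W t"
      using tail_gen_lo[OF tA] tail_gen_mono[OF lo_P V'(2) tA(1), of A] W(3) tA by (auto intro: order_trans)
  qed
  moreover have "dominated W (scaled hi X)"
  proof (rule dominatedI[OF W(2) hi_P])
    fix t A assume tA: "0 \<le> (t::real)" "A \<in> sets (F t)"
    show "mass A W t \<le> mass A (scaled hi X) t"
      using tail_gen_hi[OF tA] tail_gen_mono[OF V'(1,3) tA(1), of A] W(3) tA by (auto intro: order_trans)
  qed
  ultimately show ?thesis using W by (auto simp: bracketed_def)
qed

text \<open>A pointwise limit of the iterates satisfies the equation but need not have cadlag paths.
  One further application of the right side yields a cadlag process that agrees with it almost
  surely at each time, and this process is the solution.\<close>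

lemma ex_sol_of_fixpoint:
  assumes U: "bracketed U"
    and eq: "\<And>t A. 0 \<le> t \<Longrightarrow> A \<in> sets (F t) \<Longrightarrow> mass A U t = tail A (gen U) t"
  shows "\<exists>W. sol W \<and> bracketed W"
proof -
  obtain W where W: "bracketed W" "cadlag M W" "\<forall>t\<ge>0. \<forall>A\<in>sets (F t). mass A W t = tail A (gen U) t"
    using ex_next[OF U] by blast
  have UP: "Pplus M F U" and WP: "Pplus M F W" using U W by (auto simp: bracketed_def)
  have "dominated U W" "dominated W U"
    using W(3) eq by (auto intro!: dominatedI UP WP)
  then have "tail A (gen W) t = tail A (gen U) t" if "0 \<le> t" for A t
    using that by (intro antisym tail_gen_mono UP WP)
  moreover have "tail (space M) (gen U) 0 < \<infinity>"
    by (rule le_less_trans[OF tail_gen_mono[OF UP _ order_refl] tail_gen_hi_finite])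
       (use U in \<open>simp add: bracketed_def\<close>)
  ultimately have "sol W"
    using W WP by (simp add: sol_def)
  then show ?thesis using W(1) by blast
qed

lemma ex_sol: "\<exists>W. sol W \<and> bracketed W"
proof -
  have X_lo: "bracketed (scaled lo X)"
  proof -
    have "dominated (scaled lo X) (scaled hi X)"
      using lo_hi X_pos by (auto simp: dominated_def less_imp_le intro!: AE_I2 mult_right_mono)
    moreover have "dominated (scaled lo X) (scaled lo X)"
      by (simp add: dominated_def)
    ultimately show ?thesis
      using cmult_Pplus[OF X] lo_hi by (simp add: bracketed_def)
  qed
  \<comment> \<open>The next iterate is only known to exist, hence a dependent choice; the
    implication on \<open>n = 0\<close> fixes the starting point.\<close>
  have "\<exists>f. \<forall>n::nat. (bracketed (f n) \<and> (n = 0 \<longrightarrow> f n = (scaled lo X)))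
      \<and> (\<forall>t\<ge>0. \<forall>A\<in>sets (F t). mass A (f (Suc n)) t = tail A (gen (f n)) t)"
  proof (rule dependent_nat_choice)
    show "\<exists>x. bracketed x \<and> ((0::nat) = 0 \<longrightarrow> x = (scaled lo X))"
      using X_lo by blast
  qed (use ex_next in blast)
  then obtain f where f': "\<forall>n::nat. (bracketed (f n) \<and> (n = 0 \<longrightarrow> f n = (scaled lo X)))
      \<and> (\<forall>t\<ge>0. \<forall>A\<in>sets (F t). mass A (f (Suc n)) t = tail A (gen (f n)) t)" ..
  have f: "\<And>n. bracketed (f n)" "f 0 = (scaled lo X)"
    "\<And>n t A. 0 \<le> t \<Longrightarrow> A \<in> sets (F t) \<Longrightarrow> mass A (f (Suc n)) t = tail A (gen (f n)) t"
    using f' by simp_all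
  have fP: "Pplus M F (f n)" for n using f(1)[of n] by (simp add: bracketed_def)
  have mono: "dominated (f n) (f (Suc n))" for n
  proof (induction n)
    case 0
    then show ?case using f(1)[of 1] f(2) by (simp add: bracketed_def)
  next
    case (Suc n)
    show ?case
      by (rule dominatedI[OF fP fP]) (simp add: f(3) tail_gen_mono[OF fP Suc])
  qed
  \<comment> \<open>\<open>lim\<close> is arbitrary where the sequence diverges;
    \<open>max 0\<close> keeps \<open>U\<close> nonnegative there.\<close>
  define U where "U s w = max 0 (lim (\<lambda>n. f n s w))" for s w
  have U_P: "Pplus M F U"
  proof -
    have l: "progressive M F (\<lambda>s w. lim (\<lambda>n. f n s w))"
      by (rule progressive_lim[OF PplusD(1)[OF fP]])
    have "progressive M F (\<lambda>s w. max 0 (lim (\<lambda>n. f n s w)))"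
      by (rule progressive_comp2[OF l l, of "\<lambda>x y. max 0 x"]) measurable
    then show ?thesis by (simp add: Pplus_def U_def[abs_def])
  qed
  have AE_mono: "AE w in M. (\<forall>n. f n s w \<le> f (Suc n) s w) \<and> (\<forall>n. 0 \<le> f n s w)
      \<and> (\<forall>n. lo * X s w \<le> f n s w \<and> f n s w \<le> hi * X s w)" if s: "0 \<le> s" for s
  proof -
    have "AE w in M. \<forall>n. f n s w \<le> f (Suc n) s w"
      using mono s by (simp add: dominated_def AE_all_countable)
    moreover have "AE w in M. \<forall>n. lo * X s w \<le> f n s w"
      using f(1) s by (simp add: bracketed_def dominated_def AE_all_countable)
    moreover have "AE w in M. \<forall>n. f n s w \<le> hi * X s w"
      using f(1) s by (simp add: bracketed_def dominated_def AE_all_countable)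
    moreover have "AE w in M. \<forall>n. 0 \<le> f n s w"
      using PplusD(2)[OF fP s] by (intro AE_I2) simp
    ultimately show ?thesis by eventually_elim simp
  qed
  have AE_lim: "AE w in M. incseq (\<lambda>n. f n s w) \<and> (\<lambda>n. f n s w) \<longlonglongrightarrow> U s w \<and> (\<forall>n. 0 \<le> f n s w)
      \<and> lo * X s w \<le> U s w \<and> U s w \<le> hi * X s w" if s: "0 \<le> s" for s
    using AE_mono[OF s]
  proof eventually_elim
    case (elim w)
    have inc: "incseq (\<lambda>n. f n s w)" using elim by (intro incseq_SucI) simp
    obtain L where L: "(\<lambda>n. f n s w) \<longlonglongrightarrow> L"
      by (rule incseq_convergent[OF inc, of "hi * X s w"]) (use elim in auto)
    then have "0 \<le> L" using elim by (intro LIMSEQ_le_const) auto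
    then have "U s w = L" using limI[OF L] by (simp add: U_def)
    moreover have "lo * X s w \<le> L" using L elim by (intro LIMSEQ_le_const) auto
    moreover have "L \<le> hi * X s w" using L elim by (intro LIMSEQ_le_const2) auto
    ultimately show ?case using L inc elim by simp
  qed
  have U: "bracketed U"
    using AE_lim U_P by (auto simp: bracketed_def dominated_def elim!: eventually_mono)
  have mass_f: "(SUP n. mass A (f n) s) = mass A U s" if s: "0 \<le> s" and A: "A \<in> sets M" for s A
  proof (rule mass_SUP[where f = f and U = U and s = s, OF A])
    show "f n s \<in> borel_measurable M" for n
      by (rule progressive_adapted_M[OF PplusD(1)[OF fP] s])
    show "AE w in M. incseq (\<lambda>n. f n s w) \<and> (\<lambda>n. f n s w) \<longlonglongrightarrow> U s w"
      using AE_lim[OF s] by eventually_elim simp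
  qed
  have mass_gen: "(SUP n. mass A (gen (f n)) s) = mass A (gen U) s" if s: "0 \<le> s" and A: "A \<in> sets M" for s A
  proof (rule mass_SUP[where f = "\<lambda>n. gen (f n)" and U = "gen U" and s = s, OF A])
    show "gen (f n) s \<in> borel_measurable M" for n
      by (rule progressive_adapted_M[OF gen_progressive[OF fP] s])
    show "AE w in M. incseq (\<lambda>n. gen (f n) s w) \<and> (\<lambda>n. gen (f n) s w) \<longlonglongrightarrow> gen U s w"
      using AE_lim[OF s]
    proof eventually_elim
      case (elim w)
      have "incseq (\<lambda>n. gen (f n) s w)"
        using elim by (intro incseq_SucI gen_mono) (auto simp: incseq_Suc_iff)
      moreover have "(\<lambda>n. gen (f n) s w) \<longlonglongrightarrow> gen U s w"
        unfolding gen_def using elim \<rho> by (intro tendsto_mult tendsto_const tendsto_powr') auto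
      ultimately show ?case by simp
    qed
  qed
  have mass_gen_mono: "mass A (gen (f n)) s \<le> mass A (gen (f (Suc n))) s" if "0 \<le> s" for n A s
  proof (rule mass_mono_AE)
    show "AE w in M. gen (f n) s w \<le> gen (f (Suc n)) s w"
      using AE_mono[OF that] by eventually_elim (auto intro: gen_mono)
  qed
  have "mass A U t = tail A (gen U) t" if t: "0 \<le> t" and A: "A \<in> sets (F t)" for t A
  proof -
    have A_M: "A \<in> sets M" by (rule sets_F[OF t A])
    have "tail A (gen U) t = (\<integral>\<^sup>+s. (SUP n. mass A (gen (f n)) s * indicator {t..} s) \<partial>lborel)"
      unfolding tail_def
    proof (rule nn_integral_cong)
      fix s
      show "mass A (gen U) s * indicator {t..} s = (SUP n. mass A (gen (f n)) s * indicator {t..} s)"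
        using mass_gen[OF _ A_M, of s] t by (cases "t \<le> s") auto
    qed
    also have "\<dots> = (SUP n. tail A (gen (f n)) t)"
      unfolding tail_def
    proof (rule nn_integral_monotone_convergence_SUP)
      show "incseq (\<lambda>n s. mass A (gen (f n)) s * indicator {t..} s)"
        using mass_gen_mono t by (auto intro!: incseq_SucI le_funI simp: indicator_def)
      show "(\<lambda>s. mass A (gen (f n)) s * indicator {t..} s) \<in> borel_measurable lborel" for n
        by (rule mass_measurable[OF gen_progressive[OF fP] A_M t])
    qed
    also have "\<dots> = (SUP n. mass A (f (Suc n)) t)"
      using f(3)[OF t A] by simp
    \<comment> \<open>Dropping the first member of an increasing sequence does not change its
      supremum.\<close>
    also have "\<dots> = (SUP n. mass A (f n) t)"
    proof -
      have "incseq (\<lambda>n. mass A (f n) t)"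
        using dominatedD[OF mono t] by (intro incseq_SucI)
      then have "(\<lambda>n. mass A (f n) t) \<longlonglongrightarrow> (SUP n. mass A (f n) t)"
        "(\<lambda>n. mass A (f (Suc n)) t) \<longlonglongrightarrow> (SUP n. mass A (f (Suc n)) t)"
        by (auto intro!: LIMSEQ_SUP simp: incseq_Suc_iff)
      then show ?thesis using LIMSEQ_Suc LIMSEQ_unique by blast
    qed
    also have "\<dots> = mass A U t" by (rule mass_f[OF t A_M])
    finally show ?thesis by simp
  qed
  then show ?thesis by (rule ex_sol_of_fixpoint[OF U])
qed

lemma bracketed_pos:
  assumes "bracketed W" "0 \<le> t"
  shows "AE w in M. 0 < W t w"
proof -
  have "AE w in M. lo * X t w \<le> W t w"
    using assms by (simp add: bracketed_def dominated_def)
  then show ?thesis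
    using AE_space
  proof eventually_elim
    case (elim w)
    then show ?case using X_pos[OF assms(2) elim(2)] lo_hi(1) by (smt (verit) mult_pos_pos)
  qed
qed

section \<open>A lower bound for positive solutions\<close>

text \<open>The equation between \<open>s\<close> and \<open>t\<close> against a random weight known
  at time \<open>s\<close>, in place of an event. The slopes of the tangent plane are such
  weights.\<close>

lemma sol_weighted:
  assumes Z: "sol Z" and s: "0 \<le> s" "s \<le> t" and H: "H \<in> borel_measurable (F s)"
  shows "(\<integral>\<^sup>+w. ennreal (Z s w) * H w \<partial>M)
    = (\<integral>\<^sup>+w. ennreal (Z t w) * H w \<partial>M) + (\<integral>\<^sup>+w. (\<integral>\<^sup>+r\<in>{s..<t}. ennreal (gen Z r w) \<partial>lborel) * H w \<partial>M)"
proof -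
  let ?R = "\<lambda>w. \<integral>\<^sup>+r\<in>{s..<t}. ennreal (gen Z r w) \<partial>lborel"
  have t: "0 \<le> t" using s by simp
  have [measurable]: "Z s \<in> borel_measurable M" "Z t \<in> borel_measurable M" "?R \<in> borel_measurable M" "H \<in> borel_measurable M"
    using sol_M[OF Z] s t tail_split(1)[OF sol_gen[OF Z] sets.top s]
      measurable_F_M[OF s(1) H] by auto
  have "(\<integral>\<^sup>+w. ennreal (Z s w) * H w \<partial>M) = (\<integral>\<^sup>+w. (ennreal (Z t w) + ?R w) * H w \<partial>M)"
  proof (rule nn_integral_weighted_subalgebra[OF F_sub[OF s(1)] _ _ H])
    fix A assume A: "A \<in> sets (F s)"
    have A': "A \<in> sets (F t)" by (rule F_mono[OF s A])
    have [measurable]: "A \<in> sets M" by (rule sets_F[OF s(1) A])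
    have "(\<integral>\<^sup>+w\<in>A. ennreal (Z s w) \<partial>M) = tail A (gen Z) s"
      using solD(5)[OF Z s(1) A] by (simp add: mass_def)
    also have "\<dots> = mass A Z t + (\<integral>\<^sup>+w\<in>A. ?R w \<partial>M)"
      using tail_split(2)[OF sol_gen[OF Z] _ s, of A] solD(5)[OF Z t A'] by simp
    also have "\<dots> = (\<integral>\<^sup>+w\<in>A. (ennreal (Z t w) + ?R w) \<partial>M)"
      by (simp add: mass_def nn_integral_add distrib_right)
    finally show "(\<integral>\<^sup>+w\<in>A. ennreal (Z s w) \<partial>M) = (\<integral>\<^sup>+w\<in>A. (ennreal (Z t w) + ?R w) \<partial>M)" .
  qed auto
  also have "\<dots> = (\<integral>\<^sup>+w. ennreal (Z t w) * H w \<partial>M) + (\<integral>\<^sup>+w. ?R w * H w \<partial>M)"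
    by (simp add: nn_integral_add distrib_right)
  finally show ?thesis .
qed

context
  fixes Y W
  assumes Y: "sol Y" and W: "sol W"
    and Y_pos: "\<And>t. 0 \<le> t \<Longrightarrow> AE w in M. 0 < Y t w"
    and W_pos: "\<And>t. 0 \<le> t \<Longrightarrow> AE w in M. 0 < W t w"
begin

definition geo :: "real \<Rightarrow> 'a \<Rightarrow> real" where
  "geo s w = Y s w powr (1 - \<rho>) * W s w powr \<rho>"

text \<open>The partial derivative of \<open>y powr (1 - \<rho>) * w powr \<rho>\<close> in
  \<open>y\<close>, taken at the point (Y, W) at time \<open>s\<close>.\<close>

definition wt :: "real \<Rightarrow> 'a \<Rightarrow> real" where
  "wt s w = (1 - \<rho>) * (Y s w / W s w) powr (- \<rho>)"

lemma wt_F: "0 \<le> s \<Longrightarrow> wt s \<in> borel_measurable (F s)"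
proof -
  assume s: "0 \<le> s"
  note [measurable] = sol_F[OF Y s] sol_F[OF W s]
  show ?thesis unfolding wt_def[abs_def] by measurable
qed

lemma wt_nonneg: "0 \<le> wt s w"
  using \<rho> by (simp add: wt_def)

lemma geo_measurable: "0 \<le> s \<Longrightarrow> geo s \<in> borel_measurable (F s)"
proof -
  assume s: "0 \<le> s"
  note [measurable] = sol_F[OF Y s] sol_F[OF W s]
  show ?thesis unfolding geo_def[abs_def] by measurable
qed

text \<open>The function \<^term>\<open>\<lambda>(y, w). y powr (1 - \<rho>) * w powr \<rho>\<close> is concave; it is compared with its tangent plane at
  time \<^term>\<open>s\<close>, whose slopes depend on the ratio \<^term>\<open>Y s w / W s w\<close> only and hence are known at time \<^term>\<open>s\<close>.\<close>

lemma geo_step: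
  assumes s: "0 \<le> s" "s \<le> t" and A: "A \<in> sets (F s)"
  shows "mass A geo t + (\<integral>\<^sup>+w\<in>A. ennreal (wt s w) * (\<integral>\<^sup>+r\<in>{s..<t}. ennreal (gen Y r w) \<partial>lborel) \<partial>M) \<le> mass A geo s"
proof -
  let ?R = "\<lambda>w. \<integral>\<^sup>+r\<in>{s..<t}. ennreal (gen Y r w) \<partial>lborel"
  have t: "0 \<le> t" using s by simp
  \<comment> \<open>The partial derivative in the second variable, the companion of
    \<open>wt s\<close>.\<close>
  define p where "p w = \<rho> * (Y s w / W s w) powr (1 - \<rho>)" for w
  define H1 where "H1 w = ennreal (p w) * indicator A w" for w
  define H2 where "H2 w = ennreal (wt s w) * indicator A w" for w
  have p_nonneg: "0 \<le> p w" for w using \<rho> by (simp add: p_def)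
  have H1: "H1 \<in> borel_measurable (F s)"
  proof -
    note [measurable] = sol_F[OF Y s(1)] sol_F[OF W s(1)] A
    show ?thesis unfolding H1_def[abs_def] p_def by measurable
  qed
  have H2: "H2 \<in> borel_measurable (F s)"
  proof -
    note [measurable] = wt_F[OF s(1)] A
    show ?thesis unfolding H2_def[abs_def] by measurable
  qed
  have [measurable]: "A \<in> sets M" "Y s \<in> borel_measurable M" "Y t \<in> borel_measurable M" "W s \<in> borel_measurable M"
    "W t \<in> borel_measurable M" "?R \<in> borel_measurable M" "H1 \<in> borel_measurable M" "H2 \<in> borel_measurable M"
    using sol_M[OF Y] sol_M[OF W] s t sets_F[OF s(1) A]
      tail_split(1)[OF sol_gen[OF Y] sets.top s] measurable_F_M[OF s(1)] H1 H2 by auto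
  have pos: "AE w in M. 0 < Y s w \<and> 0 < W s w \<and> 0 \<le> Y t w \<and> 0 \<le> W t w"
    using Y_pos[OF s(1)] W_pos[OF s(1)] AE_space
    by eventually_elim (simp add: solD(6)[OF Y t] solD(6)[OF W t])
  have "mass A geo t \<le> (\<integral>\<^sup>+w. ennreal (Y t w) * H2 w + ennreal (W t w) * H1 w \<partial>M)"
    unfolding mass_def
  proof (rule nn_integral_mono_AE)
    show "AE w in M. ennreal (geo t w) * indicator A w \<le> ennreal (Y t w) * H2 w + ennreal (W t w) * H1 w"
      using pos
    proof eventually_elim
      case (elim w)
      let ?l = "Y s w / W s w"
      have l: "0 < ?l" using elim by simp
      \<comment> \<open>Two factors whose weighted geometric mean is 1 can be inserted for free.
        After this rescaling the tangent plane inequality is the weighted inequality of arithmetic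
        and geometric means.\<close>
      have "(?l powr (- \<rho>)) powr (1 - \<rho>) * (?l powr (1 - \<rho>)) powr \<rho> = 1"
        using elim by (simp add: powr_powr algebra_simps flip: powr_add)
      then have "geo t w = ((?l powr (- \<rho>)) powr (1 - \<rho>) * (?l powr (1 - \<rho>)) powr \<rho>) * (Y t w powr (1 - \<rho>) * W t w powr \<rho>)"
        by (simp add: geo_def)
      also have "\<dots> = (?l powr (- \<rho>) * Y t w) powr (1 - \<rho>) * (?l powr (1 - \<rho>) * W t w) powr \<rho>"
        using elim l by (simp add: powr_mult)
      also have "\<dots> \<le> (1 - \<rho>) * (?l powr (- \<rho>) * Y t w) + \<rho> * (?l powr (1 - \<rho>) * W t w)"
        using elim by (intro weighted_amgm \<rho>) auto
      also have "\<dots> = Y t w * wt s w + W t w * p w"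
        by (simp add: wt_def p_def)
      finally have "ennreal (geo t w) \<le> ennreal (Y t w * wt s w + W t w * p w)"
        by (rule ennreal_leI)
      also have "\<dots> = ennreal (Y t w) * ennreal (wt s w) + ennreal (W t w) * ennreal (p w)"
        using elim wt_nonneg p_nonneg by (simp add: ennreal_mult)
      finally show ?case by (auto simp: H1_def H2_def indicator_def)
    qed
  qed
  also have "\<dots> = (\<integral>\<^sup>+w. ennreal (Y t w) * H2 w \<partial>M) + (\<integral>\<^sup>+w. ennreal (W t w) * H1 w \<partial>M)"
    by (rule nn_integral_add) measurable
  finally have "mass A geo t + (\<integral>\<^sup>+w. ?R w * H2 w \<partial>M)
      \<le> ((\<integral>\<^sup>+w. ennreal (Y t w) * H2 w \<partial>M) + (\<integral>\<^sup>+w. ?R w * H2 w \<partial>M)) + (\<integral>\<^sup>+w. ennreal (W t w) * H1 w \<partial>M)"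
    by (simp add: add_right_mono ac_simps)
  \<comment> \<open>The drift of \<open>Y\<close> is kept and restores \<open>Y\<close> at time
    \<open>s\<close> exactly; the drift of \<open>W\<close> is nonnegative and is dropped.\<close>
  also have "\<dots> \<le> (\<integral>\<^sup>+w. ennreal (Y s w) * H2 w \<partial>M) + (\<integral>\<^sup>+w. ennreal (W s w) * H1 w \<partial>M)"
    unfolding sol_weighted[OF Y s H2] sol_weighted[OF W s H1] by (intro add_mono) auto
  also have "\<dots> = (\<integral>\<^sup>+w. ennreal (Y s w) * H2 w + ennreal (W s w) * H1 w \<partial>M)"
    by (rule nn_integral_add[symmetric]) measurable
  \<comment> \<open>Euler's identity for a function homogeneous of degree 1: the tangent plane takes
    the value of the function at the base point and has no constant term.\<close>
  also have "\<dots> = mass A geo s"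
    unfolding mass_def
  proof (rule nn_integral_cong_AE)
    show "AE w in M. ennreal (Y s w) * H2 w + ennreal (W s w) * H1 w = ennreal (geo s w) * indicator A w"
      using pos
    proof eventually_elim
      case (elim w)
      have "Y s w powr 1 * Y s w powr (- \<rho>) = Y s w powr (1 - \<rho>)"
        "W s w powr 1 * W s w powr (\<rho> - 1) = W s w powr \<rho>"
        by (simp_all only: powr_add[symmetric]) simp_all
      then have "Y s w * Y s w powr (- \<rho>) = Y s w powr (1 - \<rho>)"
        "W s w * W s w powr (\<rho> - 1) = W s w powr \<rho>"
        using elim by simp_all
      moreover have "(Y s w / W s w) powr (- \<rho>) = Y s w powr (- \<rho>) * W s w powr \<rho>"
        "(Y s w / W s w) powr (1 - \<rho>) = Y s w powr (1 - \<rho>) * W s w powr (\<rho> - 1)"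
        using elim powr_minus_divide[of "W s w" "1 - \<rho>"] powr_minus_divide[of "W s w" \<rho>] by (simp_all add: powr_divide powr_minus field_simps)
      ultimately have "Y s w * wt s w = (1 - \<rho>) * geo s w" "W s w * p w = \<rho> * geo s w"
        by (simp_all add: wt_def p_def geo_def mult_ac)
      then have "Y s w * wt s w + W s w * p w = geo s w"
        by (simp add: algebra_simps)
      then have "ennreal (Y s w) * ennreal (wt s w) + ennreal (W s w) * ennreal (p w) = ennreal (geo s w)"
        using elim wt_nonneg[of s w] p_nonneg[of w] by (simp flip: ennreal_mult ennreal_plus)
      then show ?case by (auto simp: H1_def H2_def indicator_def)
    qed
  qed
  finally show ?thesis by (simp add: H2_def mult_ac)
qed

section \<open>Passage to the limit along grids of vanishing mesh\<close>

definition grid :: "real \<Rightarrow> nat \<Rightarrow> nat \<Rightarrow> real" where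
  "grid t m i = t + real i / real (Suc m)"

text \<open>The drift at time \<open>r\<close> with the slope frozen at the left end of the cell
  containing \<open>r\<close>. The left end keeps the slope known at the start of the cell, as
  \<open>geo_step\<close> requires.\<close>

definition approx :: "real \<Rightarrow> nat \<Rightarrow> 'a \<Rightarrow> real \<Rightarrow> ennreal" where
  "approx t m w r = (\<Sum>i. ennreal (wt (grid t m i) w)
      * (ennreal (gen Y r w) * indicator {grid t m i..<grid t m (Suc i)} r))"

definition drift :: "real \<Rightarrow> nat \<Rightarrow> nat \<Rightarrow> 'a \<Rightarrow> ennreal" where
  "drift t m i w = ennreal (wt (grid t m i) w)
     * (\<integral>\<^sup>+r\<in>{grid t m i..<grid t m (Suc i)}. ennreal (gen Y r w) \<partial>lborel)"

lemma grid_nonneg: "0 \<le> t \<Longrightarrow> 0 \<le> grid t m i"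
  by (simp add: grid_def)

lemma grid_mono: "grid t m i \<le> grid t m (Suc i)"
  by (simp add: grid_def divide_right_mono)

lemma grid_ge: "t \<le> grid t m i"
  by (simp add: grid_def)

text \<open>An event of \<open>F t\<close> is an event at every grid point, so
  \<open>geo_step\<close> applies on each cell and the intermediate values cancel.\<close>

lemma grid_telescope:
  assumes t: "0 \<le> t" and A: "A \<in> sets (F t)"
  shows "mass A geo (grid t m n) + (\<Sum>i<n. \<integral>\<^sup>+w\<in>A. drift t m i w \<partial>M) \<le> mass A geo t"
proof (induction n)
  case 0
  then show ?case by (simp add: grid_def)
next
  case (Suc n)
  have "A \<in> sets (F (grid t m n))"
    by (rule F_mono[OF t grid_ge A])
  note step = geo_step[OF grid_nonneg[OF t] grid_mono this]
  let ?S = "\<lambda>i. \<integral>\<^sup>+w\<in>A. drift t m i w \<partial>M"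
  have "mass A geo (grid t m (Suc n)) + (\<Sum>i<Suc n. ?S i)
      = (mass A geo (grid t m (Suc n)) + ?S n) + (\<Sum>i<n. ?S i)"
    by (simp only: sum.lessThan_Suc ac_simps)
  also have "\<dots> \<le> mass A geo (grid t m n) + (\<Sum>i<n. ?S i)"
    by (rule add_right_mono[OF step[folded drift_def]])
  also have "\<dots> \<le> mass A geo t" by (rule Suc.IH)
  finally show ?case .
qed

lemma gen_path_measurable:
  assumes "0 \<le> t" "w \<in> space M"
  shows "(\<lambda>r. ennreal (gen Y r w) * indicator {grid t m i..<grid t m (Suc i)} r) \<in> borel_measurable borel"
  using grid_nonneg[OF assms(1), of m i]
  by (intro progressive_path_measurable gen_progressive solD(2)[OF Y] assms(2)) auto

lemma approx_measurable:
  "0 \<le> t \<Longrightarrow> w \<in> space M \<Longrightarrow> approx t m w \<in> borel_measurable borel"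
  unfolding approx_def[abs_def]
  by (intro borel_measurable_suminf_order borel_measurable_times_ennreal gen_path_measurable) auto

lemma approx_integral:
  assumes t: "0 \<le> t" and w: "w \<in> space M"
  shows "(\<integral>\<^sup>+r. approx t m w r \<partial>lborel) = (\<Sum>i. drift t m i w)"
  unfolding approx_def drift_def using gen_path_measurable[OF assms]
  by (subst nn_integral_suminf) (auto simp: nn_integral_cmult)

lemma drift_measurable: "0 \<le> t \<Longrightarrow> drift t m i \<in> borel_measurable M"
  unfolding drift_def[abs_def]
  using measurable_F_M[OF grid_nonneg wt_F[OF grid_nonneg]]
  by (intro borel_measurable_times_ennreal measurable_compose[OF _ measurable_ennreal]
        tail_split(1)[OF sol_gen[OF Y] sets.top grid_nonneg grid_mono]) auto

lemma approx_integral_measurable: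
  assumes t: "0 \<le> t"
  shows "(\<lambda>w. \<integral>\<^sup>+r. approx t m w r \<partial>lborel) \<in> borel_measurable M"
proof -
  have "(\<lambda>w. \<Sum>i. drift t m i w) \<in> borel_measurable M"
    by (intro borel_measurable_suminf_order drift_measurable t)
  then show ?thesis
    by (rule measurable_cong[THEN iffD1, rotated]) (simp add: approx_integral[OF t])
qed

lemma approx_bound:
  assumes t: "0 \<le> t" and A: "A \<in> sets (F t)"
  shows "(\<integral>\<^sup>+w\<in>A. (\<integral>\<^sup>+r. approx t m w r \<partial>lborel) \<partial>M) \<le> mass A geo t"
proof -
  have [measurable]: "A \<in> sets M" by (rule sets_F[OF t A])
  note [measurable] = drift_measurable[OF t]
  have "(\<integral>\<^sup>+w\<in>A. (\<integral>\<^sup>+r. approx t m w r \<partial>lborel) \<partial>M) = (\<integral>\<^sup>+w. (\<Sum>i. drift t m i w * indicator A w) \<partial>M)"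
    by (intro nn_integral_cong) (simp add: approx_integral[OF t])
  also have "\<dots> = (\<Sum>i. \<integral>\<^sup>+w\<in>A. drift t m i w \<partial>M)"
    by (rule nn_integral_suminf) measurable
  also have "\<dots> \<le> mass A geo t"
  proof (rule suminf_le_const[OF summableI])
    show "(\<Sum>i<n. \<integral>\<^sup>+w\<in>A. drift t m i w \<partial>M) \<le> mass A geo t" for n
      by (rule order_trans[OF _ grid_telescope[OF t A, of m n]]) simp
  qed
  finally show ?thesis .
qed

text \<open>The half-open cells partition the times from \<open>t\<close> on, so only the index
  \<open>i m\<close> of the cell containing \<open>r\<close> contributes, and its left end lies
  within \<open>1 / Suc m\<close> of \<open>r\<close>.\<close>

lemma approx_eq:
  assumes "t \<le> r"
  defines "i m \<equiv> nat \<lfloor>(r - t) * real (Suc m)\<rfloor>"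
  shows "approx t m w r = ennreal (wt (grid t m (i m)) w) * ennreal (gen Y r w)"
    and "grid t m (i m) \<le> r" and "(\<lambda>m. grid t m (i m)) \<longlonglongrightarrow> r"
proof -
  have i: "real (i m) = of_int \<lfloor>(r - t) * real (Suc m)\<rfloor>" for m
    using assms(1) by (simp add: i_def)
  have b: "real (i m) \<le> (r - t) * real (Suc m)" "(r - t) * real (Suc m) < real (i m) + 1" for m
    unfolding i by linarith+
  have le: "grid t m (i m) \<le> r" for m
    using b(1)[of m] by (simp add: grid_def field_simps)
  then show "grid t m (i m) \<le> r" .
  have gt: "r < grid t m (i m) + 1 / real (Suc m)" for m
    using b(2)[of m] by (simp add: grid_def field_simps)
  have iff: "r \<in> {grid t m j..<grid t m (Suc j)} \<longleftrightarrow> j = i m" for j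
  proof
    assume "r \<in> {grid t m j..<grid t m (Suc j)}"
    then have "real j \<le> (r - t) * real (Suc m)" "(r - t) * real (Suc m) < real j + 1"
      by (auto simp: grid_def field_simps)
    then have "real j < real (i m) + 1" "real (i m) < real j + 1" using b[of m] by linarith+
    then show "j = i m" by linarith
  next
    assume "j = i m"
    then show "r \<in> {grid t m j..<grid t m (Suc j)}"
      using b[of m] by (auto simp: grid_def field_simps)
  qed
  have "approx t m w r = (\<Sum>j\<in>{i m}. ennreal (wt (grid t m j) w)
      * (ennreal (gen Y r w) * indicator {grid t m j..<grid t m (Suc j)} r))"
    unfolding approx_def by (intro suminf_finite) (use iff in \<open>auto simp: indicator_def\<close>)
  then show "approx t m w r = ennreal (wt (grid t m (i m)) w) * ennreal (gen Y r w)"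
    using iff[of "i m"] by simp
  show "(\<lambda>m. grid t m (i m)) \<longlonglongrightarrow> r"
  proof (rule tendsto_sandwich)
    show "\<forall>\<^sub>F m in sequentially. r - 1 / real (Suc m) \<le> grid t m (i m)"
      using gt by (intro always_eventually allI) (simp add: less_imp_le algebra_simps)
    show "(\<lambda>m. r - 1 / real (Suc m)) \<longlonglongrightarrow> r"
      using tendsto_diff[OF tendsto_const LIMSEQ_Suc[OF lim_1_over_n], of r] by simp
  qed (use le in auto)
qed

lemma AE_path_left_continuous:
  assumes Z: "sol Z" and w: "w \<in> space M"
  shows "AE r in lborel. 0 < r \<longrightarrow> ((\<lambda>s. Z s w) \<longlongrightarrow> Z r w) (at_left r)"
proof (rule AE_left_continuous)
  show "(\<lambda>s. indicator {0..} s * Z s w) \<in> borel_measurable borel"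
    by (rule progressive_path[OF solD(3)[OF Z] w])
qed (use solD(1)[OF Z] w in \<open>auto simp: cadlag_def\<close>)

lemma liminf_approx:
  assumes t: "0 \<le> t"
  shows "AE w in M. AE r in lborel. ennreal ((1 - \<rho>) * gen W r w) * indicator {t..} r \<le> liminf (\<lambda>m. approx t m w r)"
proof -
  have "AE w in M. AE r in lborel. 0 \<le> r \<longrightarrow> 0 < Y r w"
    by (rule AE_AE_positive[OF solD(3)[OF Y]]) (rule Y_pos)
  moreover have "AE w in M. AE r in lborel. 0 \<le> r \<longrightarrow> 0 < W r w"
    by (rule AE_AE_positive[OF solD(3)[OF W]]) (rule W_pos)
  ultimately show ?thesis
    using AE_space
  proof eventually_elim
    case (elim w)
    show ?case
      using elim(1,2) AE_path_left_continuous[OF Y elim(3)] AE_path_left_continuous[OF W elim(3)] AE_lborel_singleton[of t]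
    proof eventually_elim
      case (elim r)
      show ?case
      proof (cases "t < r")
        case True
        then have r: "0 < r" "t \<le> r" using t by auto
        then have pos: "0 < Y r w" "0 < W r w" using elim by auto
        let ?\<tau> = "\<lambda>m. grid t m (nat \<lfloor>(r - t) * real (Suc m)\<rfloor>)"
        note \<tau> = approx_eq(3,2)[OF r(2)]
        have "(\<lambda>m. wt (?\<tau> m) w) \<longlonglongrightarrow> wt r w"
          unfolding wt_def using elim r pos
          by (intro tendsto_mult tendsto_const tendsto_powr tendsto_divide
                tendsto_left_compose[of "\<lambda>s. Y s w", OF _ \<tau>] tendsto_left_compose[of "\<lambda>s. W s w", OF _ \<tau>]) auto
        then have "(\<lambda>m. ennreal (wt (?\<tau> m) w * gen Y r w)) \<longlonglongrightarrow> ennreal (wt r w * gen Y r w)"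
          by (intro tendsto_ennrealI tendsto_mult tendsto_const)
        \<comment> \<open>The powers of \<open>Y\<close> cancel, which turns the drift of
          \<open>Y\<close> into the drift of \<open>W\<close>.\<close>
        also have "wt r w * gen Y r w = (1 - \<rho>) * gen W r w"
          using pos by (simp add: wt_def gen_def powr_divide powr_minus field_simps)
        finally have "(\<lambda>m. approx t m w r) \<longlonglongrightarrow> ennreal ((1 - \<rho>) * gen W r w)"
          unfolding approx_eq(1)[OF r(2)] using wt_nonneg by (simp add: ennreal_mult')
        then have "liminf (\<lambda>m. approx t m w r) = ennreal ((1 - \<rho>) * gen W r w)"
          by (intro lim_imp_Liminf) auto
        then show ?thesis using True by simp
      qed (use elim in auto)
    qed
  qed
qed

text \<open>Fatou is used twice, along each path in time and then over the probability space; the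
  telescoped sums stay below \<open>mass A geo t\<close> for every mesh.\<close>

lemma mass_le_geo:
  assumes t: "0 \<le> t" and A: "A \<in> sets (F t)"
  shows "ennreal (1 - \<rho>) * mass A W t \<le> mass A geo t"
proof -
  have A_M[measurable]: "A \<in> sets M" by (rule sets_F[OF t A])
  have gP: "progressive M F (\<lambda>s w. (1 - \<rho>) * gen W s w)"
    using \<rho> by (intro PplusD(1)[OF cmult_Pplus[OF gen_Pplus[OF solD(2)[OF W]]]]) simp
  have "ennreal (1 - \<rho>) * mass A W t = tail A (\<lambda>s w. (1 - \<rho>) * gen W s w) t"
    using solD(5)[OF W t A] tail_cmult[OF sol_gen[OF W] A_M _ t, of "1 - \<rho>"] \<rho> by simp
  also have "\<dots> = (\<integral>\<^sup>+w\<in>A. (\<integral>\<^sup>+r\<in>{t..}. ennreal ((1 - \<rho>) * gen W r w) \<partial>lborel) \<partial>M)"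
    by (rule tail_Fubini(2)[OF gP A_M t])
  also have "\<dots> \<le> (\<integral>\<^sup>+w. liminf (\<lambda>m. (\<integral>\<^sup>+r. approx t m w r \<partial>lborel) * indicator A w) \<partial>M)"
  proof (rule nn_integral_mono_AE)
    show "AE w in M. (\<integral>\<^sup>+r\<in>{t..}. ennreal ((1 - \<rho>) * gen W r w) \<partial>lborel) * indicator A w
        \<le> liminf (\<lambda>m. (\<integral>\<^sup>+r. approx t m w r \<partial>lborel) * indicator A w)"
      using liminf_approx[OF t] AE_space
    proof eventually_elim
      case (elim w)
      have "(\<integral>\<^sup>+r\<in>{t..}. ennreal ((1 - \<rho>) * gen W r w) \<partial>lborel) \<le> (\<integral>\<^sup>+r. liminf (\<lambda>m. approx t m w r) \<partial>lborel)"
        by (rule nn_integral_mono_AE[OF elim(1)])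
      also have "\<dots> \<le> liminf (\<lambda>m. \<integral>\<^sup>+r. approx t m w r \<partial>lborel)"
        by (rule nn_integral_liminf) (simp add: approx_measurable[OF t elim(2)])
      finally show ?case by (cases "w \<in> A") auto
    qed
  qed
  also have "\<dots> \<le> liminf (\<lambda>m. \<integral>\<^sup>+w\<in>A. (\<integral>\<^sup>+r. approx t m w r \<partial>lborel) \<partial>M)"
    by (intro nn_integral_liminf borel_measurable_times_ennreal approx_integral_measurable t borel_measurable_indicator A_M)
  also have "\<dots> \<le> liminf (\<lambda>m::nat. mass A geo t)"
    by (intro Liminf_mono always_eventually allI approx_bound t A)
  finally show ?thesis by (simp add: Liminf_const)
qed

lemma positive_sol_lower: "dominated W (scaled (\<theta> powr \<theta>) Y)"
  unfolding dominated_def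
proof (intro allI impI)
  fix t :: real assume t: "0 \<le> t"
  have "AE w in M. (1 - \<rho>) * W t w \<le> geo t w"
  proof (rule AE_le_F[OF t _ geo_measurable[OF t]])
    show "(\<lambda>w. (1 - \<rho>) * W t w) \<in> borel_measurable (F t)"
      using sol_F[OF W t] by measurable
    fix A assume A: "A \<in> sets (F t)"
    show "(\<integral>\<^sup>+w\<in>A. ennreal ((1 - \<rho>) * W t w) \<partial>M) \<le> (\<integral>\<^sup>+w\<in>A. ennreal (geo t w) \<partial>M)"
      using mass_le_geo[OF t A] mass_cmult[of W t A "1 - \<rho>"] sol_M[OF W t] sets_F[OF t A] \<rho>
      by (simp add: mass_def)
  qed (simp add: geo_def)
  then show "AE w in M. W t w \<le> \<theta> powr \<theta> * Y t w"
    using Y_pos[OF t] W_pos[OF t]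
  proof eventually_elim
    case (elim w)
    \<comment> \<open>Division by \<open>W powr \<rho>\<close>, possible as \<open>W\<close> is
      positive, and raising to the power \<open>\<theta> = 1 / (1 - \<rho>)\<close> produce the
      constant \<open>\<theta> powr \<theta>\<close>.\<close>
    have "W t w = \<theta> * ((1 - \<rho>) * W t w)" using \<theta> by (simp flip: mult.assoc)
    also have "\<dots> \<le> \<theta> * geo t w" using elim(1) \<theta>_pos by (intro mult_left_mono) auto
    finally have "W t w powr (1 - \<rho>) * W t w powr \<rho> \<le> \<theta> * Y t w powr (1 - \<rho>) * W t w powr \<rho>"
      using elim by (simp add: geo_def mult.assoc flip: powr_add)
    then have "W t w powr (1 - \<rho>) \<le> \<theta> * Y t w powr (1 - \<rho>)"
      using elim by simp
    then have "(W t w powr (1 - \<rho>)) powr \<theta> \<le> (\<theta> * Y t w powr (1 - \<rho>)) powr \<theta>"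
      using \<theta>_pos by (intro powr_mono2) auto
    then show ?case
      using elim \<theta> \<theta>_pos by (simp add: powr_powr powr_mult mult.commute)
  qed
qed

end

end

section \<open>Relation to real conditional expectations\<close>

context usual_filtered
begin

lemma real_cond_exp_eq_cexp:
  assumes t: "0 \<le> t" and [measurable]: "Z \<in> borel_measurable M" and Z: "\<And>w. w \<in> space M \<Longrightarrow> 0 \<le> Z w"
  shows "AE w in M. real_cond_exp M (F t) Z w = cexp Z t w"
proof -
  interpret S: sigma_finite_subalgebra M "F t" by (rule sigma_finite_F[OF t])
  have "AE w in M. nn_cond_exp M (F t) (\<lambda>w. ennreal (- Z w)) w = nn_cond_exp M (F t) (\<lambda>w. 0) w"
    by (rule S.nn_cond_exp_cong) (use Z in \<open>auto simp: ennreal_neg\<close>)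
  moreover have "AE w in M. 0 = nn_cond_exp M (F t) (\<lambda>w. 0) w"
    by (rule S.nn_cond_exp_F_meas) simp
  ultimately show ?thesis
    by eventually_elim (simp add: real_cond_exp_def cexp_def)
qed

text \<open>No integrability is required: for a divergent integral both sides take the default value
  0.\<close>

lemma tail_integral_eq:
  assumes g: "Pplus M F g" and t: "0 \<le> t" and w: "w \<in> space M"
  shows "(LINT s:{t..}|lborel. g s w) = enn2real (\<integral>\<^sup>+s\<in>{t..}. ennreal (g s w) \<partial>lborel)"
proof -
  have [measurable]: "(\<lambda>s. indicator {0..} s * g s w) \<in> borel_measurable borel"
    by (rule progressive_path[OF PplusD(1)[OF g] w])
  have "(\<lambda>s. indicator {t..} s * (indicator {0..} s * g s w)) \<in> borel_measurable borel"
    by measurable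
  also have "(\<lambda>s. indicator {t..} s * (indicator {0..} s * g s w)) = (\<lambda>s. indicator {t..} s *\<^sub>R g s w)"
    using t by (auto simp: fun_eq_iff indicator_def)
  finally have "(LINT s:{t..}|lborel. g s w) = enn2real (\<integral>\<^sup>+s. ennreal (indicator {t..} s *\<^sub>R g s w) \<partial>lborel)"
    unfolding set_lebesgue_integral_def
    by (intro integral_eq_nn_integral) (use PplusD(2)[OF g _ w] t in \<open>auto simp: indicator_def\<close>)
  also have "(\<integral>\<^sup>+s. ennreal (indicator {t..} s *\<^sub>R g s w) \<partial>lborel) = (\<integral>\<^sup>+s\<in>{t..}. ennreal (g s w) \<partial>lborel)"
    by (intro nn_integral_cong) (auto simp: indicator_def)
  finally show ?thesis .
qed

lemma tail_integral:
  assumes g: "Pplus M F g" and fin: "tail (space M) g 0 < \<infinity>" and t: "0 \<le> t"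
  defines "h \<equiv> \<lambda>w. LINT s:{t..}|lborel. g s w"
  shows "h \<in> borel_measurable M" and "w \<in> space M \<Longrightarrow> 0 \<le> h w"
    and "A \<in> sets M \<Longrightarrow> (\<integral>\<^sup>+w\<in>A. ennreal (h w) \<partial>M) = tail A g t"
    and "integrable M h"
proof -
  let ?I = "\<lambda>w. \<integral>\<^sup>+s\<in>{t..}. ennreal (g s w) \<partial>lborel"
  have [measurable]: "?I \<in> borel_measurable M"
    by (rule tail_Fubini(1)[OF PplusD(1)[OF g] sets.top t])
  have h: "h w = enn2real (?I w)" if "w \<in> space M" for w
    unfolding h_def by (rule tail_integral_eq[OF g t that])
  show meas: "h \<in> borel_measurable M"
    by (rule measurable_cong[THEN iffD2, OF h]) auto
  show nonneg: "0 \<le> h w" if "w \<in> space M" for w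
    using h[OF that] by simp
  have I: "(\<integral>\<^sup>+w. ?I w \<partial>M) = tail (space M) g t"
    unfolding tail_Fubini(2)[OF PplusD(1)[OF g] sets.top t] by (auto intro: nn_integral_cong)
  then have "(\<integral>\<^sup>+w. ?I w \<partial>M) \<noteq> \<infinity>"
    using tail_finite[OF fin sets.top t] by simp
  then have "AE w in M. ?I w \<noteq> \<infinity>"
    by (intro nn_integral_noteq_infinite) auto
  then have AE: "AE w in M. ennreal (h w) = ?I w"
    using AE_space by eventually_elim (simp add: h less_top)
  show integral: "(\<integral>\<^sup>+w\<in>A. ennreal (h w) \<partial>M) = tail A g t" if "A \<in> sets M" for A
    unfolding tail_Fubini(2)[OF PplusD(1)[OF g] that t]
    by (rule nn_integral_cong_AE) (use AE in \<open>auto elim!: eventually_mono\<close>)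
  have "(\<integral>\<^sup>+w. ennreal (h w) \<partial>M) = (\<integral>\<^sup>+w. ?I w \<partial>M)"
    by (rule nn_integral_cong_AE[OF AE])
  then have "(\<integral>\<^sup>+w. ennreal (h w) \<partial>M) < \<infinity>"
    unfolding I using tail_finite[OF fin sets.top t] by simp
  then show "integrable M h"
    using meas nonneg by (intro integrableI_nonneg) (auto intro: AE_I2)
qed

text \<open>Replaces \<open>Jproc\<close> by a version that is nonnegative everywhere and
  characterised by its integrals over events.\<close>

lemma cond_tail_integral:
  assumes g: "Pplus M F g" and fin: "tail (space M) g 0 < \<infinity>" and t: "0 \<le> t"
  obtains G where "G \<in> borel_measurable (F t)" "\<forall>w. 0 \<le> G w" "AE w in M. Jproc M F g t w = G w"
    "\<forall>A\<in>sets (F t). (\<integral>\<^sup>+w\<in>A. ennreal (G w) \<partial>M) = tail A g t"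
proof -
  let ?h = "\<lambda>w. LINT s:{t..}|lborel. g s w"
  note h = tail_integral[OF g fin t]
  have "(\<integral>\<^sup>+w. ennreal (?h w) \<partial>M) = (\<integral>\<^sup>+w\<in>space M. ennreal (?h w) \<partial>M)"
    by (auto intro: nn_integral_cong)
  then have fin': "(\<integral>\<^sup>+w. ennreal (?h w) \<partial>M) < \<infinity>"
    using h(3)[OF sets.top] tail_finite[OF fin sets.top t] by simp
  show thesis
  proof (rule that[of "cexp ?h t"])
    show "AE w in M. Jproc M F g t w = cexp ?h t w"
      unfolding Jproc_def by (rule real_cond_exp_eq_cexp[OF t h(1,2)])
    show "\<forall>A\<in>sets (F t). (\<integral>\<^sup>+w\<in>A. ennreal (cexp ?h t w) \<partial>M) = tail A g t"
      using nn_integral_cexp[OF t h(1) fin'] h(3) sets_F[OF t] by simp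
  qed auto
qed

text \<open>The factor \<open>c\<close> may be negative: besides 1 it is instantiated with
  \<open>1 / (1 - R)\<close>, whose sign depends on \<open>R\<close>.\<close>

lemma finite_expected_integral_iff:
  assumes g: "Pplus M F g" and c: "c \<noteq> 0"
    and eq: "\<And>s w. 0 \<le> s \<Longrightarrow> w \<in> space M \<Longrightarrow> h s w = c * g s w"
  shows "finite_expected_integral M h \<longleftrightarrow> tail (space M) g 0 < \<infinity>"
proof -
  have prog: "progressive M F (\<lambda>s w. \<bar>c\<bar> * g s w)"
    by (rule progressive_comp2[OF PplusD(1)[OF g] PplusD(1)[OF g], of "\<lambda>x y. \<bar>c\<bar> * x"]) measurable
  have "(\<integral>\<^sup>+w. (\<integral>\<^sup>+s\<in>{0..}. ennreal \<bar>h s w\<bar> \<partial>lborel) \<partial>M)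
      = (\<integral>\<^sup>+w\<in>space M. (\<integral>\<^sup>+s\<in>{0..}. ennreal (\<bar>c\<bar> * g s w) \<partial>lborel) \<partial>M)"
    by (intro nn_integral_cong) (auto intro!: nn_integral_cong simp: eq abs_mult PplusD(2)[OF g] indicator_def)
  also have "\<dots> = tail (space M) (\<lambda>s w. \<bar>c\<bar> * g s w) 0"
    by (rule tail_Fubini(2)[OF prog sets.top order_refl, symmetric])
  also have "\<dots> = ennreal \<bar>c\<bar> * tail (space M) g 0"
    by (rule tail_cmult[OF PplusD(1)[OF g]]) auto
  finally show ?thesis
    using c by (auto simp: finite_expected_integral_def ennreal_mult_less_top ennreal_mult_eq_top_iff less_top[symmetric])
qed

text \<open>Translates the order conditions of the definitions into conditions on masses and
  back.\<close>

lemma Jproc_bounds_iff_mass: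
  assumes X: "Pplus M F X" and fin: "tail (space M) X 0 < \<infinity>" and t: "0 \<le> t" and c: "0 \<le> c"
    and U: "U \<in> borel_measurable (F t)" "\<And>w. w \<in> space M \<Longrightarrow> 0 \<le> U w"
  shows "(AE w in M. c * Jproc M F X t w \<le> U w)
      \<longleftrightarrow> (\<forall>A\<in>sets (F t). ennreal c * tail A X t \<le> (\<integral>\<^sup>+w\<in>A. ennreal (U w) \<partial>M))"
    and "(AE w in M. U w \<le> c * Jproc M F X t w)
      \<longleftrightarrow> (\<forall>A\<in>sets (F t). (\<integral>\<^sup>+w\<in>A. ennreal (U w) \<partial>M) \<le> ennreal c * tail A X t)"
proof -
  obtain G where G: "G \<in> borel_measurable (F t)" "\<forall>w. 0 \<le> G w" "AE w in M. Jproc M F X t w = G w"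
    "\<forall>A\<in>sets (F t). (\<integral>\<^sup>+w\<in>A. ennreal (G w) \<partial>M) = tail A X t"
    using cond_tail_integral[OF X fin t] .
  have cG: "(\<integral>\<^sup>+w\<in>A. ennreal (c * G w) \<partial>M) = ennreal c * tail A X t" if "A \<in> sets (F t)" for A
  proof -
    have [measurable]: "A \<in> sets M" "G \<in> borel_measurable M"
      using sets_F[OF t that] measurable_F_M[OF t G(1)] by auto
    show ?thesis unfolding G(4)[rule_format, OF that, symmetric]
      using c by (simp add: ennreal_mult' mult.assoc nn_integral_cmult)
  qed
  have cG_F: "(\<lambda>w. c * G w) \<in> borel_measurable (F t)" using G(1) by measurable
  have "(AE w in M. c * Jproc M F X t w \<le> U w) \<longleftrightarrow> (AE w in M. c * G w \<le> U w)"
    "(AE w in M. U w \<le> c * Jproc M F X t w) \<longleftrightarrow> (AE w in M. U w \<le> c * G w)"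
    using G(3) by (auto elim: eventually_elim2)
  then show "(AE w in M. c * Jproc M F X t w \<le> U w)
      \<longleftrightarrow> (\<forall>A\<in>sets (F t). ennreal c * tail A X t \<le> (\<integral>\<^sup>+w\<in>A. ennreal (U w) \<partial>M))"
    and "(AE w in M. U w \<le> c * Jproc M F X t w)
      \<longleftrightarrow> (\<forall>A\<in>sets (F t). (\<integral>\<^sup>+w\<in>A. ennreal (U w) \<partial>M) \<le> ennreal c * tail A X t)"
    using AE_le_F_iff[OF t cG_F U] AE_le_F_iff[OF t U(1) cG_F] c G(2) by (simp_all add: cG)
qed

lemma SO_massD:
  assumes "SO M F X"
  obtains k K where "Pplus M F X" "tail (space M) X 0 < \<infinity>" "0 < k" "k \<le> K"
    "\<And>t A. 0 \<le> t \<Longrightarrow> A \<in> sets (F t) \<Longrightarrow> ennreal k * tail A X t \<le> mass A X t"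
    "\<And>t A. 0 \<le> t \<Longrightarrow> A \<in> sets (F t) \<Longrightarrow> mass A X t \<le> ennreal K * tail A X t"
proof -
  obtain k K where kK: "0 < k" "k \<le> K"
    "\<And>t. 0 \<le> t \<Longrightarrow> AE w in M. k * Jproc M F X t w \<le> X t w \<and> X t w \<le> K * Jproc M F X t w"
    using assms unfolding SO_def by blast
  have X: "Pplus M F X"
    using assms by (auto simp: SO_def Ppp_def Pplus_def less_imp_le)
  have fin: "tail (space M) X 0 < \<infinity>"
    using assms finite_expected_integral_iff[OF X, of 1 X] by (simp add: SO_def)
  note J = Jproc_bounds_iff_mass[OF X fin, where U = "X t" for t]
  show thesis
  proof (rule that[OF X fin kK(1,2)])
    fix t A assume t: "0 \<le> (t::real)" and A: "A \<in> sets (F t)"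
    note X_t = progressive_adapted[OF PplusD(1)[OF X] t] PplusD(2)[OF X t]
    have AE: "AE w in M. k * Jproc M F X t w \<le> X t w" "AE w in M. X t w \<le> K * Jproc M F X t w"
      using kK(3)[OF t] by (auto elim!: eventually_mono)
    show "ennreal k * tail A X t \<le> mass A X t"
      using J(1)[OF t _ X_t] AE(1) A kK by (simp add: mass_def)
    show "mass A X t \<le> ennreal K * tail A X t"
      using J(2)[OF t _ X_t] AE(2) A kK by (simp add: mass_def)
  qed
qed

text \<open>Countably many dyadic times share one null set, and every other time is a limit of
  dyadic times from the right.\<close>

lemma AE_all_le_of_right_continuous:
  assumes "cadlag M Y" "cadlag M W" "\<And>t. 0 \<le> t \<Longrightarrow> AE w in M. Y t w \<le> W t w"
  shows "AE w in M. \<forall>t\<ge>0. Y t w \<le> W t w"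
proof -
  have "AE w in M. \<forall>s\<in>dyadics. Y s w \<le> W s w"
    using assms(3) dyadics_nonneg by (simp add: AE_ball_countable[OF countable_dyadics])
  then show ?thesis
    using AE_space
  proof eventually_elim
    case (elim w)
    show ?case
    proof (intro allI impI)
      fix t :: real assume t: "0 \<le> t"
      have "filterlim (dyadic_above t) (at_right t) sequentially"
        unfolding filterlim_at using dyadic_above_tendsto dyadic_above_bounds(1)[of t]
        by (auto simp: order_less_imp_not_eq2)
      moreover have "((\<lambda>s. Y s w) \<longlongrightarrow> Y t w) (at_right t)" "((\<lambda>s. W s w) \<longlongrightarrow> W t w) (at_right t)"
        using assms(1,2) elim(2) t by (auto simp: cadlag_def)
      ultimately have "(\<lambda>n. Y (dyadic_above t n) w) \<longlonglongrightarrow> Y t w" "(\<lambda>n. W (dyadic_above t n) w) \<longlonglongrightarrow> W t w"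
        by (auto intro: filterlim_compose)
      then show "Y t w \<le> W t w"
        by (rule LIMSEQ_le) (use elim(1) dyadic_above_in[OF t] in blast)
    qed
  qed
qed

end

section \<open>Epstein--Zin utility\<close>

locale ez_setting = ez_equation +
  fixes C :: "real \<Rightarrow> 'a \<Rightarrow> real" and R S :: real
  assumes X_eq: "X = (\<lambda>t w. C t w powr (1 - R))"
    and R: "R \<noteq> 1" and S: "S \<noteq> 1"
    and \<theta>_EZ: "\<theta> = EZ_theta R S" and \<rho>_EZ: "\<rho> = EZ_rho R S"
begin

text \<open>From \<open>\<theta> * (1 - \<rho>) = 1\<close> follows
  \<open>(1 - R) * (1 - \<rho>) = 1 - S\<close>, which matches the exponents of \<open>C\<close>;
  the prefactors agree by the definition of \<open>\<theta>\<close>.\<close>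

lemma f_EZ_eq: "f_EZ R S (C s w) (V s w) = 1 / (1 - R) * gen (\<lambda>s w. (1 - R) * V s w) s w"
proof -
  have "(1 - R) * (1 - \<rho>) = 1 - S"
    using \<theta> R S by (simp add: \<theta>_EZ EZ_theta_def field_simps)
  then have "X s w powr (1 - \<rho>) = C s w powr (1 - S)"
    by (simp add: X_eq powr_powr)
  moreover have "1 / (1 - R) * \<theta> = 1 / (1 - S)"
    using R S by (simp add: \<theta>_EZ EZ_theta_def)
  ultimately have "C s w powr (1 - S) / (1 - S) * ((1 - R) * V s w) powr \<rho>
      = 1 / (1 - R) * \<theta> * (X s w powr (1 - \<rho>) * ((1 - R) * V s w) powr \<rho>)"
    by simp
  then show ?thesis
    by (simp only: f_EZ_def gen_def \<rho>_EZ[symmetric] mult.assoc)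
qed

text \<open>Multiplication by \<open>1 - R\<close> makes solutions nonnegative for either sign of
  \<open>1 - R\<close>, and conditional expectation commutes with the constant.\<close>

lemma EZ_solution_iff: "EZ_solution R S M F C V \<longleftrightarrow> sol (\<lambda>s w. (1 - R) * V s w)"
proof -
  let ?W = "\<lambda>s w. (1 - R) * V s w"
  let ?c = "1 / (1 - R)"
  have cadlag: "cadlag M V \<longleftrightarrow> cadlag M ?W"
  proof -
    have scale: "cadlag M (\<lambda>s w. a * Z s w)" if "cadlag M Z" for a Z
      unfolding cadlag_def
    proof (intro ballI conjI allI impI)
      fix w and t :: real assume "w \<in> space M" "0 \<le> t"
      then show "((\<lambda>s. a * Z s w) \<longlongrightarrow> a * Z t w) (at_right t)"
        using that by (intro tendsto_mult tendsto_const) (simp add: cadlag_def)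
    next
      fix w and t :: real assume "w \<in> space M" "0 < t"
      with that have "\<exists>l. ((\<lambda>s. Z s w) \<longlongrightarrow> l) (at_left t)"
        unfolding cadlag_def by blast
      then obtain l where "((\<lambda>s. Z s w) \<longlongrightarrow> l) (at_left t)" ..
      then show "\<exists>l. ((\<lambda>s. a * Z s w) \<longlongrightarrow> l) (at_left t)"
        by (intro exI[of _ "a * l"] tendsto_mult tendsto_const)
    qed
    show ?thesis
      using scale[of V "1 - R"] scale[of ?W ?c] R by auto
  qed
  have prog: "progressive M F V \<longleftrightarrow> progressive M F ?W"
  proof -
    have scale: "progressive M F (\<lambda>s w. a * Z s w)" if "progressive M F Z" for a Z
      using progressive_comp2[OF that that, of "\<lambda>x y. a * x"] by simp
    show ?thesis
      using scale[of V "1 - R"] scale[of ?W ?c] R by auto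
  qed
  \<comment> \<open>Both sides imply that \<open>?W\<close> is progressive and nonnegative, so the
    equivalence may be proved under this assumption.\<close>
  have "EZ_solution R S M F C V \<longleftrightarrow> sol ?W" if W: "Pplus M F ?W"
  proof -
    have g: "Pplus M F (gen ?W)" by (rule gen_Pplus[OF W])
    have fin: "finite_expected_integral M (\<lambda>s w. f_EZ R S (C s w) (V s w)) \<longleftrightarrow> tail (space M) (gen ?W) 0 < \<infinity>"
      using R by (intro finite_expected_integral_iff[OF g, of ?c]) (auto simp: f_EZ_eq)
    have "(AE w in M. V t w = real_cond_exp M (F t) (\<lambda>w'. LINT s:{t..}|lborel. f_EZ R S (C s w') (V s w')) w)
        \<longleftrightarrow> (\<forall>A\<in>sets (F t). mass A ?W t = tail A (gen ?W) t)"
      if t: "0 \<le> t" and fin: "tail (space M) (gen ?W) 0 < \<infinity>" for t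
    proof -
      interpret Sub: sigma_finite_subalgebra M "F t" by (rule sigma_finite_F[OF t])
      let ?h = "\<lambda>w. LINT s:{t..}|lborel. gen ?W s w"
      have f: "(\<lambda>w'. LINT s:{t..}|lborel. f_EZ R S (C s w') (V s w')) = (\<lambda>w. ?c * ?h w)"
        by (simp only: f_EZ_eq set_integral_mult_right)
      obtain G where G: "G \<in> borel_measurable (F t)" "\<forall>w. 0 \<le> G w" "AE w in M. Jproc M F (gen ?W) t w = G w"
        "\<forall>A\<in>sets (F t). (\<integral>\<^sup>+w\<in>A. ennreal (G w) \<partial>M) = tail A (gen ?W) t"
        using cond_tail_integral[OF g fin t] .
      have "AE w in M. real_cond_exp M (F t) (\<lambda>w. ?c * ?h w) w = ?c * real_cond_exp M (F t) ?h w"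
        by (rule Sub.real_cond_exp_cmult[OF tail_integral(4)[OF g fin t]])
      with G(3)[unfolded Jproc_def] have AE: "AE w in M. real_cond_exp M (F t) (\<lambda>w. ?c * ?h w) w = ?c * G w"
        by eventually_elim simp
      have "(AE w in M. V t w = real_cond_exp M (F t) (\<lambda>w. ?c * ?h w) w) \<longleftrightarrow> (AE w in M. ?W t w = G w)"
      proof
        assume "AE w in M. V t w = real_cond_exp M (F t) (\<lambda>w. ?c * ?h w) w"
        with AE show "AE w in M. ?W t w = G w" by eventually_elim (use R in simp)
      next
        assume "AE w in M. ?W t w = G w"
        with AE show "AE w in M. V t w = real_cond_exp M (F t) (\<lambda>w. ?c * ?h w) w"
        proof eventually_elim
          case (elim w)
          have "V t w = ?c * ?W t w" using R by simp
          then show ?case unfolding elim .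
        qed
      qed
      also have "\<dots> \<longleftrightarrow> (\<forall>A\<in>sets (F t). mass A ?W t = tail A (gen ?W) t)"
      proof
        assume "AE w in M. ?W t w = G w"
        then have "mass A ?W t = (\<integral>\<^sup>+w\<in>A. ennreal (G w) \<partial>M)" for A
          unfolding mass_def by (intro nn_integral_cong_AE) (auto elim!: eventually_mono)
        then show "\<forall>A\<in>sets (F t). mass A ?W t = tail A (gen ?W) t" using G(4) by simp
      next
        assume "\<forall>A\<in>sets (F t). mass A ?W t = tail A (gen ?W) t"
        then show "AE w in M. ?W t w = G w"
          using progressive_adapted[OF PplusD(1)[OF W] t] PplusD(2)[OF W t] G
          by (intro AE_eq_F[OF t]) (auto simp: mass_def)
      qed
      finally show ?thesis unfolding f .
    qed
    then have "tail (space M) (gen ?W) 0 < \<infinity> \<Longrightarrow>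
        (\<forall>t\<ge>0. AE w in M. V t w = real_cond_exp M (F t) (\<lambda>w'. LINT s:{t..}|lborel. f_EZ R S (C s w') (V s w')) w)
        \<longleftrightarrow> (\<forall>t\<ge>0. \<forall>A\<in>sets (F t). mass A ?W t = tail A (gen ?W) t)"
      by simp
    moreover have "progressive M F V" "\<forall>t\<ge>0. \<forall>w\<in>space M. (1 - R) * V t w \<ge> 0"
      using W prog by (simp_all add: Pplus_def)
    ultimately show ?thesis
      using cadlag fin W unfolding EZ_solution_def sol_def
      by (cases "tail (space M) (gen ?W) 0 < \<infinity>") simp_all
  qed
  moreover have "Pplus M F ?W" if "EZ_solution R S M F C V \<or> sol ?W"
    using that prog by (auto simp: EZ_solution_def sol_def Pplus_def)
  ultimately show ?thesis by blast
qed

lemma J_bounds: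
  assumes t: "0 \<le> t"
  shows "AE w in M. k * Jproc M F X t w \<le> X t w \<and> X t w \<le> K * Jproc M F X t w"
proof -
  note J = Jproc_bounds_iff_mass[OF X X_finite t _ progressive_adapted[OF PplusD(1)[OF X] t] PplusD(2)[OF X t]]
  have "AE w in M. k * Jproc M F X t w \<le> X t w"
    using J(1)[of k] X_lower[OF t] k by (simp add: mass_def)
  moreover have "AE w in M. X t w \<le> K * Jproc M F X t w"
    using J(2)[of K] X_upper[OF t] k by (simp add: mass_def)
  ultimately show ?thesis by eventually_elim simp
qed

text \<open>Positivity of \<open>X\<close> and \<open>X \<le> K J\<close> force the conditional tail
  to be positive. Hence a proper solution is positive almost surely at every time.\<close>

lemma J_pos:
  assumes t: "0 \<le> t"
  shows "AE w in M. 0 < Jproc M F X t w"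
  using J_bounds[OF t] AE_space
proof eventually_elim
  case (elim w)
  then have "0 < K * Jproc M F X t w" using X_pos[OF t elim(2)] by linarith
  then show ?case using k by (simp add: zero_less_mult_iff)
qed

theorem unique_solution:
  "\<exists>V. EZ_solution R S M F C V
     \<and> EZ_CRRA_order R M F C V \<and> EZ_extremal R S M F C V \<and> EZ_proper R M F C V
     \<and> (\<forall>V'. EZ_solution R S M F C V'
            \<and> (EZ_CRRA_order R M F C V' \<or> EZ_extremal R S M F C V' \<or> EZ_proper R M F C V')
            \<longrightarrow> indistinguishable M V V')"
proof -
  obtain W where W: "sol W" "bracketed W" using ex_sol by blast
  have W_lo: "dominated (scaled lo X) W" and W_hi: "dominated W (scaled hi X)"
    using W(2) by (auto simp: bracketed_def)
  define V where "V s w = W s w / (1 - R)" for s w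
  have V: "(\<lambda>s w. (1 - R) * V s w) = W"
    using R by (auto simp: V_def fun_eq_iff)
  have V': "(1 - R) * V s w = W s w" for s w using R by (simp add: V_def)
  have V_sol: "EZ_solution R S M F C V" unfolding EZ_solution_iff V by (rule W(1))
  have max: "dominated Y W" if Y: "sol Y" for Y
  proof -
    obtain c where c: "0 < c" "dominated Y (scaled c X)" using sol_upper[OF Y] .
    \<comment> \<open>\<open>Y \<le> c X\<close> and \<open>lo X \<le> W\<close>.\<close>
    have "dominated Y (scaled (c / lo) W)"
      unfolding dominated_def
    proof (intro allI impI)
      fix t :: real assume t: "0 \<le> t"
      have "AE w in M. Y t w \<le> c * X t w" "AE w in M. lo * X t w \<le> W t w"
        using c(2) W_lo t by (auto simp: dominated_def)
      then show "AE w in M. Y t w \<le> c / lo * W t w"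
      proof eventually_elim
        case (elim w)
        have "c * X t w = c / lo * (lo * X t w)" using lo_hi by simp
        also have "\<dots> \<le> c / lo * W t w" using elim c(1) lo_hi by (intro mult_left_mono) auto
        finally show ?case using elim by simp
      qed
    qed
    then show ?thesis using c lo_hi by (intro sol_dominated[OF Y W(1), of "c / lo"]) auto
  qed
  have AE_all: "AE w in M. \<forall>t\<ge>0. Y t w \<le> Z t w" if "sol Y" "sol Z" "dominated Y Z" for Y Z
    using that by (intro AE_all_le_of_right_continuous solD(1)) (auto simp: dominated_def)
  have crra: "EZ_CRRA_order R M F C V"
    unfolding EZ_CRRA_order_def V' X_eq[symmetric]
  proof (rule exI[of _ "lo * k"], rule exI[of _ "hi * K"], intro conjI allI impI)
    show "0 < lo * k" "lo * k \<le> hi * K"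
      using lo_hi k hi_pos by (auto intro: mult_mono)
    fix t :: real assume t: "0 \<le> t"
    have "AE w in M. lo * X t w \<le> W t w" "AE w in M. W t w \<le> hi * X t w"
      using W_lo W_hi t by (auto simp: dominated_def)
    then show "AE w in M. lo * k * Jproc M F X t w \<le> W t w \<and> W t w \<le> hi * K * Jproc M F X t w"
      using J_bounds[OF t]
    proof eventually_elim
      case (elim w)
      have "lo * (k * Jproc M F X t w) \<le> lo * X t w" "hi * X t w \<le> hi * (K * Jproc M F X t w)"
        using elim lo_hi hi_pos by (auto intro!: mult_left_mono)
      then show ?case using elim by (simp add: mult.assoc)
    qed
  qed
  have extremal: "EZ_extremal R S M F C V"
    unfolding EZ_extremal_def V' EZ_solution_iff using AE_all[OF _ W(1) max] by blast
  have proper: "EZ_proper R M F C V"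
    unfolding EZ_proper_def V'
  proof (intro allI impI)
    fix t :: real assume "0 \<le> t"
    from bracketed_pos[OF W(2) this]
    show "AE w in M. 0 < Jproc M F (\<lambda>s w'. C s w' powr (1 - R)) t w \<longrightarrow> 0 < W t w"
      by eventually_elim simp
  qed
  have unique: "indistinguishable M V V'"
    if sol': "EZ_solution R S M F C V'"
      and cases: "EZ_CRRA_order R M F C V' \<or> EZ_extremal R S M F C V' \<or> EZ_proper R M F C V'" for V'
  proof -
    let ?Y = "\<lambda>s w. (1 - R) * V' s w"
    have Y: "sol ?Y" using sol' by (simp add: EZ_solution_iff)
    \<comment> \<open>In each of the three cases it suffices to bound \<open>W\<close> from above by
      \<open>?Y\<close>, since \<open>?Y \<le> W\<close> holds for every solution by
      \<open>max\<close>.\<close>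
    have "AE w in M. \<forall>t\<ge>0. W t w \<le> ?Y t w"
      using cases
    proof (elim disjE)
      assume "EZ_extremal R S M F C V'"
      then show ?thesis using V_sol by (auto simp: EZ_extremal_def V')
    next
      assume "EZ_CRRA_order R M F C V'"
      then obtain c c' where c: "0 < c"
        "\<And>t. 0 \<le> t \<Longrightarrow> AE w in M. c * Jproc M F X t w \<le> ?Y t w \<and> ?Y t w \<le> c' * Jproc M F X t w"
        unfolding EZ_CRRA_order_def X_eq by blast
      \<comment> \<open>The constant comes from the chain \<open>W \<le> hi X \<le> hi K J\<close>
        and \<open>c J \<le> ?Y\<close>.\<close>
      have "dominated W (\<lambda>s w. (hi * K / c) * ?Y s w)"
        unfolding dominated_def
      proof (intro allI impI)
        fix t :: real assume t: "0 \<le> t"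
        have "AE w in M. W t w \<le> hi * X t w" using W_hi t by (simp add: dominated_def)
        then show "AE w in M. W t w \<le> (hi * K / c) * ?Y t w"
          using J_bounds[OF t] c(2)[OF t]
        proof eventually_elim
          case (elim w)
          have "hi * X t w \<le> hi * (K * Jproc M F X t w)"
            using elim hi_pos by (intro mult_left_mono) auto
          also have "\<dots> = (hi * K / c) * (c * Jproc M F X t w)" using c by simp
          also have "\<dots> \<le> (hi * K / c) * ?Y t w"
            using elim c k hi_pos by (intro mult_left_mono) auto
          finally show ?case using elim by simp
        qed
      qed
      then have "dominated W ?Y"
        using c k hi_pos by (intro sol_dominated[OF W(1) Y, of "hi * K / c"]) auto
      then show ?thesis by (rule AE_all[OF W(1) Y])
    next
      assume p: "EZ_proper R M F C V'"
      have "AE w in M. 0 < ?Y t w" if t: "0 \<le> t" for t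
      proof -
        have "AE w in M. Jproc M F X t w > 0 \<longrightarrow> 0 < ?Y t w"
          using p t by (simp add: EZ_proper_def X_eq)
        with J_pos[OF t] show ?thesis by eventually_elim simp
      qed
      then have "dominated W (\<lambda>s w. \<theta> powr \<theta> * ?Y s w)"
        by (intro positive_sol_lower[OF Y W(1)] bracketed_pos[OF W(2)])
      then have "dominated W ?Y"
        using \<theta>_pos by (intro sol_dominated[OF W(1) Y, of "\<theta> powr \<theta>"]) auto
      then show ?thesis by (rule AE_all[OF W(1) Y])
    qed
    moreover have "AE w in M. \<forall>t\<ge>0. ?Y t w \<le> W t w"
      by (rule AE_all[OF Y W(1) max[OF Y]])
    ultimately show ?thesis
      unfolding indistinguishable_def
    proof eventually_elim
      case (elim w)
      show ?case
      proof (intro allI impI)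
        fix t :: real assume "0 \<le> t"
        then have "(1 - R) * V' t w = (1 - R) * V t w"
          unfolding V' using elim by (auto intro: antisym)
        then show "V t w = V' t w" using R by simp
      qed
    qed
  qed
  show ?thesis
    using V_sol crra extremal proper unique by blast
qed

end

theorem theorem4p6:
  fixes M :: "'a measure" and F :: "real \<Rightarrow> 'a measure"
    and R S :: real and C :: "real \<Rightarrow> 'a \<Rightarrow> real"
  assumes filt: "usual_filtration M F"
    and R: "R > 0" "R \<noteq> 1" and S: "S > 0" "S \<noteq> 1"
    and theta: "EZ_theta R S > 1"
    and C_prog: "Pplus M F C"
    and C_SO: "SO_plus M F (\<lambda>t \<omega>. C t \<omega> powr (1 - R))"
  shows "\<exists>V. EZ_solution R S M F C V
            \<and> EZ_CRRA_order R M F C V \<and> EZ_extremal R S M F C V \<and> EZ_proper R M F C V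
            \<and> (\<forall>W. EZ_solution R S M F C W
                   \<and> (EZ_CRRA_order R M F C W \<or> EZ_extremal R S M F C W \<or> EZ_proper R M F C W)
                   \<longrightarrow> indistinguishable M V W)"
proof -
  interpret usual_filtered M F by unfold_locales (rule filt)
  let ?X = "\<lambda>t \<omega>. C t \<omega> powr (1 - R)"
  obtain \<nu> where \<nu>: "0 < \<nu>" "SO M F ?X" "SO M F (\<lambda>t \<omega>. exp (\<nu> * t) * ?X t \<omega>)"
    using C_SO by (auto simp: SO_plus_def SO_nu_def)
  obtain k K where kK: "Pplus M F ?X" "tail (space M) ?X 0 < \<infinity>" "0 < k" "k \<le> K"
    "\<And>t A. 0 \<le> t \<Longrightarrow> A \<in> sets (F t) \<Longrightarrow> ennreal k * tail A ?X t \<le> mass A ?X t"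
    "\<And>t A. 0 \<le> t \<Longrightarrow> A \<in> sets (F t) \<Longrightarrow> mass A ?X t \<le> ennreal K * tail A ?X t"
    by (rule SO_massD[OF \<nu>(2)]) (rule that; blast)
  let ?E = "\<lambda>t \<omega>. exp (\<nu> * t) * ?X t \<omega>"
  obtain k' K' where kK': "Pplus M F ?E" "tail (space M) ?E 0 < \<infinity>" "0 < k'" "k' \<le> K'"
    "\<And>t A. 0 \<le> t \<Longrightarrow> A \<in> sets (F t) \<Longrightarrow> ennreal k' * tail A ?E t \<le> mass A ?E t"
    "\<And>t A. 0 \<le> t \<Longrightarrow> A \<in> sets (F t) \<Longrightarrow> mass A ?E t \<le> ennreal K' * tail A ?E t"
    by (rule SO_massD[OF \<nu>(3)]) (rule that; blast)
  \<comment> \<open>Strict positivity of the power comes from membership in SO; \<open>C\<close>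
    itself is assumed nonnegative, and a zero of \<open>C\<close> would make the power 0.\<close>
  have pos: "0 < ?X t \<omega>" if "0 \<le> t" "\<omega> \<in> space M" for t \<omega>
    using \<nu>(2) that by (simp only: SO_def Ppp_def)
  have \<rho>: "0 < EZ_rho R S" "EZ_rho R S < 1" "EZ_theta R S * (1 - EZ_rho R S) = 1"
    using theta by (simp_all add: EZ_rho_def field_simps)
  interpret ez_setting M F ?X "EZ_theta R S" "EZ_rho R S" k K \<nu> k' C R S
    by unfold_locales (use kK kK' pos \<rho> \<nu>(1) R S in auto)
  show ?thesis by (rule unique_solution)
qed

end
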